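(* The topological isomorphism relation between automorphism groups of countable $\omega$-categorical structures with weak elimination of imaginaries is smooth. That is, let $\mathcal{W}$ be the Borel set of all closed subgroups $G\leq \mathrm{Sym}(\omega)$ of the form $G=\mathrm{Aut}(M)$ with $M$ an $\omega$-categorical structure with domain $\omega$ having weak elimination of imaginaries. Then there are a standard Borel space $Y$ and a Borel map $f:\mathcal{W}\to Y$ such that for all $G,H\in\mathcal{W}$: $G$ and $H$ are topologically isomorphic if and only if $f(G)=f(H)$.
   Context: A countable structure is $\omega$-categorical if it is, up to isomorphism, the only countable model of its first-order theory. For a countable structure $M$, $\mathrm{Aut}(M)$ carries the topology whose basic open subgroups are the pointwise stabilizers of finite subsets of $M$. A topological isomorphism is a group isomorphism which is also a homeomorphism. The closed subgroups of $\mathrm{Sym}(\omega)$ form a standard Borel space with the usual (Effros) Borel structure. The automorphism groups of $\omega$-categorical structures with domain $\omega$ are exactly the oligomorphic groups, i.e. the closed subgroups of $\mathrm{Sym}(\omega)$ having only finitely many orbits on $\omega^n$ for every $n<\omega$; they form a Borel subset of this space. Let $M$ be a countable $\omega$-categorical structure and $G=\mathrm{Aut}(M)$. For $A\subseteq M$, $G_{(A)}$ and $G_{\{A\}}$ denote the pointwise and the setwise stabilizer of $A$ in $G$. An element $a\in M$ is algebraic over $A$ if its orbit under $G_{(A)}$ is finite ($A$ finite), and a finite set $A\subseteq M$ is algebraically closed if it contains all elements algebraic over it. $M$ has weak elimination of imaginaries if for every subgroup $H\leq G$ which contains the pointwise stabilizer of a finite set there is a unique smallest finite algebraically closed set $K\subseteq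 M$ such that $G_{(K)}\leq H\leq G_{\{K\}}$. An equivalence relation on a (standard) Borel space is smooth if it is Borel reducible to the equality relation on a Borel space. *)

theory Defs
  imports "HOL-Analysis.Analysis" "HOL-Algebra.Bij"
begin

section \<open>First-order structures over countable languages\<close>

text \<open>
  A symbol is a pair of a name and an arity, so a language over names in \<^typ>\<open>nat\<close> is countable,
  and every countable language is of this form up to renaming.  (Over uncountable languages the
  automorphism group of an \<open>\<omega>\<close>-categorical structure need not be oligomorphic.)
\<close>

record language =
  fun_syms :: "(nat \<times> nat) set"
  rel_syms :: "(nat \<times> nat) set"

datatype fo_term = Var nat | App nat "fo_term list"

datatype fo_formula =
    Equal fo_term fo_term
  | Atom nat "fo_term list"
  | Neg fo_formula
  | Conj fo_formula fo_formula
  | Exist nat fo_formula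

fun term_in :: "language \<Rightarrow> fo_term \<Rightarrow> bool" where
  "term_in L (Var x) \<longleftrightarrow> True"
| "term_in L (App f ts) \<longleftrightarrow> (f, length ts) \<in> fun_syms L \<and> (\<forall>t\<in>set ts. term_in L t)"

fun formula_in :: "language \<Rightarrow> fo_formula \<Rightarrow> bool" where
  "formula_in L (Equal s t) \<longleftrightarrow> term_in L s \<and> term_in L t"
| "formula_in L (Atom r ts) \<longleftrightarrow> (r, length ts) \<in> rel_syms L \<and> (\<forall>t\<in>set ts. term_in L t)"
| "formula_in L (Neg p) \<longleftrightarrow> formula_in L p"
| "formula_in L (Conj p q) \<longleftrightarrow> formula_in L p \<and> formula_in L q"
| "formula_in L (Exist x p) \<longleftrightarrow> formula_in L p"

fun term_vars :: "fo_term \<Rightarrow> nat set" where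
  "term_vars (Var x) = {x}"
| "term_vars (App f ts) = (\<Union>t\<in>set ts. term_vars t)"

fun free_vars :: "fo_formula \<Rightarrow> nat set" where
  "free_vars (Equal s t) = term_vars s \<union> term_vars t"
| "free_vars (Atom r ts) = (\<Union>t\<in>set ts. term_vars t)"
| "free_vars (Neg p) = free_vars p"
| "free_vars (Conj p q) = free_vars p \<union> free_vars q"
| "free_vars (Exist x p) = free_vars p - {x}"

definition sentence :: "language \<Rightarrow> fo_formula \<Rightarrow> bool" where
  "sentence L p \<longleftrightarrow> formula_in L p \<and> free_vars p = {}"

text \<open>Only the values of the interpretations at symbols of the language matter.\<close>

record 'a fo_structure =
  univ :: "'a set"
  fun_interp :: "nat \<Rightarrow> 'a list \<Rightarrow> 'a"
  rel_interp :: "nat \<Rightarrow> 'a list \<Rightarrow> bool"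

definition is_structure :: "language \<Rightarrow> 'a fo_structure \<Rightarrow> bool" where
  "is_structure L M \<longleftrightarrow> univ M \<noteq> {} \<and>
     (\<forall>(f, n)\<in>fun_syms L. \<forall>xs. set xs \<subseteq> univ M \<and> length xs = n \<longrightarrow> fun_interp M f xs \<in> univ M)"

fun eval_term :: "'a fo_structure \<Rightarrow> (nat \<Rightarrow> 'a) \<Rightarrow> fo_term \<Rightarrow> 'a" where
  "eval_term M e (Var x) = e x"
| "eval_term M e (App f ts) = fun_interp M f (map (eval_term M e) ts)"

fun satisfies :: "'a fo_structure \<Rightarrow> (nat \<Rightarrow> 'a) \<Rightarrow> fo_formula \<Rightarrow> bool" where
  "satisfies M e (Equal s t) \<longleftrightarrow> eval_term M e s = eval_term M e t"
| "satisfies M e (Atom r ts) \<longleftrightarrow> rel_interp M r (map (eval_term M e) ts)"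
| "satisfies M e (Neg p) \<longleftrightarrow> \<not> satisfies M e p"
| "satisfies M e (Conj p q) \<longleftrightarrow> satisfies M e p \<and> satisfies M e q"
| "satisfies M e (Exist x p) \<longleftrightarrow> (\<exists>a\<in>univ M. satisfies M (e(x := a)) p)"

definition holds_in :: "'a fo_structure \<Rightarrow> fo_formula \<Rightarrow> bool" where
  "holds_in M p \<longleftrightarrow> (\<forall>e. range e \<subseteq> univ M \<longrightarrow> satisfies M e p)"

definition theory_of :: "language \<Rightarrow> 'a fo_structure \<Rightarrow> fo_formula set" where
  "theory_of L M = {p. sentence L p \<and> holds_in M p}"

definition is_model :: "language \<Rightarrow> fo_formula set \<Rightarrow> 'a fo_structure \<Rightarrow> bool" where
  "is_model L T M \<longleftrightarrow> is_structure L M \<and> (\<forall>p\<in>T. holds_in M p)"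

definition struct_isomorphism ::
    "language \<Rightarrow> 'a fo_structure \<Rightarrow> 'b fo_structure \<Rightarrow> ('a \<Rightarrow> 'b) \<Rightarrow> bool" where
  "struct_isomorphism L M N h \<longleftrightarrow>
     bij_betw h (univ M) (univ N) \<and>
     (\<forall>(f, n)\<in>fun_syms L. \<forall>xs. set xs \<subseteq> univ M \<and> length xs = n \<longrightarrow>
        h (fun_interp M f xs) = fun_interp N f (map h xs)) \<and>
     (\<forall>(r, n)\<in>rel_syms L. \<forall>xs. set xs \<subseteq> univ M \<and> length xs = n \<longrightarrow>
        (rel_interp M r xs \<longleftrightarrow> rel_interp N r (map h xs)))"

text \<open>
  Every countable structure has an isomorphic copy whose universe is a set of natural numbers, so
  it suffices to let \<open>N\<close> range over structures of type \<^typ>\<open>nat fo_structure\<close>.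
\<close>

definition omega_categorical :: "language \<Rightarrow> nat fo_structure \<Rightarrow> bool" where
  "omega_categorical L M \<longleftrightarrow> is_structure L M \<and>
     (\<forall>N :: nat fo_structure. is_model L (theory_of L M) N \<longrightarrow> (\<exists>h. struct_isomorphism L M N h))"

definition Aut :: "language \<Rightarrow> 'a fo_structure \<Rightarrow> ('a \<Rightarrow> 'a) set" where
  "Aut L M = {g \<in> Bij (univ M). struct_isomorphism L M M g}"


section \<open>Weak elimination of imaginaries\<close>

definition pointwise_stabilizer :: "('a \<Rightarrow> 'a) set \<Rightarrow> 'a set \<Rightarrow> ('a \<Rightarrow> 'a) set" where
  "pointwise_stabilizer G A = {g \<in> G. \<forall>a\<in>A. g a = a}"

definition setwise_stabilizer :: "('a \<Rightarrow> 'a) set \<Rightarrow> 'a set \<Rightarrow> ('a \<Rightarrow> 'a) set" where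
  "setwise_stabilizer G A = {g \<in> G. g ` A = A}"

definition algebraic_over :: "('a \<Rightarrow> 'a) set \<Rightarrow> 'a \<Rightarrow> 'a set \<Rightarrow> bool" where
  "algebraic_over G a A \<longleftrightarrow> finite {g a | g. g \<in> pointwise_stabilizer G A}"

definition fin_alg_closed :: "language \<Rightarrow> 'a fo_structure \<Rightarrow> 'a set \<Rightarrow> bool" where
  "fin_alg_closed L M A \<longleftrightarrow> finite A \<and> A \<subseteq> univ M \<and>
     (\<forall>a\<in>univ M. algebraic_over (Aut L M) a A \<longrightarrow> a \<in> A)"

text \<open>The smallest such set (least with respect to inclusion) is unique by antisymmetry.\<close>

definition weak_elim_imaginaries :: "language \<Rightarrow> 'a fo_structure \<Rightarrow> bool" where
  "weak_elim_imaginaries L M \<longleftrightarrow>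
     (let G = Aut L M;
          supports = (\<lambda>H K. fin_alg_closed L M K \<and>
                        pointwise_stabilizer G K \<subseteq> H \<and> H \<subseteq> setwise_stabilizer G K)
      in \<forall>H. subgroup H (BijGroup (univ M) \<lparr>carrier := G\<rparr>) \<and>
             (\<exists>A. finite A \<and> A \<subseteq> univ M \<and> pointwise_stabilizer G A \<subseteq> H) \<longrightarrow>
             (\<exists>!K. supports H K \<and> (\<forall>K'. supports H K' \<longrightarrow> K \<subseteq> K')))"


section \<open>The space of closed subgroups of the symmetric group on the natural numbers\<close>

text \<open>
  The topology of \<open>Sym(\<omega>)\<close> and its subgroups is the one induced by the product topology on
  \<^typ>\<open>nat \<Rightarrow> nat\<close> with \<^typ>\<open>nat\<close> discrete.  The lemma below says that its basic open sets
  are the left cosets of the pointwise stabilizers of finite sets.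
\<close>

abbreviation Sym_omega :: "(nat \<Rightarrow> nat) monoid" where
  "Sym_omega \<equiv> BijGroup UNIV"

lemma openin_pointwise_iff:
  fixes G U :: "(nat \<Rightarrow> nat) set"
  shows "openin (top_of_set G) U \<longleftrightarrow>
    U \<subseteq> G \<and> (\<forall>g\<in>U. \<exists>A. finite A \<and> {h \<in> G. \<forall>a\<in>A. h a = g a} \<subseteq> U)"
proof
  assume "openin (top_of_set G) U"
  then obtain V where V: "open V" "U = G \<inter> V"
    by (auto simp: openin_open)
  show "U \<subseteq> G \<and> (\<forall>g\<in>U. \<exists>A. finite A \<and> {h \<in> G. \<forall>a\<in>A. h a = g a} \<subseteq> U)"
  proof (intro conjI ballI)
    fix g assume g: "g \<in> U"
    have "openin (product_topology (\<lambda>i::nat. euclidean :: nat topology) UNIV) V"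
      using V(1) by (simp add: open_fun_def)
    then obtain X where X: "finite {i. X i \<noteq> (UNIV :: nat set)}" "g \<in> PiE UNIV X" "PiE UNIV X \<subseteq> V"
      using g V(2) by (auto simp: openin_product_topology_alt)
    have "{h \<in> G. \<forall>a\<in>{i. X i \<noteq> UNIV}. h a = g a} \<subseteq> U"
    proof
      fix h assume h: "h \<in> {h \<in> G. \<forall>a\<in>{i. X i \<noteq> UNIV}. h a = g a}"
      have "h i \<in> X i" for i
        using h X(2) by (cases "X i = UNIV") (auto simp: PiE_iff)
      then show "h \<in> U" using h X(3) V(2) by (auto simp: PiE_iff)
    qed
    then show "\<exists>A. finite A \<and> {h \<in> G. \<forall>a\<in>A. h a = g a} \<subseteq> U"
      using X(1) by blast
  qed (use V in blast)
next
  assume R: "U \<subseteq> G \<and> (\<forall>g\<in>U. \<exists>A. finite A \<and> {h \<in> G. \<forall>a\<in>A. h a = g a} \<subseteq> U)"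
  show "openin (top_of_set G) U"
  proof (subst openin_subopen, intro ballI)
    fix g assume g: "g \<in> U"
    then obtain A where A: "finite A" "{h \<in> G. \<forall>a\<in>A. h a = g a} \<subseteq> U"
      using R by blast
    have "open (\<Inter>a\<in>A. {h :: nat \<Rightarrow> nat. h a = g a})"
    proof (rule open_INT[OF A(1)], rule ballI)
      fix a
      have "open ((\<lambda>h :: nat \<Rightarrow> nat. h a) -` {g a})"
        by (rule open_vimage) (auto simp: open_discrete)
      then show "open {h :: nat \<Rightarrow> nat. h a = g a}" by (simp add: vimage_def)
    qed
    then have "openin (top_of_set G) (G \<inter> (\<Inter>a\<in>A. {h. h a = g a}))"
      by blast
    moreover have "G \<inter> (\<Inter>a\<in>A. {h. h a = g a}) = {h \<in> G. \<forall>a\<in>A. h a = g a}"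
      by blast
    ultimately show "\<exists>T. openin (top_of_set G) T \<and> g \<in> T \<and> T \<subseteq> U"
      using A(2) g R by (intro exI[of _ "{h \<in> G. \<forall>a\<in>A. h a = g a}"]) auto
  qed
qed

definition closed_subgroups :: "(nat \<Rightarrow> nat) set set" where
  "closed_subgroups =
     {G. subgroup G Sym_omega \<and> closedin (top_of_set (carrier Sym_omega)) G}"

definition Effros :: "(nat \<Rightarrow> nat) set measure" where
  "Effros = sigma closed_subgroups
     {{G \<in> closed_subgroups. G \<inter> U \<noteq> {}} | U. openin (top_of_set (carrier Sym_omega)) U}"

definition topologically_isomorphic :: "(nat \<Rightarrow> nat) set \<Rightarrow> (nat \<Rightarrow> nat) set \<Rightarrow> bool" where
  "topologically_isomorphic G H \<longleftrightarrow>
     (\<exists>\<phi>. \<phi> \<in> iso (Sym_omega \<lparr>carrier := G\<rparr>) (Sym_omega \<lparr>carrier := H\<rparr>) \<and>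
          homeomorphic_map (top_of_set G) (top_of_set H) \<phi>)"

definition WEI_groups :: "(nat \<Rightarrow> nat) set set" where
  "WEI_groups = {G \<in> closed_subgroups.
     \<exists>L M. univ M = UNIV \<and> omega_categorical L M \<and> weak_elim_imaginaries L M \<and> G = Aut L M}"


section \<open>Standard Borel spaces\<close>

definition standard_borel :: "'a measure \<Rightarrow> bool" where
  "standard_borel Y \<longleftrightarrow>
     (\<exists>X. completely_metrizable_space X \<and> second_countable X \<and> topspace X = space Y \<and>
          sets Y = sigma_sets (topspace X) {U. openin X U})"

end

theory Submission
  imports Defs
begin

text \<open>
  By the theorem of Ryll-Nardzewski, the groups in question are exactly the closed oligomorphic groups
  \<open>G\<close> with weak elimination of imaginaries.  Every open subgroup of an oligomorphic group is coded
  by finitely many tuples, so this is a Borel condition.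

  Weak elimination of imaginaries makes the pointwise stabilizers of finite algebraically closed sets
  recognizable in the topological group \<open>G\<close>: they are the open subgroups without proper open
  subgroups of finite index.  Hence \<open>G\<close> is determined, as a topological group, by the
  countable structure of its cosets of such stabilizers, that is, of the partial maps \<open>g|K\<close>
  with \<open>K\<close> finite and algebraically closed, under restriction and composition; \<open>G\<close> is
  recovered as the group of coherent systems of such maps.  Modulo conjugation by \<open>G\<close> there are only
  finitely many partial maps with a given number of restrictions, so this structure is atomic, and
  a countable atomic structure is determined up to isomorphism by its first-order theory.  The theory,
  coded as a real number, is the required invariant.
\<close>

section \<open>Formulas and types\<close>

text \<open>The structure of partial maps may use only relations that can be read off from cosets,
  so neither single points nor the size of a domain may occur in its language. Inclusion can be read
  off: a point outside the domain \<open>K\<close> of a partial map is not algebraic over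
  \<open>K\<close>, so the stabilizer of \<open>K\<close> moves it, and the coset of all extensions
  determines the map. The number of restrictions replaces the size of the domain: it depends on
  inclusion alone, and a finite algebraically closed set with at most \<open>n\<close> algebraically
  closed subsets is generated by at most \<open>n\<close> points, hence by oligomorphy has bounded
  size. Since the number of restrictions is unbounded on the whole structure, the structure is not
  itself omega-categorical, and atomicity is the right substitute. Measurability is arranged in the
  same spirit: every condition on \<open>G\<close> is built by countable logical operations from
  statements that some element of \<open>G\<close> has a property depending on its values at
  finitely many points.\<close>

instance fo_term :: countable
  by countable_datatype

instance fo_formula :: countable
  by countable_datatype

lemma eval_term_cong:
  "(\<And>x. x \<in> term_vars t \<Longrightarrow> e x = e' x) \<Longrightarrow> eval_term M e t = eval_term M e' t"
proof (induction t)
  case (App f ts)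
  then have "map (eval_term M e) ts = map (eval_term M e') ts"
    by auto
  then show ?case by (simp only: eval_term.simps)
qed simp

lemma satisfies_cong:
  "(\<And>x. x \<in> free_vars \<phi> \<Longrightarrow> e x = e' x) \<Longrightarrow> satisfies M e \<phi> \<longleftrightarrow> satisfies M e' \<phi>"
proof (induction \<phi> arbitrary: e e')
  case (Equal s t)
  then show ?case using eval_term_cong[of s e e' M] eval_term_cong[of t e e' M] by auto
next
  case (Atom r ts)
  then have "map (eval_term M e) ts = map (eval_term M e') ts"
    by (auto intro!: eval_term_cong)
  then show ?case by (simp only: satisfies.simps)
next
  case (Exist x p)
  have "satisfies M (e(x := a)) p \<longleftrightarrow> satisfies M (e'(x := a)) p" for a
    by (rule Exist.IH) (use Exist.prems in auto)
  then show ?case by simp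
next
  case (Conj p q)
  have "satisfies M e p \<longleftrightarrow> satisfies M e' p" "satisfies M e q \<longleftrightarrow> satisfies M e' q"
    by (rule Conj.IH(1); use Conj.prems in auto) (rule Conj.IH(2); use Conj.prems in auto)
  then show ?case by simp
next
  case (Neg p)
  have "satisfies M e p \<longleftrightarrow> satisfies M e' p"
    by (rule Neg.IH) (use Neg.prems in auto)
  then show ?case by simp
qed

lemma finite_term_vars: "finite (term_vars t)"
  by (induction t) auto

lemma finite_free_vars: "finite (free_vars \<phi>)"
  by (induction \<phi>) (auto simp: finite_term_vars)

definition env :: "'a fo_structure \<Rightarrow> (nat \<Rightarrow> 'a) set" where
  "env M = {e. range e \<subseteq> univ M}"

lemma env_upd: "e \<in> env M \<Longrightarrow> a \<in> univ M \<Longrightarrow> e(x := a) \<in> env M"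
  by (auto simp: env_def)

lemma env_comp: "e \<in> env M \<Longrightarrow> e \<circ> \<sigma> \<in> env M"
  by (auto simp: env_def)

lemma env_in: "e \<in> env M \<Longrightarrow> e i \<in> univ M"
  by (auto simp: env_def)

lemma eval_term_in:
  assumes "is_structure L M" "e \<in> env M"
  shows "term_in L t \<Longrightarrow> eval_term M e t \<in> univ M"
proof (induction t)
  case (App f ts)
  then have "set (map (eval_term M e) ts) \<subseteq> univ M" by auto
  then show ?case using App.prems assms(1) unfolding is_structure_def by fastforce
qed (use assms(2) in \<open>auto simp: env_def\<close>)

lemma struct_isomorphism_fun:
  "struct_isomorphism L M N h \<Longrightarrow> (f, length xs) \<in> fun_syms L \<Longrightarrow> set xs \<subseteq> univ M \<Longrightarrow>
    h (fun_interp M f xs) = fun_interp N f (map h xs)"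
  unfolding struct_isomorphism_def by blast

lemma struct_isomorphism_rel:
  "struct_isomorphism L M N h \<Longrightarrow> (r, length xs) \<in> rel_syms L \<Longrightarrow> set xs \<subseteq> univ M \<Longrightarrow>
    rel_interp M r xs \<longleftrightarrow> rel_interp N r (map h xs)"
  unfolding struct_isomorphism_def by blast

lemma struct_isomorphismI:
  assumes "bij_betw h (univ M) (univ N)"
    and "\<And>f xs. (f, length xs) \<in> fun_syms L \<Longrightarrow> set xs \<subseteq> univ M \<Longrightarrow>
      h (fun_interp M f xs) = fun_interp N f (map h xs)"
    and "\<And>r xs. (r, length xs) \<in> rel_syms L \<Longrightarrow> set xs \<subseteq> univ M \<Longrightarrow>
      rel_interp M r xs \<longleftrightarrow> rel_interp N r (map h xs)"
  shows "struct_isomorphism L M N h"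
  unfolding struct_isomorphism_def using assms by auto

lemma fun_interp_in:
  "is_structure L M \<Longrightarrow> (f, length xs) \<in> fun_syms L \<Longrightarrow> set xs \<subseteq> univ M \<Longrightarrow> fun_interp M f xs \<in> univ M"
  unfolding is_structure_def by blast

lemma isomorphism_eval:
  assumes "struct_isomorphism L M N h" "is_structure L M" "e \<in> env M"
  shows "term_in L t \<Longrightarrow> h (eval_term M e t) = eval_term N (h \<circ> e) t"
proof (induction t)
  case (App f ts)
  have "set (map (eval_term M e) ts) \<subseteq> univ M"
    using App.prems eval_term_in[OF assms(2,3)] by auto
  then have "h (fun_interp M f (map (eval_term M e) ts)) = fun_interp N f (map h (map (eval_term M e) ts))"
    using App.prems by (intro struct_isomorphism_fun[OF assms(1)]) auto
  also have "map h (map (eval_term M e) ts) = map (eval_term N (h \<circ> e)) ts"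
    using App by (simp add: o_def)
  finally show ?case by (simp only: eval_term.simps)
qed simp

lemma isomorphism_satisfies:
  assumes "struct_isomorphism L M N h" "is_structure L M"
  shows "formula_in L \<phi> \<Longrightarrow> e \<in> env M \<Longrightarrow> satisfies M e \<phi> \<longleftrightarrow> satisfies N (h \<circ> e) \<phi>"
proof (induction \<phi> arbitrary: e)
  case (Equal s t)
  have "inj_on h (univ M)" using assms(1) by (auto simp: struct_isomorphism_def bij_betw_def)
  then show ?case
    using Equal.prems(1) isomorphism_eval[OF assms Equal.prems(2), of s]
      isomorphism_eval[OF assms Equal.prems(2), of t]
      eval_term_in[OF assms(2) Equal.prems(2), of s] eval_term_in[OF assms(2) Equal.prems(2), of t]
    by (metis formula_in.simps(1) inj_on_eq_iff satisfies.simps(1))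
next
  case (Atom r ts)
  have "set (map (eval_term M e) ts) \<subseteq> univ M"
    using Atom.prems eval_term_in[OF assms(2)] by auto
  then have "rel_interp M r (map (eval_term M e) ts) \<longleftrightarrow> rel_interp N r (map h (map (eval_term M e) ts))"
    using Atom.prems by (intro struct_isomorphism_rel[OF assms(1)]) auto
  also have "map h (map (eval_term M e) ts) = map (eval_term N (h \<circ> e)) ts"
    using Atom isomorphism_eval[OF assms] by auto
  finally show ?case by (simp only: satisfies.simps)
next
  case (Exist x p)
  have *: "satisfies M (e(x := a)) p \<longleftrightarrow> satisfies N ((h \<circ> e)(x := h a)) p" if "a \<in> univ M" for a
    using Exist.IH[of "e(x := a)"] Exist.prems env_upd[OF _ that]
    by (metis formula_in.simps(5) fun_upd_comp)
  have N: "univ N = h ` univ M" using assms(1) by (auto simp: struct_isomorphism_def bij_betw_def)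
  show ?case unfolding satisfies.simps N using * by blast
qed auto

section \<open>Formulas in the first k variables, conjunctions, renaming and quantifier
  blocks\<close>

definition fmla :: "language \<Rightarrow> nat \<Rightarrow> fo_formula set" where
  "fmla L k = {\<phi>. formula_in L \<phi> \<and> free_vars \<phi> \<subseteq> {..<k}}"

lemma satisfies_fmla_cong:
  "\<phi> \<in> fmla L k \<Longrightarrow> (\<And>i. i < k \<Longrightarrow> e i = e' i) \<Longrightarrow> satisfies M e \<phi> \<longleftrightarrow> satisfies M e' \<phi>"
  by (rule satisfies_cong) (auto simp: fmla_def)

lemma fmla_mono: "\<phi> \<in> fmla L k \<Longrightarrow> k \<le> k' \<Longrightarrow> \<phi> \<in> fmla L k'"
  by (force simp: fmla_def)

lemma fmla_bound:
  assumes "formula_in L \<phi>"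
  obtains k where "\<phi> \<in> fmla L k" "m \<le> k"
proof -
  obtain k0 where "free_vars \<phi> \<subseteq> {..<k0}"
    using finite_free_vars[of \<phi>] finite_nat_iff_bounded by blast
  then have "\<phi> \<in> fmla L (max k0 m)" using assms by (force simp: fmla_def)
  then show ?thesis using that by simp
qed

lemma fmla_Neg: "Neg \<phi> \<in> fmla L k \<longleftrightarrow> \<phi> \<in> fmla L k"
  and fmla_Conj: "Conj \<phi> \<psi> \<in> fmla L k \<longleftrightarrow> \<phi> \<in> fmla L k \<and> \<psi> \<in> fmla L k"
  by (auto simp: fmla_def)

lemma fmla_Exist: "\<phi> \<in> fmla L (Suc k) \<Longrightarrow> Exist k \<phi> \<in> fmla L k"
  by (auto simp: fmla_def less_Suc_eq)

text \<open>There is no truth constant among the formulas, so the empty conjunction is the sentence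
  that some element equals itself. It belongs to every \<open>fmla L k\<close>, including
  \<open>k = 0\<close>, and is true exactly in structures with non-empty universe.\<close>

fun conj_list :: "fo_formula list \<Rightarrow> fo_formula" where
  "conj_list [] = Exist 0 (Equal (Var 0) (Var 0))"
| "conj_list (\<phi> # \<phi>s) = Conj \<phi> (conj_list \<phi>s)"

lemma fmla_conj_list: "set \<phi>s \<subseteq> fmla L k \<Longrightarrow> conj_list \<phi>s \<in> fmla L k"
  by (induction \<phi>s) (auto simp: fmla_def)

lemma satisfies_conj_list:
  "univ M \<noteq> {} \<Longrightarrow> satisfies M e (conj_list \<phi>s) \<longleftrightarrow> (\<forall>\<phi>\<in>set \<phi>s. satisfies M e \<phi>)"
  by (induction \<phi>s) auto

fun rename_term :: "(nat \<Rightarrow> nat) \<Rightarrow> fo_term \<Rightarrow> fo_term" where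
  "rename_term \<sigma> (Var x) = Var (\<sigma> x)"
| "rename_term \<sigma> (App f ts) = App f (map (rename_term \<sigma>) ts)"

text \<open>Substitution of variables. The bound variable is replaced by one above all images of
  free variables of the body, which excludes capture; \<open>insert 0\<close> keeps the maximum
  defined when the body has none.\<close>

fun rename :: "(nat \<Rightarrow> nat) \<Rightarrow> fo_formula \<Rightarrow> fo_formula" where
  "rename \<sigma> (Equal s t) = Equal (rename_term \<sigma> s) (rename_term \<sigma> t)"
| "rename \<sigma> (Atom r ts) = Atom r (map (rename_term \<sigma>) ts)"
| "rename \<sigma> (Neg p) = Neg (rename \<sigma> p)"
| "rename \<sigma> (Conj p q) = Conj (rename \<sigma> p) (rename \<sigma> q)"
| "rename \<sigma> (Exist x p) =
     (let y = Suc (Max (insert 0 (\<sigma> ` free_vars p))) in Exist y (rename (\<sigma>(x := y)) p))"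

lemma term_in_rename: "term_in L t \<Longrightarrow> term_in L (rename_term \<sigma> t)"
  by (induction t) auto

lemma formula_in_rename: "formula_in L \<phi> \<Longrightarrow> formula_in L (rename \<sigma> \<phi>)"
  by (induction \<phi> arbitrary: \<sigma>) (auto simp: term_in_rename Let_def)

lemma term_vars_rename: "term_vars (rename_term \<sigma> t) = \<sigma> ` term_vars t"
  by (induction t) auto

lemma free_vars_rename: "free_vars (rename \<sigma> \<phi>) \<subseteq> \<sigma> ` free_vars \<phi>"
proof (induction \<phi> arbitrary: \<sigma>)
  case (Exist x p)
  show ?case
    using Exist.IH[of "\<sigma>(x := y)" for y] by (fastforce simp: Let_def split: if_splits)
next
  case (Conj p q) then show ?case by fastforce
qed (auto simp: term_vars_rename)

lemma eval_rename: "eval_term M e (rename_term \<sigma> t) = eval_term M (e \<circ> \<sigma>) t"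
proof (induction t)
  case (App f ts)
  then have "map (eval_term M e) (map (rename_term \<sigma>) ts) = map (eval_term M (e \<circ> \<sigma>)) ts" by (simp add: o_def)
  then show ?case by (simp only: eval_term.simps rename_term.simps)
qed auto

lemma satisfies_rename: "satisfies M e (rename \<sigma> \<phi>) \<longleftrightarrow> satisfies M (e \<circ> \<sigma>) \<phi>"
proof (induction \<phi> arbitrary: \<sigma> e)
  case (Atom r ts)
  have "map (eval_term M e) (map (rename_term \<sigma>) ts) = map (eval_term M (e \<circ> \<sigma>)) ts"
    by (auto simp: eval_rename)
  then show ?case by (simp only: satisfies.simps rename.simps)
next
  case (Exist x p)
  define y where "y = Suc (Max (insert 0 (\<sigma> ` free_vars p)))"
  have fresh: "\<sigma> i \<noteq> y" if "i \<in> free_vars p" for i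
  proof -
    have "\<sigma> i \<le> Max (insert 0 (\<sigma> ` free_vars p))"
      using that finite_free_vars[of p] by (intro Max_ge) auto
    then show ?thesis by (simp add: y_def)
  qed
  have "satisfies M (e(y := a)) (rename (\<sigma>(x := y)) p) \<longleftrightarrow> satisfies M ((e \<circ> \<sigma>)(x := a)) p" for a
    unfolding Exist.IH by (rule satisfies_cong) (auto simp: fresh)
  then show ?case by (simp only: rename.simps Let_def y_def[symmetric] satisfies.simps)
qed (auto simp: eval_rename)

text \<open>Binds the variables from \<open>n\<close> to \<open>n + k - 1\<close>, the largest
  innermost, so that each quantifier removes the top variable.\<close>

fun ex_vars :: "nat \<Rightarrow> nat \<Rightarrow> fo_formula \<Rightarrow> fo_formula" where
  "ex_vars n 0 \<phi> = \<phi>"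
| "ex_vars n (Suc k) \<phi> = ex_vars n k (Exist (n + k) \<phi>)"

lemma fmla_ex_vars: "\<phi> \<in> fmla L (n + k) \<Longrightarrow> ex_vars n k \<phi> \<in> fmla L n"
  by (induction k arbitrary: \<phi>) (auto intro: fmla_Exist)

lemma satisfies_ex_vars:
  assumes "\<phi> \<in> fmla L (n + k)" "e \<in> env M"
  shows "satisfies M e (ex_vars n k \<phi>) \<longleftrightarrow> (\<exists>e'\<in>env M. (\<forall>i<n. e' i = e i) \<and> satisfies M e' \<phi>)"
  using assms
proof (induction k arbitrary: \<phi>)
  case 0
  then show ?case using satisfies_fmla_cong[of \<phi> L n] by (metis add_0_right ex_vars.simps(1))
next
  case (Suc k)
  have "Exist (n + k) \<phi> \<in> fmla L (n + k)" using Suc.prems by (auto intro: fmla_Exist)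
  then have "satisfies M e (ex_vars n (Suc k) \<phi>) \<longleftrightarrow>
      (\<exists>e'\<in>env M. (\<forall>i<n. e' i = e i) \<and> (\<exists>a\<in>univ M. satisfies M (e'(n + k := a)) \<phi>))"
    using Suc by simp
  also have "\<dots> \<longleftrightarrow> (\<exists>e'\<in>env M. (\<forall>i<n. e' i = e i) \<and> satisfies M e' \<phi>)"
  proof
    assume "\<exists>e'\<in>env M. (\<forall>i<n. e' i = e i) \<and> (\<exists>a\<in>univ M. satisfies M (e'(n + k := a)) \<phi>)"
    then obtain e' a where "e' \<in> env M" "\<forall>i<n. e' i = e i" "a \<in> univ M" "satisfies M (e'(n + k := a)) \<phi>"
      by blast
    then show "\<exists>e'\<in>env M. (\<forall>i<n. e' i = e i) \<and> satisfies M e' \<phi>"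
      by (intro bexI[of _ "e'(n + k := a)"]) (auto intro: env_upd)
  next
    assume "\<exists>e'\<in>env M. (\<forall>i<n. e' i = e i) \<and> satisfies M e' \<phi>"
    then obtain e' where "e' \<in> env M" "\<forall>i<n. e' i = e i" "satisfies M e' \<phi>" by blast
    then show "\<exists>e'\<in>env M. (\<forall>i<n. e' i = e i) \<and> (\<exists>a\<in>univ M. satisfies M (e'(n + k := a)) \<phi>)"
      by (intro bexI[of _ e'] conjI bexI[of _ "e' (n + k)"]) (auto simp: env_in)
  qed
  finally show ?case .
qed

section \<open>Elementary equivalence\<close>

definition elem_equiv :: "language \<Rightarrow> 'a fo_structure \<Rightarrow> 'b fo_structure \<Rightarrow> bool" where
  "elem_equiv L M N \<longleftrightarrow> (\<forall>p. sentence L p \<longrightarrow> holds_in M p \<longleftrightarrow> holds_in N p)"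

lemma elem_equiv_sym: "elem_equiv L M N \<Longrightarrow> elem_equiv L N M"
  by (auto simp: elem_equiv_def)

lemma sentence_fmla: "sentence L p \<longleftrightarrow> p \<in> fmla L 0"
  by (auto simp: sentence_def fmla_def)

lemma holds_in_iff:
  assumes "sentence L p" "e \<in> env M"
  shows "holds_in M p \<longleftrightarrow> satisfies M e p"
  using assms satisfies_fmla_cong[of p L 0] by (auto simp: holds_in_def env_def sentence_fmla)

lemma env_nonempty: "univ M \<noteq> {} \<Longrightarrow> \<exists>e. e \<in> env M"
  unfolding env_def by force

text \<open>The theory of \<open>M\<close> is complete: a sentence that fails in \<open>M\<close>
  has its negation in the theory and therefore fails in \<open>N\<close>.\<close>

lemma elem_equiv_model:
  assumes "is_structure L M" "is_model L (theory_of L M) N"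
  shows "elem_equiv L M N"
  unfolding elem_equiv_def
proof (intro allI impI)
  fix p assume p: "sentence L p"
  have ne: "univ M \<noteq> {}" "univ N \<noteq> {}" using assms by (auto simp: is_model_def is_structure_def)
  obtain e e' where e: "e \<in> env M" "e' \<in> env N"
    using env_nonempty[OF ne(1)] env_nonempty[OF ne(2)] by blast
  have *: "holds_in M q \<Longrightarrow> holds_in N q" if "sentence L q" for q
    using assms(2) that by (auto simp: is_model_def theory_of_def)
  have "sentence L (Neg p)" using p by (simp add: sentence_fmla fmla_Neg)
  then show "holds_in M p \<longleftrightarrow> holds_in N p"
    using p *[of p] *[of "Neg p"] holds_in_iff[OF _ e(1)] holds_in_iff[OF _ e(2)]
    by (metis satisfies.simps(3))
qed

text \<open>Elementary equivalence concerns sentences only, so a formula valid in \<open>M\<close>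
  is transferred through its universal closure, written as the negation of
  \<open>ex_vars 0 k (Neg \<phi>)\<close>. Implications from isolating formulas are carried from one
  model to another in this way.\<close>

lemma elem_equiv_all:
  assumes "elem_equiv L M N" "univ M \<noteq> {}" "univ N \<noteq> {}" "\<phi> \<in> fmla L k"
    and "\<And>e. e \<in> env M \<Longrightarrow> satisfies M e \<phi>" and "e' \<in> env N"
  shows "satisfies N e' \<phi>"
proof -
  let ?p = "Neg (ex_vars 0 k (Neg \<phi>))"
  have N: "Neg \<phi> \<in> fmla L (0 + k)" using assms(4) by (simp add: fmla_Neg)
  have p: "sentence L ?p" unfolding sentence_fmla fmla_Neg by (rule fmla_ex_vars[OF N])
  obtain e where e: "e \<in> env M" using env_nonempty[OF assms(2)] by blast
  have "satisfies M e ?p" using satisfies_ex_vars[OF N e] assms(5) by auto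
  then have "holds_in N ?p" using holds_in_iff[OF p e] p assms(1) by (simp add: elem_equiv_def)
  then have "satisfies N e' ?p" using holds_in_iff[OF p assms(6)] by blast
  then show ?thesis using satisfies_ex_vars[OF N assms(6)] assms(6) by auto
qed

lemma isomorphism_elem_equiv:
  assumes "struct_isomorphism L M N h" "is_structure L M"
  shows "elem_equiv L M N"
  unfolding elem_equiv_def
proof (intro allI impI)
  fix p assume p: "sentence L p"
  obtain e where e: "e \<in> env M" using assms(2) env_nonempty[of M] by (auto simp: is_structure_def)
  have he: "h \<circ> e \<in> env N" using e assms(1) by (auto simp: env_def struct_isomorphism_def bij_betw_def)
  then show "holds_in M p \<longleftrightarrow> holds_in N p"
    using isomorphism_satisfies[OF assms _ e, of p] p holds_in_iff[OF p e] holds_in_iff[OF p he]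
    by (simp add: sentence_def)
qed

section \<open>Types, isolated types and atomic structures\<close>

definition same_type ::
    "language \<Rightarrow> nat \<Rightarrow> 'a fo_structure \<Rightarrow> (nat \<Rightarrow> 'a) \<Rightarrow> 'b fo_structure \<Rightarrow> (nat \<Rightarrow> 'b) \<Rightarrow> bool" where
  "same_type L k M e N e' \<longleftrightarrow> (\<forall>\<phi>\<in>fmla L k. satisfies M e \<phi> \<longleftrightarrow> satisfies N e' \<phi>)"

text \<open>The isolating formula is tested on tuples of \<open>M\<close> only. Each implication
  from it to a formula of the type is then a universal statement about \<open>M\<close> and survives
  in every elementarily equivalent structure.\<close>

definition isolated :: "language \<Rightarrow> nat \<Rightarrow> 'a fo_structure \<Rightarrow> (nat \<Rightarrow> 'a) \<Rightarrow> bool" where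
  "isolated L k M e \<longleftrightarrow> (\<exists>\<gamma>\<in>fmla L k. satisfies M e \<gamma> \<and>
     (\<forall>e'\<in>env M. satisfies M e' \<gamma> \<longrightarrow> same_type L k M e' M e))"

definition atomic :: "language \<Rightarrow> 'a fo_structure \<Rightarrow> bool" where
  "atomic L M \<longleftrightarrow> (\<forall>k. \<forall>e\<in>env M. isolated L k M e)"

lemma same_type_sym: "same_type L k M e N e' \<Longrightarrow> same_type L k N e' M e"
  by (auto simp: same_type_def)

lemma same_type_trans: "same_type L k M e N e' \<Longrightarrow> same_type L k N e' K e'' \<Longrightarrow> same_type L k M e K e''"
  by (auto simp: same_type_def)

lemma same_type_cong:
  assumes "same_type L k M e N e'" "\<And>i. i < k \<Longrightarrow> e1 i = e i" "\<And>i. i < k \<Longrightarrow> e1' i = e' i"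
  shows "same_type L k M e1 N e1'"
  unfolding same_type_def
proof
  fix \<phi> assume "\<phi> \<in> fmla L k"
  then show "satisfies M e1 \<phi> \<longleftrightarrow> satisfies N e1' \<phi>"
    using assms satisfies_fmla_cong[of \<phi> L k e1 e M] satisfies_fmla_cong[of \<phi> L k e1' e' N]
    by (auto simp: same_type_def)
qed

lemma same_type_0:
  assumes "elem_equiv L M N" "e \<in> env M" "e' \<in> env N"
  shows "same_type L 0 M e N e'"
  using assms holds_in_iff[OF _ assms(2)] holds_in_iff[OF _ assms(3)]
  by (auto simp: elem_equiv_def same_type_def sentence_fmla)

lemma same_type_mono: "same_type L k M e N e' \<Longrightarrow> j \<le> k \<Longrightarrow> same_type L j M e N e'"
  by (auto simp: same_type_def intro: fmla_mono)

text \<open>The forth step. With \<open>\<gamma>\<close> isolating the type of the extended tuple,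
  \<open>Exist k \<gamma>\<close> belongs to the common type of \<open>e\<close> and
  \<open>e'\<close>, so some \<open>b\<close> satisfies \<open>\<gamma>\<close> in \<open>N\<close>;
  the implications from \<open>\<gamma>\<close> to the other formulas of the type hold in
  \<open>N\<close> as they do in \<open>M\<close>.\<close>

lemma isolated_extend:
  assumes eq: "elem_equiv L M N" and st: "same_type L k M e N e'"
    and e: "e \<in> env M" "e' \<in> env N" and a: "a \<in> univ M"
    and iso: "isolated L (Suc k) M (e(k := a))"
  shows "\<exists>b\<in>univ N. same_type L (Suc k) M (e(k := a)) N (e'(k := b))"
proof -
  obtain \<gamma> where \<gamma>: "\<gamma> \<in> fmla L (Suc k)" "satisfies M (e(k := a)) \<gamma>"
    and \<gamma>': "\<And>e'. e' \<in> env M \<Longrightarrow> satisfies M e' \<gamma> \<Longrightarrow> same_type L (Suc k) M e' M (e(k := a))"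
    using iso by (auto simp: isolated_def)
  have "satisfies M e (Exist k \<gamma>)" using \<gamma>(2) a by auto
  then have "satisfies N e' (Exist k \<gamma>)" using st fmla_Exist[OF \<gamma>(1)] by (simp only: same_type_def)
  then obtain b where b: "b \<in> univ N" "satisfies N (e'(k := b)) \<gamma>" by auto
  have imp: "satisfies N (e'(k := b)) \<phi>" if \<phi>: "\<phi> \<in> fmla L (Suc k)" "satisfies M (e(k := a)) \<phi>" for \<phi>
  proof -
    have "satisfies N (e'(k := b)) (Neg (Conj \<gamma> (Neg \<phi>)))"
    proof (rule elem_equiv_all[OF eq, where k = "Suc k"])
      show "satisfies M e'' (Neg (Conj \<gamma> (Neg \<phi>)))" if "e'' \<in> env M" for e''
        using \<gamma>'[OF that] \<phi> by (auto simp: same_type_def)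
    qed (use a b \<phi>(1) \<gamma>(1) in \<open>auto simp: fmla_Neg fmla_Conj intro: env_upd e\<close>)
    then show ?thesis using b by simp
  qed
  have "same_type L (Suc k) M (e(k := a)) N (e'(k := b))"
    unfolding same_type_def using imp imp[of "Neg \<phi>" for \<phi>] by (auto simp: fmla_Neg)
  then show ?thesis using b by blast
qed

text \<open>The formula \<open>Equal (Var i) (Var j)\<close> makes the assignment of
  \<open>E' i\<close> to \<open>E i\<close> well defined and injective. Relations are compared by
  atomic formulas, and the value of a function symbol is treated as some \<open>E j\<close>, so that
  an equation describes it.\<close>

lemma isomorphismI_same_type:
  assumes ran: "range E = univ M" "range E' = univ N" and S: "is_structure L M" "is_structure L N"
    and st: "\<And>k. same_type L k M E N E'"
  obtains h where "struct_isomorphism L M N h" "\<And>i. h (E i) = E' i"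
proof -
  have sat: "satisfies M E \<phi> \<longleftrightarrow> satisfies N E' \<phi>" if "formula_in L \<phi>" for \<phi>
    using fmla_bound[OF that] st unfolding same_type_def by metis
  have eq: "E i = E j \<longleftrightarrow> E' i = E' j" for i j
    using sat[of "Equal (Var i) (Var j)"] by simp
  define h where "h a = E' (SOME i. E i = a)" for a
  have h: "h (E i) = E' i" for i
    unfolding h_def using eq by (metis (mono_tags, lifting) someI_ex)
  have idx: "\<exists>is. xs = map E is" if "set xs \<subseteq> univ M" for xs
    using that ran(1) by (metis ex_map_conv subset_iff rangeE)
  have mapE: "map (eval_term M E) (map Var is) = map E is"
    "map (eval_term N E') (map Var is) = map E' is"  for "is" by auto
  have mh: "map h (map E is) = map E' is" for "is" using h by simp
  have "struct_isomorphism L M N h"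
  proof (rule struct_isomorphismI)
    have "inj_on h (univ M)" unfolding ran(1)[symmetric] by (auto simp: inj_on_def h eq)
    moreover have "h ` univ M = univ N" unfolding ran[symmetric] using h by (auto simp: image_iff)
    ultimately show "bij_betw h (univ M) (univ N)" by (simp add: bij_betw_def)
  next
    fix f xs assume f: "(f, length xs) \<in> fun_syms L" "set xs \<subseteq> univ M"
    obtain "is" where xs: "xs = map E is" using idx f(2) by blast
    obtain j where j: "fun_interp M f xs = E j" using fun_interp_in[OF S(1) f] ran(1) by auto
    have "satisfies M E (Equal (App f (map Var is)) (Var j))"
      using j by (simp only: satisfies.simps eval_term.simps mapE xs)
    moreover have "formula_in L (Equal (App f (map Var is)) (Var j))" using f by (auto simp: xs)
    ultimately have "satisfies N E' (Equal (App f (map Var is)) (Var j))" using sat by blast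
    then have "fun_interp N f (map E' is) = E' j"
      by (simp only: satisfies.simps eval_term.simps mapE)
    then show "h (fun_interp M f xs) = fun_interp N f (map h xs)"
      by (simp only: j h, simp only: xs mh)
  next
    fix r xs assume r: "(r, length xs) \<in> rel_syms L" "set xs \<subseteq> univ M"
    obtain "is" where xs: "xs = map E is" using idx r(2) by blast
    have "satisfies M E (Atom r (map Var is)) \<longleftrightarrow> satisfies N E' (Atom r (map Var is))"
      by (rule sat) (use r in \<open>auto simp: xs\<close>)
    then show "rel_interp M r xs \<longleftrightarrow> rel_interp N r (map h xs)"
      by (simp only: satisfies.simps mapE xs mh)
  qed
  then show ?thesis using that[of h] h by blast
qed

text \<open>Back and forth: even stages append the next element of \<open>M\<close>, odd stages that
  of \<open>N\<close>, and isolation of types supplies the partner. The prescribed initial tuples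
  serve two purposes: \<open>k = 0\<close> gives uniqueness of countable atomic models, and
  \<open>M = N\<close> gives automorphisms moving one tuple to another of the same type.\<close>

lemma atomic_unique:
  fixes M :: "'a fo_structure" and N :: "'b fo_structure"
  assumes eq: "elem_equiv L M N" and S: "is_structure L M" "is_structure L N"
    and at: "atomic L M" "atomic L N" and c: "countable (univ M)" "countable (univ N)"
    and st: "same_type L k M e N e'" and e: "e \<in> env M" "e' \<in> env N"
  obtains h where "struct_isomorphism L M N h" "\<And>i. i < k \<Longrightarrow> h (e i) = e' i"
proof -
  have ne: "univ M \<noteq> {}" "univ N \<noteq> {}" using S by (auto simp: is_structure_def)
  define a where "a = from_nat_into (univ M)"
  define b where "b = from_nat_into (univ N)"
  have a: "range a = univ M" "a i \<in> univ M" for i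
    unfolding a_def using ne c by (auto simp: range_from_nat_into from_nat_into)
  have b: "range b = univ N" "b i \<in> univ N" for i
    unfolding b_def using ne c by (auto simp: range_from_nat_into from_nat_into)
  define P where "P n s \<longleftrightarrow> fst s \<in> env M \<and> snd s \<in> env N \<and> same_type L (k + n) M (fst s) N (snd s) \<and>
      (\<forall>i<k. fst s i = e i \<and> snd s i = e' i)" for n and s :: "(nat \<Rightarrow> 'a) \<times> (nat \<Rightarrow> 'b)"
  define Q where "Q n s s' \<longleftrightarrow>
      (\<forall>i<k+n. fst s' i = fst s i \<and> snd s' i = snd s i) \<and>
      (even n \<longrightarrow> fst s' (k + n) = a (n div 2)) \<and> (odd n \<longrightarrow> snd s' (k + n) = b (n div 2))"
    for n and s s' :: "(nat \<Rightarrow> 'a) \<times> (nat \<Rightarrow> 'b)"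
  have "\<exists>s. \<forall>n. P n (s n) \<and> Q n (s n) (s (Suc n))"
  proof (rule dependent_nat_choice)
    show "\<exists>s. P 0 s" using e st by (intro exI[of _ "(e, e')"]) (auto simp: P_def)
  next
    fix s n assume "P n s"
    then have s: "fst s \<in> env M" "snd s \<in> env N" "same_type L (k + n) M (fst s) N (snd s)"
      "\<forall>i<k. fst s i = e i \<and> snd s i = e' i" by (auto simp: P_def)
    show "\<exists>s'. P (Suc n) s' \<and> Q n s s'"
    proof (cases "even n")
      case True
      have "isolated L (Suc (k + n)) M ((fst s)(k + n := a (n div 2)))"
        using at(1) env_upd[OF s(1) a(2)] by (auto simp: atomic_def)
      from isolated_extend[OF eq s(3,1,2) a(2) this]
      obtain y where y: "y \<in> univ N"
        "same_type L (Suc (k + n)) M ((fst s)(k + n := a (n div 2))) N ((snd s)(k + n := y))" by blast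
      have "P (Suc n) ((fst s)(k + n := a (n div 2)), (snd s)(k + n := y))"
        using y s by (auto simp: P_def intro: env_upd a)
      then show ?thesis using True by (intro exI conjI) (auto simp: Q_def)
    next
      case False
      have "isolated L (Suc (k + n)) N ((snd s)(k + n := b (n div 2)))"
        using at(2) env_upd[OF s(2) b(2)] by (auto simp: atomic_def)
      from isolated_extend[OF elem_equiv_sym[OF eq] same_type_sym[OF s(3)] s(2,1) b(2) this]
      obtain y where y: "y \<in> univ M"
        "same_type L (Suc (k + n)) N ((snd s)(k + n := b (n div 2))) M ((fst s)(k + n := y))" by blast
      have "P (Suc n) ((fst s)(k + n := y), (snd s)(k + n := b (n div 2)))"
        using y s same_type_sym[OF y(2)] by (auto simp: P_def intro: env_upd b)
      then show ?thesis using False by (intro exI conjI) (auto simp: Q_def)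
    qed
  qed
  then obtain s where s: "\<And>n. P n (s n)" "\<And>n. Q n (s n) (s (Suc n))" by blast
  \<comment> \<open>Stage \<open>n\<close> has settled the entries below \<open>k + n\<close>, so
    entry \<open>i\<close> is final from stage \<open>Suc i\<close> on, whatever \<open>k\<close>
    is.\<close>
  define E where "E i = fst (s (Suc i)) i" for i
  define E' where "E' i = snd (s (Suc i)) i" for i
  have stab: "i < k + n \<Longrightarrow> fst (s (n + m)) i = fst (s n) i \<and> snd (s (n + m)) i = snd (s n) i" for i n m
  proof (induction m)
    case (Suc m)
    then show ?case using s(2)[of "n + m"] by (auto simp: Q_def)
  qed simp
  have agree: "fst (s n) i = E i \<and> snd (s n) i = E' i" if "i < k + n" for i n
    using stab[of i n "Suc i"] stab[of i "Suc i" n] that unfolding E_def E'_def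
    by (simp add: add.commute)
  have "a j \<in> range E" for j
    using s(2)[of "2 * j"] agree[of "k + 2 * j" "Suc (2 * j)"]
    by (auto simp: Q_def intro: range_eqI[where x = "k + 2 * j"])
  moreover have "E i \<in> univ M" for i
    using s(1)[of "Suc i"] env_in[of "fst (s (Suc i))" M i] by (simp add: E_def P_def)
  ultimately have ranE: "range E = univ M" using a(1) by (auto simp: set_eq_iff image_iff) metis
  have "b j \<in> range E'" for j
    using s(2)[of "2 * j + 1"] agree[of "k + (2 * j + 1)" "Suc (2 * j + 1)"]
    by (auto simp: Q_def intro: range_eqI[where x = "k + (2 * j + 1)"])
  moreover have "E' i \<in> univ N" for i
    using s(1)[of "Suc i"] env_in[of "snd (s (Suc i))" N i] by (simp add: E'_def P_def)
  ultimately have ranE': "range E' = univ N" using b(1) by (auto simp: set_eq_iff image_iff) metis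
  have "same_type L n M E N E'" for n
  proof (rule same_type_mono)
    show "same_type L (k + n) M E N E'"
      by (rule same_type_cong[of _ _ _ "fst (s n)" _ "snd (s n)"])
        (use s(1)[of n] agree[of _ n] in \<open>auto simp: P_def\<close>)
  qed simp
  then obtain h where h: "struct_isomorphism L M N h" "\<And>i. h (E i) = E' i"
    using isomorphismI_same_type[OF ranE ranE' S] by blast
  have "h (e i) = e' i" if "i < k" for i
    using h(2)[of i] agree[of i 0] s(1)[of 0] that by (simp add: P_def)
  then show ?thesis using that[of h] h(1) by blast
qed

text \<open>To \<open>\<delta>\<close> one adds, for each of the finitely many representatives of
  another type, a formula true of \<open>e\<close> and false of the representative. The members of
  \<open>T\<close> are plain assignments, not necessarily into \<open>M\<close>, so any finite
  family that covers the types will do.\<close>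

lemma isolated_if_finite_types:
  assumes S: "is_structure L M" and \<delta>: "\<delta> \<in> fmla L k" "satisfies M e \<delta>" and e: "e \<in> env M"
    and T: "finite T" "\<And>e'. e' \<in> env M \<Longrightarrow> satisfies M e' \<delta> \<Longrightarrow> \<exists>t\<in>T. same_type L k M e' M t"
  shows "isolated L k M e"
proof -
  have "\<exists>\<psi>\<in>fmla L k. satisfies M e \<psi> \<and> (\<not> same_type L k M e M t \<longrightarrow> \<not> satisfies M t \<psi>)" for t
  proof (cases "same_type L k M e M t")
    case False
    then obtain \<phi> where "\<phi> \<in> fmla L k" "satisfies M e \<phi> \<noteq> satisfies M t \<phi>"
      by (auto simp: same_type_def)
    then show ?thesis
      by (intro bexI[of _ "if satisfies M e \<phi> then \<phi> else Neg \<phi>"]) (auto simp: fmla_Neg)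
  qed (use \<delta> in blast)
  then obtain \<psi> where \<psi>: "\<And>t. \<psi> t \<in> fmla L k" "\<And>t. satisfies M e (\<psi> t)"
    "\<And>t. \<not> same_type L k M e M t \<Longrightarrow> \<not> satisfies M t (\<psi> t)" by metis
  obtain ts where ts: "set ts = T" using T(1) finite_list by blast
  have ne: "univ M \<noteq> {}" using S by (auto simp: is_structure_def)
  define \<gamma> where "\<gamma> = Conj \<delta> (conj_list (map \<psi> ts))"
  have \<gamma>: "satisfies M e' \<gamma> \<longleftrightarrow> satisfies M e' \<delta> \<and> (\<forall>t\<in>T. satisfies M e' (\<psi> t))" for e'
    using ne by (simp add: \<gamma>_def satisfies_conj_list ts)
  have "\<gamma> \<in> fmla L k" unfolding \<gamma>_def fmla_Conj using \<delta> \<psi> by (auto intro!: fmla_conj_list)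
  moreover have "same_type L k M e' M e" if e': "e' \<in> env M" "satisfies M e' \<gamma>" for e'
  proof -
    obtain t where t: "t \<in> T" "same_type L k M e' M t" using T(2)[OF e'(1)] e'(2) \<gamma> by blast
    then have "satisfies M t (\<psi> t)" using e'(2) \<gamma> \<psi>(1) by (auto simp: same_type_def)
    then have "same_type L k M e M t" using \<psi>(3) by blast
    then show ?thesis using same_type_trans[OF t(2) same_type_sym] by blast
  qed
  ultimately show ?thesis unfolding isolated_def using \<gamma> \<delta> \<psi> by blast
qed

definition finite_types :: "language \<Rightarrow> 'a fo_structure \<Rightarrow> bool" where
  "finite_types L M \<longleftrightarrow>
     (\<forall>k. \<exists>T. finite T \<and> T \<subseteq> env M \<and> (\<forall>e\<in>env M. \<exists>t\<in>T. same_type L k M e M t))"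

lemma finite_types_atomic:
  assumes "is_structure L M" "finite_types L M"
  shows "atomic L M"
  unfolding atomic_def
proof (intro allI ballI)
  fix k e assume e: "e \<in> env M"
  obtain T where T: "finite T" "\<forall>e\<in>env M. \<exists>t\<in>T. same_type L k M e M t"
    using assms(2) unfolding finite_types_def by blast
  have "satisfies M e (conj_list [])" using assms(1) by (auto simp: is_structure_def)
  moreover have "conj_list [] \<in> fmla L k" by (rule fmla_conj_list) simp
  ultimately show "isolated L k M e"
    using isolated_if_finite_types[OF assms(1) _ _ e T(1)] T(2) by blast
qed

text \<open>Two kinds of universal statements pass from \<open>M\<close> to \<open>N\<close>: every
  \<open>k\<close>-tuple satisfies one of finitely many isolating formulas, and each isolating
  formula implies every formula of its type.\<close>

lemma atomic_elem_equiv: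
  assumes "is_structure L M" "finite_types L M" "elem_equiv L M N" "is_structure L N"
  shows "atomic L N"
  unfolding atomic_def
proof (intro allI ballI)
  fix k e assume e: "e \<in> env N"
  have ne: "univ M \<noteq> {}" "univ N \<noteq> {}" using assms(1,4) by (simp_all add: is_structure_def)
  obtain T where T: "finite T" "T \<subseteq> env M" "\<forall>e\<in>env M. \<exists>t\<in>T. same_type L k M e M t"
    using assms(2)[unfolded finite_types_def, THEN spec, of k] by (elim exE conjE)
  have "\<forall>t\<in>T. isolated L k M t"
    using finite_types_atomic[OF assms(1,2)] T(2) by (auto simp: atomic_def)
  then obtain \<gamma> where \<gamma>: "\<And>t. t \<in> T \<Longrightarrow> \<gamma> t \<in> fmla L k" "\<And>t. t \<in> T \<Longrightarrow> satisfies M t (\<gamma> t)"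
    "\<And>t e'. t \<in> T \<Longrightarrow> e' \<in> env M \<Longrightarrow> satisfies M e' (\<gamma> t) \<Longrightarrow> same_type L k M e' M t"
    unfolding isolated_def by metis
  obtain ts where ts: "set ts = T" using T(1) finite_list by blast
  let ?\<psi> = "Neg (conj_list (map (Neg \<circ> \<gamma>) ts))"
  have "satisfies N e ?\<psi>"
  proof (rule elem_equiv_all[OF assms(3) ne _ _ e])
    show "?\<psi> \<in> fmla L k"
      unfolding fmla_Neg by (rule fmla_conj_list) (auto simp: fmla_Neg ts \<gamma>)
    fix e' assume "e' \<in> env M"
    then obtain t where "t \<in> T" "same_type L k M e' M t" using T(3) by blast
    then show "satisfies M e' ?\<psi>"
      using ne \<gamma>(1,2) by (auto simp: satisfies_conj_list ts same_type_def)
  qed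
  then obtain t where t: "t \<in> T" "satisfies N e (\<gamma> t)"
    using ne by (auto simp: satisfies_conj_list ts)
  have decide: "satisfies N e' \<phi>" if "\<phi> \<in> fmla L k" "satisfies M t \<phi>" "e' \<in> env N" "satisfies N e' (\<gamma> t)" for \<phi> e'
  proof -
    have "satisfies N e' (Neg (Conj (\<gamma> t) (Neg \<phi>)))"
    proof (rule elem_equiv_all[OF assms(3) ne _ _ that(3)])
      show "Neg (Conj (\<gamma> t) (Neg \<phi>)) \<in> fmla L k" using \<gamma> t that by (simp add: fmla_Neg fmla_Conj)
      show "satisfies M e'' (Neg (Conj (\<gamma> t) (Neg \<phi>)))" if "e'' \<in> env M" for e''
        using \<gamma>(3)[OF t(1) that] \<open>satisfies M t \<phi>\<close> \<open>\<phi> \<in> fmla L k\<close> by (auto simp: same_type_def)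
    qed
    then show ?thesis using that(4) by simp
  qed
  have st: "same_type L k N e' M t" if "e' \<in> env N" "satisfies N e' (\<gamma> t)" for e'
    unfolding same_type_def using decide[OF _ _ that] decide[of "Neg \<phi>" for \<phi>, OF _ _ that]
    by (auto simp: fmla_Neg)
  have "same_type L k N e' N e" if "e' \<in> env N" "satisfies N e' (\<gamma> t)" for e'
    by (rule same_type_trans[OF st[OF that] same_type_sym[OF st[OF e t(2)]]])
  then show "isolated L k N e"
    unfolding isolated_def using t \<gamma>(1) by blast
qed

text \<open>A model on natural numbers is countable and, by transfer, atomic; back and forth from
  the empty tuple identifies it with \<open>M\<close>. This half of the theorem of Ryll-Nardzewski
  is applied to the structure of orbits of an oligomorphic group.\<close>

theorem finite_types_omega_categorical:
  fixes M :: "nat fo_structure"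
  assumes "is_structure L M" "finite_types L M"
  shows "omega_categorical L M"
  unfolding omega_categorical_def
proof (intro conjI allI impI)
  fix N :: "nat fo_structure" assume N: "is_model L (theory_of L M) N"
  have eq: "elem_equiv L M N" by (rule elem_equiv_model[OF assms(1) N])
  have SN: "is_structure L N" using N by (simp add: is_model_def)
  obtain e e' where e: "e \<in> env M" "e' \<in> env N"
    using env_nonempty[of M] env_nonempty[of N] assms(1) SN unfolding is_structure_def by blast
  show "\<exists>h. struct_isomorphism L M N h"
    using atomic_unique[OF eq assms(1) SN finite_types_atomic[OF assms] atomic_elem_equiv[OF assms eq SN]
      countableI_type countableI_type same_type_0[OF eq e] e] by blast
qed (rule assms)

section \<open>Automorphism groups of omega-categorical structures are oligomorphic\<close>

subsection \<open>Elementary substructures\<close>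

text \<open>The Tarski-Vaught criterion is taken as the definition; agreement of truth values
  follows by induction in \<open>elementary_satisfies\<close>.\<close>

definition elementary_subset :: "language \<Rightarrow> 'a fo_structure \<Rightarrow> 'a set \<Rightarrow> bool" where
  "elementary_subset L P A \<longleftrightarrow> A \<noteq> {} \<and> A \<subseteq> univ P \<and>
     (\<forall>\<phi> x e. formula_in L \<phi> \<longrightarrow> range e \<subseteq> A \<longrightarrow>
        (\<exists>a\<in>univ P. satisfies P (e(x := a)) \<phi>) \<longrightarrow> (\<exists>a\<in>A. satisfies P (e(x := a)) \<phi>))"

lemma eval_substructure: "eval_term (P\<lparr>univ := A\<rparr>) e t = eval_term P e t"
proof (induction t)
  case (App f ts)
  then have "map (eval_term (P\<lparr>univ := A\<rparr>) e) ts = map (eval_term P e) ts" by auto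
  then show ?case by (simp only: eval_term.simps) simp
qed simp

lemma elementary_satisfies:
  assumes "elementary_subset L P A"
  shows "formula_in L \<phi> \<Longrightarrow> range e \<subseteq> A \<Longrightarrow> satisfies (P\<lparr>univ := A\<rparr>) e \<phi> \<longleftrightarrow> satisfies P e \<phi>"
proof (induction \<phi> arbitrary: e)
  case (Atom r ts)
  have "map (eval_term (P\<lparr>univ := A\<rparr>) e) ts = map (eval_term P e) ts"
    by (auto simp: eval_substructure)
  then show ?case by (simp only: satisfies.simps) simp
next
  case (Exist x p)
  have "satisfies (P\<lparr>univ := A\<rparr>) (e(x := a)) p \<longleftrightarrow> satisfies P (e(x := a)) p" if "a \<in> A" for a
    by (rule Exist.IH) (use Exist.prems that in auto)
  then have "satisfies (P\<lparr>univ := A\<rparr>) e (Exist x p) \<longleftrightarrow> (\<exists>a\<in>A. satisfies P (e(x := a)) p)"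
    by auto
  also have "\<dots> \<longleftrightarrow> (\<exists>a\<in>univ P. satisfies P (e(x := a)) p)"
    using assms Exist.prems unfolding elementary_subset_def by (metis formula_in.simps(5) subset_iff)
  finally show ?case by simp
qed (auto simp: eval_substructure)

text \<open>Closure under a function symbol is an instance of the criterion, applied to the formula
  saying that the last variable is the value.\<close>

lemma elementary_structure:
  assumes "elementary_subset L P A" "is_structure L P"
  shows "is_structure L (P\<lparr>univ := A\<rparr>)"
proof -
  obtain d where d: "d \<in> A" using assms by (auto simp: elementary_subset_def)
  have "fun_interp P f xs \<in> A" if f: "(f, length xs) \<in> fun_syms L" and xs: "set xs \<subseteq> A" for f xs
  proof -
    let ?n = "length xs"
    define e where "e i = (if i < ?n then xs ! i else d)" for i
    have e: "range e \<subseteq> A" using d xs by (auto simp: e_def)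
    let ?\<phi> = "Equal (App f (map Var [0..<?n])) (Var ?n)"
    have m: "map (eval_term P (e(?n := a))) (map Var [0..<?n]) = xs" for a
      by (rule nth_equalityI) (auto simp: e_def)
    have sat: "satisfies P (e(?n := a)) ?\<phi> \<longleftrightarrow> fun_interp P f xs = a" for a
      by (simp only: satisfies.simps eval_term.simps m) simp
    have "fun_interp P f xs \<in> univ P"
      using assms f xs unfolding is_structure_def elementary_subset_def by blast
    then have "\<exists>a\<in>univ P. satisfies P (e(?n := a)) ?\<phi>" using sat by blast
    moreover have "formula_in L ?\<phi>" using f by auto
    ultimately have "\<exists>a\<in>A. satisfies P (e(?n := a)) ?\<phi>"
      using assms(1) e unfolding elementary_subset_def by blast
    then show ?thesis using sat by simp
  qed
  then show ?thesis using d by (auto simp: is_structure_def)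
qed

lemma elementary_equiv:
  assumes "elementary_subset L P A" "is_structure L P"
  shows "elem_equiv L P (P\<lparr>univ := A\<rparr>)"
  unfolding elem_equiv_def
proof (intro allI impI)
  fix p assume p: "sentence L p"
  obtain d where d: "d \<in> A" using assms by (auto simp: elementary_subset_def)
  have e: "(\<lambda>_. d) \<in> env P" "(\<lambda>_. d) \<in> env (P\<lparr>univ := A\<rparr>)"
    using d assms by (auto simp: env_def elementary_subset_def)
  have "satisfies (P\<lparr>univ := A\<rparr>) (\<lambda>_. d) p \<longleftrightarrow> satisfies P (\<lambda>_. d) p"
    by (rule elementary_satisfies[OF assms(1)]) (use p d in \<open>auto simp: sentence_def\<close>)
  then show "holds_in P p \<longleftrightarrow> holds_in (P\<lparr>univ := A\<rparr>) p"
    using holds_in_iff[OF p e(1)] holds_in_iff[OF p e(2)] by simp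
qed

text \<open>A Skolem hull. Only finitely many parameters matter to a formula, so the Skolem function
  \<open>sk\<close> takes a finite list, extended by the default \<open>d\<close>. Formulas,
  variables and lists over a countable set are countably many, hence each stage \<open>B n\<close>
  stays countable.\<close>

theorem downward_loewenheim_skolem:
  assumes "C \<subseteq> univ P" "countable C" "C \<noteq> {}"
  obtains A where "C \<subseteq> A" "countable A" "elementary_subset L P A"
proof -
  obtain d where d: "d \<in> C" using assms by auto
  define ev where "ev l i = (if i < length l then l ! i else d)" for l :: "'a list" and i
  define sk where "sk = (\<lambda>(\<phi>, x, l). if \<exists>a\<in>univ P. satisfies P ((ev l)(x := a)) \<phi>
      then SOME a. a \<in> univ P \<and> satisfies P ((ev l)(x := a)) \<phi> else d)"
  have sk: "sk z \<in> univ P" for z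
  proof -
    obtain \<phi> x l where z: "z = (\<phi>, x, l)" by (cases z)
    show ?thesis
    proof (cases "\<exists>a\<in>univ P. satisfies P ((ev l)(x := a)) \<phi>")
      case True
      then have "\<exists>a. a \<in> univ P \<and> satisfies P ((ev l)(x := a)) \<phi>" by blast
      from someI_ex[OF this] True show ?thesis by (simp add: sk_def z)
    next
      case False then show ?thesis using d assms by (auto simp: sk_def z)
    qed
  qed
  have sk_sat: "satisfies P ((ev l)(x := sk (\<phi>, x, l))) \<phi>"
    if "\<exists>a\<in>univ P. satisfies P ((ev l)(x := a)) \<phi>" for \<phi> x l
  proof -
    have "\<exists>a. a \<in> univ P \<and> satisfies P ((ev l)(x := a)) \<phi>" using that by blast
    from someI_ex[OF this] that show ?thesis by (simp add: sk_def)
  qed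
  define B where "B = rec_nat C (\<lambda>_ N. N \<union> sk ` (UNIV \<times> UNIV \<times> lists N))"
  have B: "B 0 = C" "B (Suc n) = B n \<union> sk ` (UNIV \<times> UNIV \<times> lists (B n))" for n
    by (simp_all add: B_def)
  have cB: "countable (B n)" for n
    by (induction n) (auto simp: B assms intro!: countable_Un countable_image countable_SIGMA countable_lists)
  have mono: "m \<le> n \<Longrightarrow> B m \<subseteq> B n" for m n
    by (rule lift_Suc_mono_le[of B]) (auto simp: B)
  have sub: "B n \<subseteq> univ P" for n
    by (induction n) (use assms sk in \<open>auto simp: B\<close>)
  let ?A = "\<Union>n. B n"
  have fin: "\<exists>n. set l \<subseteq> B n" if "set l \<subseteq> ?A" for l
    using that
  proof (induction l)
    case (Cons a l)
    then obtain n m where "set l \<subseteq> B n" "a \<in> B m" by auto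
    then show ?case using mono[of n "max n m"] mono[of m "max n m"]
      by (intro exI[of _ "max n m"]) auto
  qed simp
  have "elementary_subset L P ?A"
    unfolding elementary_subset_def
  proof (intro conjI allI impI)
    show "?A \<noteq> {}" using d B(1) by blast
    show "?A \<subseteq> univ P" using sub by blast
    fix \<phi> x e assume \<phi>: "formula_in L \<phi>" and e: "range e \<subseteq> ?A"
      and ex: "\<exists>a\<in>univ P. satisfies P (e(x := a)) \<phi>"
    obtain k where k: "\<phi> \<in> fmla L k" using fmla_bound[OF \<phi>] by blast
    let ?l = "map e [0..<k]"
    have "set ?l \<subseteq> ?A" using e by auto
    from fin[OF this] obtain n where n: "set ?l \<subseteq> B n" by blast
    have eq: "satisfies P ((ev ?l)(x := a)) \<phi> \<longleftrightarrow> satisfies P (e(x := a)) \<phi>" for a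
      by (rule satisfies_fmla_cong[OF k]) (auto simp: ev_def)
    have "sk (\<phi>, x, ?l) \<in> B (Suc n)"
      using n unfolding B by (intro UnI2 imageI) (auto simp: in_lists_conv_set)
    moreover have "satisfies P (e(x := sk (\<phi>, x, ?l))) \<phi>"
      using sk_sat[of ?l x \<phi>] ex unfolding eq by blast
    ultimately show "\<exists>a\<in>?A. satisfies P (e(x := a)) \<phi>" by blast
  qed
  moreover have "C \<subseteq> ?A" using B(1) by blast
  moreover have "countable ?A" using cB by blast
  ultimately show ?thesis using that by blast
qed

section \<open>Countable copies and transport along isomorphisms\<close>

lemma countable_copy:
  assumes "is_structure L M" "countable (univ M)"
  obtains N :: "nat fo_structure" and h where "is_structure L N" "struct_isomorphism L M N h"
proof -
  define h where "h = to_nat_on (univ M)"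
  define g where "g = inv_into (univ M) h"
  have inj: "inj_on h (univ M)" unfolding h_def by (rule inj_on_to_nat_on[OF assms(2)])
  have gh: "g (h a) = a" if "a \<in> univ M" for a
    using inj that by (simp add: g_def)
  have mgh: "map g (map h xs) = xs" if "set xs \<subseteq> univ M" for xs
    using that gh by (induction xs) auto
  define N where "N = \<lparr>univ = h ` univ M, fun_interp = (\<lambda>f xs. h (fun_interp M f (map g xs))),
     rel_interp = (\<lambda>r xs. rel_interp M r (map g xs))\<rparr>"
  have "fun_interp N f xs \<in> univ N" if f: "(f, length xs) \<in> fun_syms L" and xs: "set xs \<subseteq> univ N" for f xs
  proof -
    have "set (map g xs) \<subseteq> univ M" using xs gh by (auto simp: N_def)
    then have "fun_interp M f (map g xs) \<in> univ M" using fun_interp_in[OF assms(1)] f by simp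
    then show ?thesis by (simp add: N_def)
  qed
  then have "is_structure L N" using assms(1) by (auto simp: is_structure_def N_def)
  moreover have "struct_isomorphism L M N h"
    unfolding struct_isomorphism_def
    using inj by (auto simp: N_def bij_betw_def mgh simp del: map_map)
  ultimately show ?thesis using that by blast
qed

lemma isomorphism_sym:
  assumes "struct_isomorphism L M N h" "is_structure L M"
  obtains g where "struct_isomorphism L N M g" "\<And>a. a \<in> univ M \<Longrightarrow> g (h a) = a"
    "\<And>b. b \<in> univ N \<Longrightarrow> g b \<in> univ M \<and> h (g b) = b"
proof -
  have bij: "bij_betw h (univ M) (univ N)" using assms by (simp add: struct_isomorphism_def)
  define g where "g = inv_into (univ M) h"
  have gh: "g (h a) = a" if "a \<in> univ M" for a
    using bij that by (simp add: g_def bij_betw_inv_into_left)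
  have hg: "g b \<in> univ M \<and> h (g b) = b" if "b \<in> univ N" for b
    using bij that by (metis bij_betw_inv_into_right bij_betw_imp_surj_on g_def inv_into_into)
  have xs: "set (map g xs) \<subseteq> univ M" "map h (map g xs) = xs" if "set xs \<subseteq> univ N" for xs
    using that hg by (auto intro!: map_idI)
  have "struct_isomorphism L N M g"
  proof (rule struct_isomorphismI)
    show "bij_betw g (univ N) (univ M)" unfolding g_def by (rule bij_betw_inv_into[OF bij])
  next
    fix f ys assume f: "(f, length ys) \<in> fun_syms L" "set ys \<subseteq> univ N"
    have f': "(f, length (map g ys)) \<in> fun_syms L" using f by simp
    show "g (fun_interp N f ys) = fun_interp M f (map g ys)"
      using struct_isomorphism_fun[OF assms(1) f' xs(1)[OF f(2)]] fun_interp_in[OF assms(2) f' xs(1)[OF f(2)]]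
        gh xs(2)[OF f(2)] by metis
  next
    fix r ys assume r: "(r, length ys) \<in> rel_syms L" "set ys \<subseteq> univ N"
    then show "rel_interp N r ys \<longleftrightarrow> rel_interp M r (map g ys)"
      using struct_isomorphism_rel[OF assms(1) _ xs(1)[OF r(2)], of r] xs(2)[OF r(2)] by simp
  qed
  then show ?thesis using that gh hg by blast
qed

text \<open>Categoricity is formulated for models on natural numbers, so a countable
  \<open>N\<close> over another type is first copied there and the two isomorphisms are
  composed.\<close>

lemma omega_categorical_unique:
  assumes "omega_categorical L M" "is_structure L N" "elem_equiv L M N" "countable (univ N)"
  obtains h where "struct_isomorphism L N M h"
proof -
  have M: "is_structure L M" using assms(1) by (simp add: omega_categorical_def)
  obtain N' :: "nat fo_structure" and c where N': "is_structure L N'" "struct_isomorphism L N N' c"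
    using countable_copy[OF assms(2,4)] by blast
  have "elem_equiv L M N'"
    using assms(3) isomorphism_elem_equiv[OF N'(2) assms(2)] by (auto simp: elem_equiv_def)
  then have "is_model L (theory_of L M) N'"
    using N'(1) by (auto simp: is_model_def theory_of_def elem_equiv_def)
  then obtain h where h: "struct_isomorphism L M N' h"
    using assms(1) unfolding omega_categorical_def by blast
  obtain g where g: "struct_isomorphism L N' M g" by (rule isomorphism_sym[OF h M], rule that)
  have c: "set (map c xs) \<subseteq> univ N'" if "set xs \<subseteq> univ N" for xs
    using that N'(2) by (auto simp: struct_isomorphism_def bij_betw_def)
  have "struct_isomorphism L N M (g \<circ> c)"
  proof (rule struct_isomorphismI)
    show "bij_betw (g \<circ> c) (univ N) (univ M)"
      using g N'(2) by (auto simp: struct_isomorphism_def intro: bij_betw_trans)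
    show "(g \<circ> c) (fun_interp N f xs) = fun_interp M f (map (g \<circ> c) xs)"
      if "(f, length xs) \<in> fun_syms L" "set xs \<subseteq> univ N" for f xs
      using struct_isomorphism_fun[OF N'(2) that] struct_isomorphism_fun[OF g, of f "map c xs"]
        c[OF that(2)] that(1) by simp
    show "rel_interp N r xs \<longleftrightarrow> rel_interp M r (map (g \<circ> c) xs)"
      if "(r, length xs) \<in> rel_syms L" "set xs \<subseteq> univ N" for r xs
      using struct_isomorphism_rel[OF N'(2) that] struct_isomorphism_rel[OF g, of r "map c xs"]
        c[OF that(2)] that(1) by simp
  qed
  then show ?thesis using that by blast
qed

subsection \<open>Ultrapowers\<close>

text \<open>Zorn's lemma is applied to families all of whose finite intersections are infinite.
  Demanding infinite rather than non-empty intersections forces a maximal family to contain every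
  final segment.\<close>

lemma nonprincipal_ultrafilter:
  obtains U :: "nat set set" where "\<And>A B. A \<inter> B \<in> U \<longleftrightarrow> A \<in> U \<and> B \<in> U"
    "\<And>A. - A \<in> U \<longleftrightarrow> A \<notin> U" "\<And>n. {n..} \<in> U"
proof -
  define fip where "fip S \<longleftrightarrow> (\<forall>X. finite X \<longrightarrow> X \<subseteq> S \<longrightarrow> infinite (\<Inter>X))" for S :: "nat set set"
  have "\<exists>U\<in>Collect fip. \<forall>X\<in>Collect fip. U \<subseteq> X \<longrightarrow> X = U"
  proof (rule subset_Zorn_nonempty)
    show "Collect fip \<noteq> {}" by (rule ex_in_conv[THEN iffD1], rule exI[of _ "{}"]) (auto simp: fip_def)
    fix C assume C: "C \<noteq> {}" "subset.chain (Collect fip) C"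
    show "\<Union>C \<in> Collect fip"
      unfolding mem_Collect_eq fip_def
    proof (intro allI impI)
      fix X assume X: "finite X" "X \<subseteq> \<Union>C"
      obtain S where "S \<in> C" "X \<subseteq> S"
        using finite_subset_Union_chain[OF X C] by blast
      then show "infinite (\<Inter>X)" using C X(1) by (auto simp: subset.chain_def fip_def)
    qed
  qed
  then obtain U where U: "fip U" and max: "\<And>X. fip X \<Longrightarrow> U \<subseteq> X \<Longrightarrow> X = U" by auto
  have inf: "infinite (\<Inter>X)" if "finite X" "X \<subseteq> U" for X using U that by (auto simp: fip_def)
  \<comment> \<open>By maximality, a set belongs to \<open>U\<close> as soon as it meets every
    finite intersection of members in an infinite set.\<close>
  have mem: "A \<in> U" if "\<And>X. finite X \<Longrightarrow> X \<subseteq> U \<Longrightarrow> infinite (\<Inter>X \<inter> A)" for A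
  proof -
    have "fip (insert A U)"
      unfolding fip_def
    proof (intro allI impI)
      fix X assume X: "finite X" "X \<subseteq> insert A U"
      have "infinite (\<Inter>(X - {A}) \<inter> A)" by (rule that) (use X in auto)
      then show "infinite (\<Inter>X)" by (rule contrapos_nn) (auto elim: finite_subset[rotated])
    qed
    then show ?thesis using max by blast
  qed
  have up: "B \<in> U" if "A \<in> U" "A \<subseteq> B" for A B
  proof (rule mem)
    fix X assume "finite X" "X \<subseteq> U"
    then have "infinite (\<Inter>(insert A X))" by (intro inf) (use that in auto)
    then show "infinite (\<Inter>X \<inter> B)" by (rule contrapos_nn) (use that(2) in \<open>auto elim: finite_subset[rotated]\<close>)
  qed
  have int: "A \<inter> B \<in> U" if "A \<in> U" "B \<in> U" for A B
  proof (rule mem)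
    fix X assume "finite X" "X \<subseteq> U"
    then have "infinite (\<Inter>(insert A (insert B X)))" by (intro inf) (use that in auto)
    then show "infinite (\<Inter>X \<inter> (A \<inter> B))" by (simp add: Int_ac)
  qed
  have "\<not> (A \<in> U \<and> - A \<in> U)" for A using inf[of "{A, - A}"] by auto
  moreover have "A \<in> U \<or> - A \<in> U" for A
  proof (rule ccontr)
    assume n: "\<not> (A \<in> U \<or> - A \<in> U)"
    obtain X where X: "finite X" "X \<subseteq> U" "finite (\<Inter>X \<inter> A)" using mem[of A] n by blast
    obtain Y where Y: "finite Y" "Y \<subseteq> U" "finite (\<Inter>Y \<inter> - A)" using mem[of "- A"] n by blast
    have "infinite (\<Inter>(X \<union> Y))" by (rule inf) (use X Y in auto)
    moreover have "\<Inter>(X \<union> Y) \<subseteq> (\<Inter>X \<inter> A) \<union> (\<Inter>Y \<inter> - A)" by auto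
    ultimately show False using X(3) Y(3) finite_subset by blast
  qed
  moreover have "{n..} \<in> U" for n
  proof (rule mem)
    fix X assume "finite X" "X \<subseteq> U"
    then have "infinite (\<Inter>X)" by (rule inf)
    then have "infinite (\<Inter>X - {..<n})" by simp
    moreover have "\<Inter>X - {..<n} = \<Inter>X \<inter> {n..}" by auto
    ultimately show "infinite (\<Inter>X \<inter> {n..})" by simp
  qed
  ultimately show ?thesis using that[of U] up int by (metis inf_le1 inf_le2)
qed

text \<open>
  The representatives \<open>rep f\<close> replace the quotient by the ultrafilter, so that equality in
  the ultrapower is equality in HOL.
\<close>

lemma countable_realization:
  fixes M :: "nat fo_structure" and \<Phi> :: "nat \<Rightarrow> fo_formula"
  assumes M: "is_structure L M" "univ M = UNIV"
    and \<Phi>: "\<And>j. formula_in L (\<Phi> j)" "\<And>k. \<exists>e. \<forall>j\<le>k. satisfies M e (\<Phi> j)"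
  obtains P :: "(nat \<Rightarrow> nat) fo_structure" and E where "is_structure L P" "elem_equiv L M P"
    "E \<in> env P" "\<And>j. satisfies P E (\<Phi> j)"
proof -
  obtain U :: "nat set set" where Int: "\<And>A B. A \<inter> B \<in> U \<longleftrightarrow> A \<in> U \<and> B \<in> U"
    and Compl: "\<And>A. - A \<in> U \<longleftrightarrow> A \<notin> U" and cofin: "\<And>n. {n..} \<in> U"
    using nonprincipal_ultrafilter by blast
  have up: "B \<in> U" if "A \<in> U" "A \<subseteq> B" for A B
    using Int[of A B] that by (simp add: Int_absorb2)
  \<comment> \<open>\<open>EV Q\<close> says that \<open>Q k\<close> holds for almost all
    \<open>k\<close> in the sense of the ultrafilter.\<close>
  define EV where "EV Q \<longleftrightarrow> {k. Q k} \<in> U" for Q :: "nat \<Rightarrow> bool"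
  have EV_conj: "EV (\<lambda>k. Q k \<and> R k) \<longleftrightarrow> EV Q \<and> EV R" for Q R
    unfolding EV_def using Int[of "Collect Q" "Collect R"] by (simp add: Collect_conj_eq)
  have EV_not: "EV (\<lambda>k. \<not> Q k) \<longleftrightarrow> \<not> EV Q" for Q
    unfolding EV_def using Compl[of "Collect Q"] by (simp add: Collect_neg_eq)
  have EV_mono: "EV R" if "EV Q" "\<And>k. Q k \<Longrightarrow> R k" for Q R
    using up[of "Collect Q" "Collect R"] that unfolding EV_def by blast
  have EV_all: "EV (\<lambda>_. True)" unfolding EV_def using up[OF cofin[of 0]] by simp
  have EV_cong: "EV R \<longleftrightarrow> EV S" if Q: "EV Q" and RS: "\<And>k. Q k \<Longrightarrow> R k \<longleftrightarrow> S k" for Q R S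
  proof -
    have "(\<lambda>k. Q k \<and> R k) = (\<lambda>k. Q k \<and> S k)" using RS by blast
    then have "EV Q \<and> EV R \<longleftrightarrow> EV Q \<and> EV S" using EV_conj by metis
    then show ?thesis using Q by blast
  qed
  have EV_list: "EV (\<lambda>k. \<forall>t\<in>set ts. Q t k)" if "\<And>t. t \<in> set ts \<Longrightarrow> EV (Q t)" for ts and Q :: "fo_term \<Rightarrow> _"
    using that by (induction ts) (auto simp: EV_all EV_conj)
  define rep where "rep f = (SOME g. EV (\<lambda>k. f k = g k))" for f :: "nat \<Rightarrow> nat"
  have rep: "EV (\<lambda>k. f k = rep f k)" for f
    unfolding rep_def by (rule someI[of _ f]) (simp add: EV_all)
  have rep_eq: "rep f = rep g \<longleftrightarrow> EV (\<lambda>k. f k = g k)" for f g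
  proof
    assume eq: "rep f = rep g"
    have "EV (\<lambda>k. f k = rep f k \<and> g k = rep f k)" using rep[of f] rep[of g] eq EV_conj by simp
    then show "EV (\<lambda>k. f k = g k)" by (rule EV_mono) simp
  next
    assume e: "EV (\<lambda>k. f k = g k)"
    have "EV (\<lambda>k. f k = h k) \<longleftrightarrow> EV (\<lambda>k. g k = h k)" for h
      by (rule EV_cong[OF e]) simp
    then show "rep f = rep g" by (simp add: rep_def)
  qed
  define P where "P = \<lparr>univ = range rep,
     fun_interp = (\<lambda>f xs. rep (\<lambda>k. fun_interp M f (map (\<lambda>x. x k) xs))),
     rel_interp = (\<lambda>r xs. EV (\<lambda>k. rel_interp M r (map (\<lambda>x. x k) xs)))\<rparr>"
  have SP: "is_structure L P" by (auto simp: is_structure_def P_def)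
  have ev: "EV (\<lambda>k. eval_term P e t k = eval_term M (\<lambda>i. e i k) t)" for e t
  proof (induction t)
    case (App f ts)
    have "EV (\<lambda>k. (\<forall>t\<in>set ts. eval_term P e t k = eval_term M (\<lambda>i. e i k) t) \<and>
       fun_interp M f (map (\<lambda>x. x k) (map (eval_term P e) ts)) = eval_term P e (App f ts) k)"
      unfolding EV_conj using EV_list[OF App] rep by (simp add: P_def)
    then show ?case
    proof (rule EV_mono)
      fix k assume k: "(\<forall>t\<in>set ts. eval_term P e t k = eval_term M (\<lambda>i. e i k) t) \<and>
         fun_interp M f (map (\<lambda>x. x k) (map (eval_term P e) ts)) = eval_term P e (App f ts) k"
      then have m: "map (\<lambda>x. x k) (map (eval_term P e) ts) = map (eval_term M (\<lambda>i. e i k)) ts" by simp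
      show "eval_term P e (App f ts) k = eval_term M (\<lambda>i. e i k) (App f ts)"
        using k unfolding m eval_term.simps(2)[of M] by simp
    qed
  qed (simp add: EV_all)
  have ran: "eval_term P e t \<in> range rep" if "e \<in> env P" for e t
    using that by (cases t) (auto simp: P_def env_def)
  \<comment> \<open>The theorem of Los. For a quantifier, witnesses are picked coordinatewise and
    then replaced by the representative \<open>rep f\<close>, which differs from them only outside a
    member of \<open>U\<close>.\<close>
  have los: "satisfies P e \<phi> \<longleftrightarrow> EV (\<lambda>k. satisfies M (\<lambda>i. e i k) \<phi>)" if "e \<in> env P" for e \<phi>
    using that
  proof (induction \<phi> arbitrary: e)
    case (Equal s t)
    obtain f g where fg: "eval_term P e s = rep f" "eval_term P e t = rep g"
      using ran[OF Equal.prems] by (meson rangeE)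
    have "EV (\<lambda>k. f k = rep f k \<and> g k = rep g k \<and> rep f k = eval_term M (\<lambda>i. e i k) s \<and>
        rep g k = eval_term M (\<lambda>i. e i k) t)" (is "EV ?Q")
      unfolding EV_conj using rep[of f] rep[of g] ev[of e s] ev[of e t] unfolding fg by blast
    then have "EV (\<lambda>k. f k = g k) \<longleftrightarrow> EV (\<lambda>k. eval_term M (\<lambda>i. e i k) s = eval_term M (\<lambda>i. e i k) t)"
      by (rule EV_cong) auto
    then show ?case by (simp add: fg rep_eq)
  next
    case (Atom r ts)
    have Q: "EV (\<lambda>k. \<forall>t\<in>set ts. eval_term P e t k = eval_term M (\<lambda>i. e i k) t)" (is "EV ?Q")
      by (rule EV_list) (rule ev)
    let ?A = "\<lambda>k. rel_interp M r (map (\<lambda>x. x k) (map (eval_term P e) ts))"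
    let ?B = "\<lambda>k. rel_interp M r (map (eval_term M (\<lambda>i. e i k)) ts)"
    have m: "map (\<lambda>x. x k) (map (eval_term P e) ts) = map (eval_term M (\<lambda>i. e i k)) ts" if "?Q k" for k
      using that by simp
    have "EV ?A \<longleftrightarrow> EV ?B" by (rule EV_cong[OF Q]) (simp only: m)
    then show ?case by (simp add: P_def)
  next
    case (Neg p) then show ?case by (simp add: EV_not)
  next
    case (Conj p q) then show ?case by (simp add: EV_conj)
  next
    case (Exist x p)
    have upd: "(\<lambda>i. (e(x := a)) i k) = (\<lambda>i. e i k)(x := a k)" for a :: "nat \<Rightarrow> nat" and k by auto
    have IH: "satisfies P (e(x := a)) p \<longleftrightarrow> EV (\<lambda>k. satisfies M ((\<lambda>i. e i k)(x := a k)) p)"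
      if "a \<in> univ P" for a
      using Exist.IH[OF env_upd[OF Exist.prems that, of x]] unfolding upd .
    show ?case
    proof
      assume "satisfies P e (Exist x p)"
      then obtain a where "a \<in> univ P" "satisfies P (e(x := a)) p" by auto
      then have "EV (\<lambda>k. satisfies M ((\<lambda>i. e i k)(x := a k)) p)" using IH by blast
      then show "EV (\<lambda>k. satisfies M (\<lambda>i. e i k) (Exist x p))"
        by (rule EV_mono) (unfold satisfies.simps M, blast)
    next
      assume *: "EV (\<lambda>k. satisfies M (\<lambda>i. e i k) (Exist x p))"
      define f where "f k = (SOME a. satisfies M ((\<lambda>i. e i k)(x := a)) p)" for k
      have f: "satisfies M ((\<lambda>i. e i k)(x := f k)) p" if "satisfies M (\<lambda>i. e i k) (Exist x p)" for k
        unfolding f_def by (rule someI_ex) (use that in \<open>unfold satisfies.simps, blast\<close>)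
      have "EV (\<lambda>k. satisfies M ((\<lambda>i. e i k)(x := f k)) p)"
        using * f by (rule EV_mono)
      then have "EV (\<lambda>k. f k = rep f k \<and> satisfies M ((\<lambda>i. e i k)(x := f k)) p)"
        using rep[of f] by (simp add: EV_conj)
      then have "EV (\<lambda>k. satisfies M ((\<lambda>i. e i k)(x := rep f k)) p)"
        by (rule EV_mono) (elim conjE, erule subst)
      moreover have "rep f \<in> univ P" by (simp add: P_def)
      ultimately show "satisfies P e (Exist x p)" using IH by auto
    qed
  qed
  have "elem_equiv L M P"
    unfolding elem_equiv_def
  proof (intro allI impI)
    fix p assume p: "sentence L p"
    obtain e where e: "e \<in> env P" using env_nonempty[of P] by (auto simp: P_def)
    have "holds_in M p \<longleftrightarrow> satisfies M (\<lambda>i. e i k) p" for k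
      by (rule holds_in_iff[OF p]) (simp add: env_def M)
    then have "EV (\<lambda>k. satisfies M (\<lambda>i. e i k) p) \<longleftrightarrow> EV (\<lambda>k. holds_in M p)" by simp
    also have "\<dots> \<longleftrightarrow> holds_in M p" using EV_all EV_not[of "\<lambda>_. True"] by (cases "holds_in M p") auto
    finally show "holds_in M p \<longleftrightarrow> holds_in P p" using holds_in_iff[OF p e] los[OF e] by simp
  qed
  \<comment> \<open>The assignment in coordinate \<open>k\<close> satisfies the formulas with index
    up to \<open>k\<close>. A fixed \<open>\<Phi> j\<close> then holds in all coordinates from
    \<open>j\<close> on, hence almost everywhere, so the classes of these sequences satisfy all
    formulas at once.\<close>
  moreover obtain e where e: "\<And>k j. j \<le> k \<Longrightarrow> satisfies M (e k) (\<Phi> j)" using \<Phi>(2) by metis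
  define E where "E i = rep (\<lambda>k. e k i)" for i
  have E: "E \<in> env P" by (auto simp: env_def E_def P_def)
  moreover have "satisfies P E (\<Phi> j)" for j
  proof -
    obtain m where m: "\<Phi> j \<in> fmla L m" using fmla_bound[OF \<Phi>(1)] by blast
    have "EV (\<lambda>k. \<forall>i<n. e k i = E i k)" for n
    proof (induction n)
      case (Suc n)
      have "EV (\<lambda>k. (\<forall>i<n. e k i = E i k) \<and> e k n = E n k)"
        unfolding EV_conj using Suc rep[of "\<lambda>k. e k n"] by (simp add: E_def)
      then show ?case by (rule EV_mono) (auto simp: less_Suc_eq)
    qed (simp add: EV_all)
    moreover have "EV (\<lambda>k. j \<le> k)" using cofin[of j] by (simp add: EV_def atLeast_def)
    ultimately have "EV (\<lambda>k. (\<forall>i<m. e k i = E i k) \<and> j \<le> k)" by (simp add: EV_conj)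
    then have "EV (\<lambda>k. satisfies M (\<lambda>i. E i k) (\<Phi> j))"
    proof (rule EV_mono)
      fix k assume k: "(\<forall>i<m. e k i = E i k) \<and> j \<le> k"
      have "satisfies M (e k) (\<Phi> j) \<longleftrightarrow> satisfies M (\<lambda>i. E i k) (\<Phi> j)"
        by (rule satisfies_fmla_cong[OF m]) (use k in auto)
      then show "satisfies M (\<lambda>i. E i k) (\<Phi> j)" using e k by blast
    qed
    then show ?thesis using los[OF E] by simp
  qed
  ultimately show ?thesis using that SP by blast
qed

text \<open>Compactness inside \<open>M\<close>: the ultrapower contains a realization, the theorem
  of Loewenheim and Skolem cuts it down to a countable elementary subset around that realization,
  and categoricity identifies this subset with \<open>M\<close>.\<close>

lemma omega_categorical_realizes:
  fixes \<Phi> :: "nat \<Rightarrow> fo_formula"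
  assumes M: "omega_categorical L M" "univ M = UNIV"
    and \<Phi>: "\<And>j. formula_in L (\<Phi> j)" "\<And>k. \<exists>e. \<forall>j\<le>k. satisfies M e (\<Phi> j)"
  shows "\<exists>e. \<forall>j. satisfies M e (\<Phi> j)"
proof -
  have SM: "is_structure L M" using M by (simp add: omega_categorical_def)
  obtain P :: "(nat \<Rightarrow> nat) fo_structure" and E where P: "is_structure L P" "elem_equiv L M P"
    "E \<in> env P" "\<And>j. satisfies P E (\<Phi> j)"
    using countable_realization[OF SM M(2) \<Phi>] by blast
  have "range E \<subseteq> univ P" "countable (range E)" "range E \<noteq> {}" using P(3) by (auto simp: env_def)
  then obtain A where A: "range E \<subseteq> A" "countable A" "elementary_subset L P A"
    by (rule downward_loewenheim_skolem)
  let ?N = "P\<lparr>univ := A\<rparr>"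
  have N: "is_structure L ?N" by (rule elementary_structure[OF A(3) P(1)])
  have "elem_equiv L M ?N"
    using P(2) elementary_equiv[OF A(3) P(1)] by (auto simp: elem_equiv_def)
  moreover have "countable (univ ?N)" using A(2) by simp
  ultimately obtain h where h: "struct_isomorphism L ?N M h"
    using omega_categorical_unique[OF M(1) N] by blast
  have "satisfies M (h \<circ> E) (\<Phi> j)" for j
  proof -
    have "satisfies ?N E (\<Phi> j)"
      using elementary_satisfies[OF A(3) \<Phi>(1) A(1)] P(4) by blast
    moreover have "E \<in> env ?N" using A(1) by (simp add: env_def)
    ultimately show ?thesis using isomorphism_satisfies[OF h N \<Phi>(1)] by blast
  qed
  then show ?thesis by blast
qed

subsection \<open>The theorem of Ryll-Nardzewski\<close>

lemma isolated_cong: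
  assumes "isolated L k M e" "\<And>i. i < k \<Longrightarrow> e i = e' i"
  shows "isolated L k M e'"
proof -
  have "satisfies M e' \<phi> \<longleftrightarrow> satisfies M e \<phi>" if "\<phi> \<in> fmla L k" for \<phi>
    by (rule satisfies_fmla_cong[OF that]) (simp add: assms(2))
  then show ?thesis using assms(1) unfolding isolated_def same_type_def by metis
qed

text \<open>The isolating formula of the reindexed tuple quantifies away a copy of \<open>e\<close>:
  the variables from \<open>k\<close> on satisfy \<open>\<gamma>\<close>, and variable
  \<open>i < k\<close> equals variable \<open>k + \<sigma> i\<close>. A tuple satisfying it is thus
  the reindexing of a tuple with the type of \<open>e\<close>.\<close>

lemma isolated_comp:
  assumes iso: "isolated L m M e" and e: "e \<in> env M" and \<sigma>: "\<And>i. i < k \<Longrightarrow> \<sigma> i < m"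
  shows "isolated L k M (e \<circ> \<sigma>)"
proof -
  have ne: "univ M \<noteq> {}" using e by (auto simp: env_def)
  obtain \<gamma> where \<gamma>: "\<gamma> \<in> fmla L m" "satisfies M e \<gamma>"
    and \<gamma>': "\<And>e'. e' \<in> env M \<Longrightarrow> satisfies M e' \<gamma> \<Longrightarrow> same_type L m M e' M e"
    using iso by (auto simp: isolated_def)
  define \<delta> where "\<delta> = conj_list (rename (\<lambda>i. k + i) \<gamma> # map (\<lambda>i. Equal (Var i) (Var (k + \<sigma> i))) [0..<k])"
  have "rename (\<lambda>i. k + i) \<gamma> \<in> fmla L (k + m)"
    using \<gamma>(1) free_vars_rename[of "\<lambda>i. k + i" \<gamma>] by (fastforce simp: fmla_def formula_in_rename)
  then have \<delta>: "\<delta> \<in> fmla L (k + m)"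
    unfolding \<delta>_def using \<sigma> by (intro fmla_conj_list) (auto simp: fmla_def intro: trans_less_add1)
  have sat_\<delta>: "satisfies M e' \<delta> \<longleftrightarrow> satisfies M (e' \<circ> (\<lambda>i. k + i)) \<gamma> \<and> (\<forall>i<k. e' i = e' (k + \<sigma> i))" for e'
    unfolding \<delta>_def satisfies_conj_list[OF ne] by (auto simp: satisfies_rename)
  note ex = satisfies_ex_vars[OF \<delta>]
  have rename_in: "rename \<sigma> \<phi> \<in> fmla L m" if "\<phi> \<in> fmla L k" for \<phi>
    using that free_vars_rename[of \<sigma> \<phi>] \<sigma> by (fastforce simp: fmla_def formula_in_rename)
  show ?thesis
    unfolding isolated_def
  proof (intro bexI conjI ballI impI)
    show "ex_vars k m \<delta> \<in> fmla L k" by (rule fmla_ex_vars[OF \<delta>])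
    let ?e = "\<lambda>i. if i < k then e (\<sigma> i) else e (i - k)"
    have "?e \<circ> (\<lambda>i. k + i) = e" by auto
    then have "satisfies M ?e \<delta>" unfolding sat_\<delta> using \<gamma>(2) by simp
    moreover have "?e \<in> env M" using e by (auto simp: env_def)
    ultimately show "satisfies M (e \<circ> \<sigma>) (ex_vars k m \<delta>)"
      unfolding ex[OF env_comp[OF e]] by (intro bexI[of _ ?e]) auto
  next
    fix e' assume e': "e' \<in> env M" "satisfies M e' (ex_vars k m \<delta>)"
    then obtain e'' where e'': "e'' \<in> env M" "\<And>i. i < k \<Longrightarrow> e'' i = e' i" "satisfies M e'' \<delta>"
      using ex by blast
    let ?f = "e'' \<circ> (\<lambda>i. k + i)"
    have f: "same_type L m M ?f M e"
      using \<gamma>'[OF env_comp[OF e''(1)]] e''(3) sat_\<delta> by blast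
    show "same_type L k M e' M (e \<circ> \<sigma>)"
      unfolding same_type_def
    proof
      fix \<phi> assume \<phi>: "\<phi> \<in> fmla L k"
      have "satisfies M e' \<phi> \<longleftrightarrow> satisfies M (?f \<circ> \<sigma>) \<phi>"
        by (rule satisfies_fmla_cong[OF \<phi>]) (use e'' sat_\<delta> in auto)
      also have "\<dots> \<longleftrightarrow> satisfies M e (rename \<sigma> \<phi>)"
        using f rename_in[OF \<phi>] by (simp only: same_type_def satisfies_rename[symmetric])
      finally show "satisfies M e' \<phi> \<longleftrightarrow> satisfies M (e \<circ> \<sigma>) \<phi>" by (simp only: satisfies_rename)
    qed
  qed
qed

lemma isolated_isomorphism:
  assumes h: "struct_isomorphism L N M h" and N: "is_structure L N"
    and e: "e \<in> env N" and iso: "isolated L k N e"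
  shows "isolated L k M (h \<circ> e)"
proof -
  obtain g where g: "struct_isomorphism L M N g" "\<And>b. b \<in> univ M \<Longrightarrow> g b \<in> univ N \<and> h (g b) = b"
    by (rule isomorphism_sym[OF h N], rule that)
  obtain \<gamma> where \<gamma>: "\<gamma> \<in> fmla L k" "satisfies N e \<gamma>"
    and \<gamma>': "\<And>e'. e' \<in> env N \<Longrightarrow> satisfies N e' \<gamma> \<Longrightarrow> same_type L k N e' N e"
    using iso by (auto simp: isolated_def)
  have sat: "satisfies N e' \<phi> \<longleftrightarrow> satisfies M (h \<circ> e') \<phi>" if "\<phi> \<in> fmla L k" "e' \<in> env N" for e' \<phi>
    by (rule isomorphism_satisfies[OF h N]) (use that in \<open>auto simp: fmla_def\<close>)
  show ?thesis
    unfolding isolated_def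
  proof (intro bexI conjI ballI impI)
    show "satisfies M (h \<circ> e) \<gamma>" using sat[OF \<gamma>(1) e] \<gamma>(2) by blast
    fix e' assume e': "e' \<in> env M" "satisfies M e' \<gamma>"
    have ge: "g \<circ> e' \<in> env N" "h \<circ> (g \<circ> e') = e'"
      using g(2) env_in[OF e'(1)] by (auto simp: env_def)
    have "same_type L k N (g \<circ> e') N e"
      by (rule \<gamma>'[OF ge(1)]) (use sat[OF \<gamma>(1) ge(1)] e'(2) ge(2) in simp)
    then show "same_type L k M e' M (h \<circ> e)"
      using sat[OF _ ge(1)] sat[OF _ e] unfolding same_type_def ge(2) by blast
  qed (rule \<gamma>)
qed

text \<open>Runs through all finite tuples, so that a construction can treat them one at a time: to
  avoid each in turn, or to pick finitely many as representatives of types.\<close>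

definition tuple :: "nat \<Rightarrow> nat \<Rightarrow> nat" where
  "tuple j i = (let l = from_nat j in if i < length l then l ! i else 0)"

lemma tuple_surj: "\<exists>j. \<forall>i<k. tuple j i = e i"
  by (intro exI[of _ "to_nat (map e [0..<k])"]) (auto simp: tuple_def)

context
  fixes L :: language and M :: "nat fo_structure"
  assumes cat: "omega_categorical L M" and UNIV: "univ M = UNIV"
begin

lemma is_structure_cat: "is_structure L M"
  using cat by (simp add: omega_categorical_def)

lemma env_UNIV: "e \<in> env M"
  by (simp add: env_def UNIV)

text \<open>
  Otherwise \<open>\<phi>\<close> could be strengthened step by step so as to exclude every tuple of \<open>M\<close>.
\<close>

lemma isolated_dense:
  assumes \<phi>: "\<phi> \<in> fmla L k" "satisfies M e0 \<phi>"
  shows "\<exists>e. satisfies M e \<phi> \<and> isolated L k M e"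
proof (rule ccontr)
  assume no: "\<not> (\<exists>e. satisfies M e \<phi> \<and> isolated L k M e)"
  define P where "P n \<psi> \<longleftrightarrow> \<psi> \<in> fmla L k \<and> (\<exists>e. satisfies M e \<psi>) \<and>
    (\<forall>e. satisfies M e \<psi> \<longrightarrow> satisfies M e \<phi>)" for n :: nat and \<psi>
  define Q where "Q n \<psi> \<psi>' \<longleftrightarrow> (\<forall>e. satisfies M e \<psi>' \<longrightarrow> satisfies M e \<psi>) \<and>
    \<not> satisfies M (tuple n) \<psi>'" for n \<psi> \<psi>'
  have "\<exists>s. \<forall>n. P n (s n) \<and> Q n (s n) (s (Suc n))"
  proof (rule dependent_nat_choice)
    show "\<exists>\<psi>. P 0 \<psi>" using \<phi> by (auto simp: P_def)
  next
    fix \<psi> n assume \<psi>: "P n \<psi>"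
    then obtain e where e: "satisfies M e \<psi>" "\<psi> \<in> fmla L k" by (auto simp: P_def)
    then have "\<not> isolated L k M e" using no \<psi> by (auto simp: P_def)
    then obtain e' where e': "satisfies M e' \<psi>" "\<not> same_type L k M e' M e"
      using e by (auto simp: isolated_def)
    then obtain \<xi> where \<xi>: "\<xi> \<in> fmla L k" "satisfies M e' \<xi> \<noteq> satisfies M e \<xi>"
      by (auto simp: same_type_def)
    \<comment> \<open>Both \<open>\<psi>\<close> with \<open>\<xi>\<close> and \<open>\<psi>\<close>
      with its negation are satisfiable, because \<open>e\<close> and \<open>e'\<close> satisfy
      \<open>\<psi>\<close> and disagree on \<open>\<xi>\<close>; the one that fails at the
      \<open>n\<close>-th tuple is kept.\<close>
    define \<psi>' where "\<psi>' = Conj \<psi> (if satisfies M (tuple n) \<xi> then Neg \<xi> else \<xi>)"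
    have "P (Suc n) \<psi>'" using \<psi> \<xi> e e' by (auto simp: P_def \<psi>'_def fmla_Conj fmla_Neg)
    moreover have "Q n \<psi> \<psi>'" by (auto simp: Q_def \<psi>'_def)
    ultimately show "\<exists>\<psi>'. P (Suc n) \<psi>' \<and> Q n \<psi> \<psi>'" by blast
  qed
  then obtain s where s: "\<And>n. P n (s n)" "\<And>n. Q n (s n) (s (Suc n))" by blast
  have mono: "satisfies M e (s (j + d)) \<Longrightarrow> satisfies M e (s j)" for e j d
    by (induction d) (use s(2) in \<open>auto simp: Q_def\<close>)
  have "\<exists>e. \<forall>j. satisfies M e (s j)"
  proof (rule omega_categorical_realizes[OF cat UNIV])
    show "formula_in L (s j)" for j using s(1)[of j] by (auto simp: P_def fmla_def)
    fix n
    obtain e where "satisfies M e (s n)" using s(1)[of n] by (auto simp: P_def)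
    then show "\<exists>e. \<forall>j\<le>n. satisfies M e (s j)" using mono le_Suc_ex by metis
  qed
  then obtain e where e: "\<And>j. satisfies M e (s j)" by blast
  obtain n where n: "\<And>i. i < k \<Longrightarrow> tuple n i = e i" using tuple_surj by blast
  have "s (Suc n) \<in> fmla L k" using s(1) by (auto simp: P_def)
  then have "satisfies M (tuple n) (s (Suc n)) \<longleftrightarrow> satisfies M e (s (Suc n))"
    by (rule satisfies_fmla_cong) (rule n)
  then show False using s(2)[of n] e by (simp add: Q_def)
qed

text \<open>
  The request of stage \<open>m\<close> is a formula \<open>\<phi>\<close>, a variable \<open>x\<close> to be witnessed by the new element and an
  assignment \<open>\<sigma>\<close> of earlier elements to the other variables; the second component of the code of
  \<open>m\<close> makes every request recur at arbitrarily late stages.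
\<close>

lemma atomic_elementary_subset:
  obtains a where "elementary_subset L M (range a)" "\<And>m. isolated L m M a"
proof -
  define req where "req m = (case from_nat (fst (prod_decode m)) of (\<phi>, x, \<sigma>) \<Rightarrow>
      rename ((\<lambda>i. if i < length \<sigma> then \<sigma> ! i else 0)(x := m)) \<phi>)" for m
  define Q where "Q m e e' \<longleftrightarrow> (\<forall>i<m. e' i = e i) \<and>
      (req m \<in> fmla L (Suc m) \<longrightarrow> (\<exists>b. satisfies M (e(m := b)) (req m)) \<longrightarrow> satisfies M e' (req m))"
    for m e e'
  have "\<exists>s. \<forall>n. isolated L n M (s n) \<and> Q n (s n) (s (Suc n))"
  proof (rule dependent_nat_choice)
    have "same_type L 0 M e M e'" for e e'
      by (rule same_type_0) (auto simp: elem_equiv_def env_UNIV)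
    moreover have "conj_list [] \<in> fmla L 0" by (rule fmla_conj_list) simp
    moreover have "satisfies M e (conj_list [])" for e by (simp add: UNIV)
    ultimately show "\<exists>e. isolated L 0 M e" unfolding isolated_def by blast
  next
    fix e m assume iso: "isolated L m M e"
    obtain \<gamma> where \<gamma>: "\<gamma> \<in> fmla L m" "satisfies M e \<gamma>"
      and \<gamma>': "\<And>e'. satisfies M e' \<gamma> \<Longrightarrow> same_type L m M e' M e"
      using iso env_UNIV by (auto simp: isolated_def)
    \<comment> \<open>The request is imposed only if a new entry can meet it; otherwise a true
      formula takes its place.\<close>
    define \<delta> where "\<delta> = (if req m \<in> fmla L (Suc m) \<and> (\<exists>b. satisfies M (e(m := b)) (req m))
      then req m else conj_list [])"
    have \<delta>: "\<delta> \<in> fmla L (Suc m)" by (auto simp: \<delta>_def intro: fmla_conj_list simp del: conj_list.simps)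
    have "\<exists>b. satisfies M (e(m := b)) \<delta>"
    proof (cases "req m \<in> fmla L (Suc m) \<and> (\<exists>b. satisfies M (e(m := b)) (req m))")
      case True
      then show ?thesis unfolding \<delta>_def if_P[OF True] by blast
    next
      case False
      then show ?thesis unfolding \<delta>_def if_not_P[OF False] by (simp add: UNIV)
    qed
    then obtain b where b: "satisfies M (e(m := b)) \<delta>" ..
    have "satisfies M (e(m := b)) \<gamma>"
      using satisfies_fmla_cong[OF \<gamma>(1), of "e(m := b)" e M] \<gamma>(2) by simp
    then obtain e' where e': "satisfies M e' (Conj \<gamma> \<delta>)" "isolated L (Suc m) M e'"
      using isolated_dense[of "Conj \<gamma> \<delta>" "Suc m" "e(m := b)"] b fmla_mono[OF \<gamma>(1)] \<delta>
      by (auto simp: fmla_Conj)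
    obtain \<eta> where \<eta>: "\<eta> \<in> fmla L (Suc m)" "satisfies M e' \<eta>"
      and \<eta>': "\<And>f. satisfies M f \<eta> \<Longrightarrow> same_type L (Suc m) M f M e'"
      using e'(2) env_UNIV by (auto simp: isolated_def)
    \<comment> \<open>The tuple \<open>e'\<close> extends one of the same type as \<open>e\<close>,
      not \<open>e\<close> itself. This formula lies in the common type, so \<open>e\<close> also
      has an extension that satisfies \<open>\<eta>\<close> and \<open>\<delta>\<close>.\<close>
    have "satisfies M e' (Exist m (Conj \<eta> \<delta>))"
      using e'(1) \<eta>(2) UNIV by (auto intro!: exI[of _ "e' m"])
    moreover have "same_type L m M e' M e" using \<gamma>' e'(1) by simp
    moreover have "Exist m (Conj \<eta> \<delta>) \<in> fmla L m" using \<eta>(1) \<delta> by (intro fmla_Exist) (simp add: fmla_Conj)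
    ultimately have "satisfies M e (Exist m (Conj \<eta> \<delta>))" by (simp only: same_type_def)
    then obtain c where c: "satisfies M (e(m := c)) \<eta>" "satisfies M (e(m := c)) \<delta>" by auto
    have "isolated L (Suc m) M (e(m := c))"
      unfolding isolated_def using \<eta>(1) c(1) \<eta>' same_type_trans[OF _ same_type_sym] by metis
    moreover have "satisfies M (e(m := c)) (req m)"
      if "req m \<in> fmla L (Suc m)" "\<exists>b. satisfies M (e(m := b)) (req m)"
      using c(2) that by (simp only: \<delta>_def simp_thms if_True)
    then have "Q m e (e(m := c))" unfolding Q_def by auto
    ultimately show "\<exists>e'. isolated L (Suc m) M e' \<and> Q m e e'" by blast
  qed
  then obtain s where s: "\<And>n. isolated L n M (s n)" "\<And>n. Q n (s n) (s (Suc n))" by blast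
  define a where "a i = s (Suc i) i" for i
  have stab: "i < n \<Longrightarrow> s (n + d) i = s n i" for i n d
    by (induction d) (use s(2) in \<open>auto simp: Q_def\<close>)
  have agree: "s n i = a i" if "i < n" for i n
    using stab[of i "Suc i" "n - Suc i"] that by (simp add: a_def)
  have iso: "isolated L m M a" for m by (rule isolated_cong[OF s(1)[of m]]) (rule agree)
  have "elementary_subset L M (range a)"
    unfolding elementary_subset_def
  proof (intro conjI allI impI)
    fix \<phi> x e assume \<phi>: "formula_in L \<phi>" and e: "range e \<subseteq> range a"
      and ex: "\<exists>b\<in>univ M. satisfies M (e(x := b)) \<phi>"
    obtain k where k: "\<phi> \<in> fmla L k" using fmla_bound[OF \<phi>] by blast
    have "\<forall>i. \<exists>j. e i = a j" using e by blast
    then obtain idx where idx: "\<And>i. e i = a (idx i)" by metis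
    define \<sigma> where "\<sigma> = map idx [0..<k]"
    define m where "m = prod_encode (to_nat (\<phi>, x, \<sigma>), Suc (Max (insert 0 (idx ` {..<k}))))"
    have m: "idx i < m" if "i < k" for i
    proof -
      have "idx i \<le> Max (insert 0 (idx ` {..<k}))" using that by (intro Max_ge) auto
      then show ?thesis unfolding m_def using le_prod_encode_2 Suc_le_lessD less_le_trans le_imp_less_Suc by metis
    qed
    define \<rho> where "\<rho> = (\<lambda>i. if i < length \<sigma> then \<sigma> ! i else 0)(x := m)"
    have req: "req m = rename \<rho> \<phi>" by (simp add: req_def m_def[of] \<rho>_def)
    have fv: "i < k" if "i \<in> free_vars \<phi>" for i using k that by (auto simp: fmla_def)
    have \<rho>: "\<rho> i = (if i = x then m else idx i)" if "i < k" for i using that by (simp add: \<rho>_def \<sigma>_def)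
    have "\<rho> i < Suc m" if "i \<in> free_vars \<phi>" for i
      using \<rho>[OF fv[OF that]] m[OF fv[OF that]] by simp
    then have "req m \<in> fmla L (Suc m)"
      using free_vars_rename[of \<rho> \<phi>] \<phi> unfolding req fmla_def
      by (auto simp: formula_in_rename)
    moreover have sat: "satisfies M f (req m) \<longleftrightarrow> satisfies M (e(x := f m)) \<phi>" if "\<And>i. i < m \<Longrightarrow> f i = a i" for f
      unfolding req satisfies_rename
      by (rule satisfies_fmla_cong[OF k]) (simp add: \<rho> that idx m)
    moreover obtain b where b: "satisfies M (e(x := b)) \<phi>" using ex by blast
    have "satisfies M ((s m)(m := b)) (req m)" using sat[of "(s m)(m := b)"] agree b by simp
    ultimately have "satisfies M (s (Suc m)) (req m)" using s(2)[of m] by (auto simp: Q_def)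
    then have "satisfies M (e(x := s (Suc m) m)) \<phi>" using sat[of "s (Suc m)"] agree by simp
    then show "\<exists>b\<in>range a. satisfies M (e(x := b)) \<phi>" unfolding a_def by blast
  qed (auto simp: UNIV)
  then show ?thesis using that iso by blast
qed

text \<open>By categoricity the countable elementary subset \<open>range a\<close> is isomorphic to
  \<open>M\<close>. Hence \<open>M\<close> is enumerated by a sequence whose initial segments have
  isolated types, and every tuple is a reindexing of such a segment.\<close>

lemma omega_categorical_atomic: "atomic L M"
  unfolding atomic_def
proof (intro allI ballI)
  fix k and e :: "nat \<Rightarrow> nat"
  obtain a where a: "elementary_subset L M (range a)" "\<And>m. isolated L m M a"
    using atomic_elementary_subset by blast
  let ?N = "M\<lparr>univ := range a\<rparr>"
  have N: "is_structure L ?N" by (rule elementary_structure[OF a(1) is_structure_cat])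
  obtain h where h: "struct_isomorphism L ?N M h"
    using omega_categorical_unique[OF cat N elementary_equiv[OF a(1) is_structure_cat]] by auto
  have "h ` range a = UNIV" using h UNIV by (simp add: struct_isomorphism_def bij_betw_def)
  then have "\<exists>j. e i = h (a j)" for i by (metis UNIV_I imageE)
  then obtain \<sigma> where \<sigma>: "\<And>i. e i = h (a (\<sigma> i))" by metis
  have sat: "satisfies ?N f \<phi> \<longleftrightarrow> satisfies M f \<phi>" if "\<phi> \<in> fmla L k" "f \<in> env ?N" for f \<phi>
    by (rule elementary_satisfies[OF a(1)]) (use that in \<open>auto simp: fmla_def env_def\<close>)
  have a\<sigma>: "a \<circ> \<sigma> \<in> env ?N" by (auto simp: env_def)
  have "\<sigma> i < Suc (Max (\<sigma> ` {..<k}))" if "i < k" for i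
    using that by (intro le_imp_less_Suc Max_ge) auto
  then have "isolated L k M (a \<circ> \<sigma>)" by (rule isolated_comp[OF a(2) env_UNIV])
  then obtain \<gamma> where \<gamma>: "\<gamma> \<in> fmla L k" "satisfies M (a \<circ> \<sigma>) \<gamma>"
    "\<And>e'. satisfies M e' \<gamma> \<Longrightarrow> same_type L k M e' M (a \<circ> \<sigma>)"
    using env_UNIV by (auto simp: isolated_def)
  have "isolated L k ?N (a \<circ> \<sigma>)"
    unfolding isolated_def
  proof (intro bexI conjI ballI impI)
    show "satisfies ?N (a \<circ> \<sigma>) \<gamma>" using sat[OF \<gamma>(1) a\<sigma>] \<gamma>(2) by blast
    fix e' assume e': "e' \<in> env ?N" "satisfies ?N e' \<gamma>"
    then have "same_type L k M e' M (a \<circ> \<sigma>)" using \<gamma>(3) sat[OF \<gamma>(1) e'(1)] by blast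
    then show "same_type L k ?N e' ?N (a \<circ> \<sigma>)"
      using sat[OF _ e'(1)] sat[OF _ a\<sigma>] by (auto simp: same_type_def simp del: o_apply)
  qed (rule \<gamma>)
  then have "isolated L k M (h \<circ> (a \<circ> \<sigma>))" by (rule isolated_isomorphism[OF h N a\<sigma>])
  then show "isolated L k M e" by (rule isolated_cong) (simp add: \<sigma>)
qed

text \<open>If no finite number of the isolating formulas covered all assignments, their negations
  would be realized together; but the realization agrees below \<open>k\<close> with some
  \<open>tuple j\<close> and therefore satisfies \<open>\<gamma> j\<close>.\<close>

lemma omega_categorical_finite_types: "\<exists>n. \<forall>e. \<exists>j\<le>n. same_type L k M e M (tuple j)"
proof -
  have "isolated L k M (tuple j)" for j
    using omega_categorical_atomic env_UNIV by (auto simp: atomic_def)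
  then have "\<exists>\<gamma>\<in>fmla L k. satisfies M (tuple j) \<gamma> \<and>
      (\<forall>e. satisfies M e \<gamma> \<longrightarrow> same_type L k M e M (tuple j))" for j
    using env_UNIV unfolding isolated_def by blast
  then obtain \<gamma> where \<gamma>: "\<And>j. \<gamma> j \<in> fmla L k" "\<And>j. satisfies M (tuple j) (\<gamma> j)"
    "\<And>j e. satisfies M e (\<gamma> j) \<Longrightarrow> same_type L k M e M (tuple j)" by metis
  have "\<exists>n. \<forall>e. \<exists>j\<le>n. satisfies M e (\<gamma> j)"
  proof (rule ccontr)
    assume "\<not> (\<exists>n. \<forall>e. \<exists>j\<le>n. satisfies M e (\<gamma> j))"
    then have "\<exists>e. \<forall>j. satisfies M e (Neg (\<gamma> j))"
      using \<gamma>(1) by (intro omega_categorical_realizes[OF cat UNIV]) (auto simp: fmla_def)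
    then obtain e where e: "\<And>j. \<not> satisfies M e (\<gamma> j)" by auto
    obtain j where j: "\<And>i. i < k \<Longrightarrow> tuple j i = e i" using tuple_surj by blast
    have "satisfies M (tuple j) (\<gamma> j) \<longleftrightarrow> satisfies M e (\<gamma> j)"
      by (rule satisfies_fmla_cong[OF \<gamma>(1)]) (rule j)
    then show False using e \<gamma>(2) by blast
  qed
  then show ?thesis using \<gamma>(3) by blast
qed

lemma same_type_automorphism:
  assumes "same_type L k M e M e'"
  obtains g where "g \<in> Aut L M" "\<And>i. i < k \<Longrightarrow> g (e i) = e' i"
proof -
  have "elem_equiv L M M" by (simp add: elem_equiv_def)
  then obtain g where g: "struct_isomorphism L M M g" "\<And>i. i < k \<Longrightarrow> g (e i) = e' i"
    by (rule atomic_unique[OF _ is_structure_cat is_structure_cat omega_categorical_atomic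
        omega_categorical_atomic _ _ assms env_UNIV env_UNIV]) auto
  then have "g \<in> Aut L M" by (simp add: Aut_def Bij_def UNIV struct_isomorphism_def)
  then show ?thesis using that g by blast
qed

end

definition oligomorphic :: "(nat \<Rightarrow> nat) set \<Rightarrow> bool" where
  "oligomorphic G \<longleftrightarrow>
     (\<forall>n. \<exists>F. finite F \<and> (\<forall>xs. length xs = n \<longrightarrow> (\<exists>ys\<in>F. \<exists>g\<in>G. map g ys = xs)))"

theorem oligomorphic_Aut:
  fixes M :: "nat fo_structure"
  assumes "omega_categorical L M" "univ M = UNIV"
  shows "oligomorphic (Aut L M)"
  unfolding oligomorphic_def
proof
  fix k
  obtain n where n: "\<And>e. \<exists>j\<le>n. same_type L k M e M (tuple j)"
    using omega_categorical_finite_types[OF assms] by blast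
  have "\<exists>ys\<in>(\<lambda>j. map (tuple j) [0..<k]) ` {..n}. \<exists>g\<in>Aut L M. map g ys = xs" if xs: "length xs = k" for xs
  proof -
    obtain j where j: "j \<le> n" "same_type L k M (\<lambda>i. xs ! i) M (tuple j)" using n by blast
    obtain g where g: "g \<in> Aut L M" "\<And>i. i < k \<Longrightarrow> g (tuple j i) = xs ! i"
      using same_type_automorphism[OF assms same_type_sym[OF j(2)]] by blast
    have "map g (map (tuple j) [0..<k]) = xs" by (rule nth_equalityI) (use g xs in auto)
    then show ?thesis using g(1) j(1) by blast
  qed
  then show "\<exists>F. finite F \<and> (\<forall>xs. length xs = k \<longrightarrow> (\<exists>ys\<in>F. \<exists>g\<in>Aut L M. map g ys = xs))"
    by (intro exI[of _ "(\<lambda>j. map (tuple j) [0..<k]) ` {..n}"]) auto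
qed

section \<open>Closed oligomorphic permutation groups\<close>

abbreviation pinv :: "('a \<Rightarrow> 'a) \<Rightarrow> 'a \<Rightarrow> 'a" where
  "pinv \<equiv> inv_into UNIV"

lemma isomorphism_same_type:
  assumes "struct_isomorphism L M N h" "is_structure L M" "e \<in> env M"
  shows "same_type L k M e N (h \<circ> e)"
  unfolding same_type_def
proof
  fix \<phi> assume "\<phi> \<in> fmla L k"
  then have "formula_in L \<phi>" by (simp add: fmla_def)
  then show "satisfies M e \<phi> \<longleftrightarrow> satisfies N (h \<circ> e) \<phi>"
    by (rule isomorphism_satisfies[OF assms(1,2) _ assms(3)])
qed

lemma oligomorphicE:
  assumes "oligomorphic G"
  obtains F where "finite F" "\<And>xs. length xs = n \<Longrightarrow> \<exists>ys\<in>F. \<exists>g\<in>G. map g ys = xs"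
  using assms[unfolded oligomorphic_def, THEN spec, of n] by (elim exE conjE) (rule that, auto)

locale perm_group =
  fixes G :: "(nat \<Rightarrow> nat) set"
  assumes bij: "g \<in> G \<Longrightarrow> bij g"
    and id_mem: "id \<in> G"
    and comp_mem: "g \<in> G \<Longrightarrow> h \<in> G \<Longrightarrow> g \<circ> h \<in> G"
    and inv_mem: "g \<in> G \<Longrightarrow> pinv g \<in> G"
begin

lemma inv_apply: "g \<in> G \<Longrightarrow> pinv g (g x) = x"
  using bij by (simp add: bij_is_inj)

lemma apply_inv: "g \<in> G \<Longrightarrow> g (pinv g x) = x"
  using bij by (simp add: bij_is_surj surj_f_inv_f)

lemma inv_comp: "g \<in> G \<Longrightarrow> pinv g \<circ> g = id"
  and comp_inv: "g \<in> G \<Longrightarrow> g \<circ> pinv g = id"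
  by (auto simp: inv_apply apply_inv)

lemma idempotent_imp_id:
  assumes "g \<in> G" "g \<circ> g = g"
  shows "g = id"
proof -
  have "pinv g \<circ> (g \<circ> g) = id" using assms by (simp add: inv_comp)
  then show ?thesis using inv_comp[OF assms(1)] by (simp flip: comp_assoc)
qed

lemma eq_iff: "g \<in> G \<Longrightarrow> g x = g y \<longleftrightarrow> x = y"
  by (metis inv_apply)

end

lemma Bij_UNIV: "Bij UNIV = Collect bij"
  by (auto simp: Bij_def)

lemma BijGroup_UNIV_simps:
  "carrier (BijGroup UNIV) = Collect bij"
  "bij g \<Longrightarrow> bij h \<Longrightarrow> g \<otimes>\<^bsub>BijGroup UNIV\<^esub> h = g \<circ> h"
  "\<one>\<^bsub>BijGroup UNIV\<^esub> = id"
  by (auto simp: BijGroup_def Bij_UNIV compose_def)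

lemma m_inv_BijGroup_UNIV:
  assumes "bij g"
  shows "inv\<^bsub>BijGroup UNIV\<^esub> g = pinv g"
proof -
  interpret group "BijGroup UNIV :: ('a \<Rightarrow> 'a) monoid" by (rule group_BijGroup)
  show ?thesis
    by (rule inv_equality)
      (use assms in \<open>simp_all add: BijGroup_UNIV_simps bij_imp_bij_inv bij_is_inj\<close>)
qed

lemma subgroup_iff_perm_group: "subgroup G Sym_omega \<longleftrightarrow> perm_group G"
proof
  assume "subgroup G Sym_omega"
  then interpret subgroup G Sym_omega .
  have bij: "bij g" if "g \<in> G" for g using subset that by (auto simp: BijGroup_UNIV_simps)
  show "perm_group G"
    by unfold_locales (use bij m_closed one_closed m_inv_closed in
        \<open>auto simp: BijGroup_UNIV_simps m_inv_BijGroup_UNIV\<close>)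
next
  assume "perm_group G"
  then interpret perm_group G .
  show "subgroup G Sym_omega"
    by unfold_locales (use bij comp_mem id_mem inv_mem in
        \<open>auto simp: BijGroup_UNIV_simps m_inv_BijGroup_UNIV\<close>)
qed

lemma subgroup_restrict_iff:
  assumes "perm_group G"
  shows "subgroup H (Sym_omega\<lparr>carrier := G\<rparr>) \<longleftrightarrow> perm_group H \<and> H \<subseteq> G"
proof -
  interpret group "Sym_omega" by (rule group_BijGroup)
  have G: "subgroup G Sym_omega" using assms by (simp add: subgroup_iff_perm_group)
  show ?thesis
    using incl_subgroup[OF G] subgroup_incl[OF _ G] subgroup.subset
    by (fastforce simp: subgroup_iff_perm_group)
qed

text \<open>Closedness within the bijections for pointwise convergence: a bijection is a limit of
  elements of \<open>G\<close> when it agrees with some element on each finite set.\<close>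

definition closed_perm :: "(nat \<Rightarrow> nat) set \<Rightarrow> bool" where
  "closed_perm G \<longleftrightarrow> (\<forall>g. bij g \<longrightarrow> (\<forall>A. finite A \<longrightarrow> (\<exists>h\<in>G. \<forall>a\<in>A. h a = g a)) \<longrightarrow> g \<in> G)"

lemma closed_subgroups_iff: "G \<in> closed_subgroups \<longleftrightarrow> perm_group G \<and> closed_perm G"
proof -
  have "closedin (top_of_set (carrier Sym_omega)) G \<longleftrightarrow> closed_perm G" if "perm_group G"
  proof -
    interpret perm_group G by (rule that)
    have "closedin (top_of_set (carrier Sym_omega)) G \<longleftrightarrow>
        openin (top_of_set (Collect bij)) (Collect bij - G)"
      using bij by (auto simp: closedin_def BijGroup_UNIV_simps)
    also have "\<dots> \<longleftrightarrow> (\<forall>g. bij g \<and> g \<notin> G \<longrightarrow>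
        (\<exists>A. finite A \<and> {h \<in> Collect bij. \<forall>a\<in>A. h a = g a} \<subseteq> Collect bij - G))"
      unfolding openin_pointwise_iff by blast
    also have "\<dots> \<longleftrightarrow> (\<forall>g. bij g \<and> g \<notin> G \<longrightarrow>
        (\<exists>A. finite A \<and> \<not> (\<exists>h\<in>G. \<forall>a\<in>A. h a = g a)))"
    proof -
      have "{h \<in> Collect bij. \<forall>a\<in>A. h a = g a} \<subseteq> Collect bij - G \<longleftrightarrow> \<not> (\<exists>h\<in>G. \<forall>a\<in>A. h a = g a)" for A g
        using bij by auto
      then show ?thesis by simp
    qed
    also have "\<dots> \<longleftrightarrow> closed_perm G" unfolding closed_perm_def by blast
    finally show ?thesis .
  qed
  then show ?thesis by (auto simp: closed_subgroups_def subgroup_iff_perm_group)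
qed

subsection \<open>The canonical structure\<close>

text \<open>One relation symbol for each finite tuple: the name codes the tuple, the arity is its
  length, and the interpretation in \<open>canonical_structure\<close> is its orbit.\<close>

definition canonical_lang :: language where
  "canonical_lang = \<lparr>fun_syms = {}, rel_syms = {(r, n). n = length (from_nat r :: nat list)}\<rparr>"

definition canonical_structure :: "(nat \<Rightarrow> nat) set \<Rightarrow> nat fo_structure" where
  "canonical_structure G = \<lparr>univ = UNIV, fun_interp = (\<lambda>_ _. 0),
     rel_interp = (\<lambda>r ys. \<exists>g\<in>G. ys = map g (from_nat r))\<rparr>"

lemma is_structure_canonical: "is_structure canonical_lang (canonical_structure G)"
  by (simp add: is_structure_def canonical_structure_def)

lemma (in perm_group) canonical_automorphism:
  assumes g: "g \<in> G"
  shows "struct_isomorphism canonical_lang (canonical_structure G) (canonical_structure G) g"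
proof -
  have "(\<exists>h\<in>G. xs = map h zs) \<longleftrightarrow> (\<exists>h\<in>G. map g xs = map h zs)" for xs zs
  proof
    assume "\<exists>h\<in>G. xs = map h zs"
    then obtain h where "h \<in> G" "xs = map h zs" by blast
    then show "\<exists>h\<in>G. map g xs = map h zs" by (intro bexI[of _ "g \<circ> h"] comp_mem g) auto
  next
    assume "\<exists>h\<in>G. map g xs = map h zs"
    then obtain h where h: "h \<in> G" "map g xs = map h zs" by blast
    then have "map (pinv g) (map g xs) = map (pinv g \<circ> h) zs" by simp
    then have "xs = map (pinv g \<circ> h) zs" by (simp add: inv_comp[OF g])
    then show "\<exists>h\<in>G. xs = map h zs" using comp_mem[OF inv_mem[OF g] h(1)] by blast
  qed
  then show ?thesis
    using bij[OF g] by (auto simp: struct_isomorphism_def canonical_structure_def canonical_lang_def)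
qed

text \<open>An automorphism preserves the orbit of a tuple listing \<open>A\<close>, so it agrees on
  \<open>A\<close> with an element of \<open>G\<close>; closedness then puts it into
  \<open>G\<close>.\<close>

lemma (in perm_group) Aut_canonical:
  assumes "closed_perm G"
  shows "Aut canonical_lang (canonical_structure G) = G"
proof
  show "G \<subseteq> Aut canonical_lang (canonical_structure G)"
    using canonical_automorphism bij by (auto simp: Aut_def canonical_structure_def Bij_UNIV)
  show "Aut canonical_lang (canonical_structure G) \<subseteq> G"
  proof
    fix h assume "h \<in> Aut canonical_lang (canonical_structure G)"
    then have h: "bij h" "struct_isomorphism canonical_lang (canonical_structure G) (canonical_structure G) h"
      by (auto simp: Aut_def canonical_structure_def Bij_UNIV)
    have "\<exists>g\<in>G. \<forall>a\<in>A. g a = h a" if "finite A" for A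
    proof -
      obtain xs where xs: "set xs = A" using \<open>finite A\<close> finite_list by blast
      have "rel_interp (canonical_structure G) (to_nat xs) xs"
        using id_mem by (auto simp: canonical_structure_def intro!: bexI[of _ id])
      then have "rel_interp (canonical_structure G) (to_nat xs) (map h xs)"
        using struct_isomorphism_rel[OF h(2), of "to_nat xs" xs]
        by (simp add: canonical_lang_def canonical_structure_def)
      then obtain g where "g \<in> G" "map h xs = map g xs" by (auto simp: canonical_structure_def)
      then show ?thesis using xs by auto
    qed
    then show "h \<in> G" using assms h(1) by (auto simp: closed_perm_def)
  qed
qed

text \<open>Tuples in one orbit have the same type, so the finitely many orbit representatives
  represent all types.\<close>

lemma (in perm_group) canonical_omega_categorical:
  assumes "oligomorphic G"
  shows "omega_categorical canonical_lang (canonical_structure G)"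
proof (rule finite_types_omega_categorical[OF is_structure_canonical])
  let ?M = "canonical_structure G"
  have env: "e \<in> env ?M" for e by (simp add: env_def canonical_structure_def)
  show "finite_types canonical_lang ?M"
    unfolding finite_types_def
  proof
    fix k
    obtain F where F: "finite F" "\<And>xs. length xs = k \<Longrightarrow> \<exists>ys\<in>F. \<exists>g\<in>G. map g ys = xs"
      by (rule oligomorphicE[OF assms, where n = k], rule that)
    have "\<exists>ys\<in>F. same_type canonical_lang k ?M e ?M ((!) ys)" for e
    proof -
      obtain ys g where ys: "ys \<in> F" "g \<in> G" "map g ys = map e [0..<k]"
        using F(2)[of "map e [0..<k]"] by auto
      have "g (ys ! i) = e i" if "i < k" for i
      proof -
        have "length ys = k" using arg_cong[OF ys(3), of length] by simp
        then show ?thesis using arg_cong[OF ys(3), of "\<lambda>l. l ! i"] that by simp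
      qed
      moreover have "same_type canonical_lang k ?M ((!) ys) ?M (g \<circ> (!) ys)"
        by (rule isomorphism_same_type[OF canonical_automorphism[OF ys(2)] is_structure_canonical env])
      ultimately have "same_type canonical_lang k ?M ((!) ys) ?M e"
        by (intro same_type_cong[where e = "(!) ys" and e' = "g \<circ> (!) ys" and ?e1.0 = "(!) ys"
              and ?e1'.0 = e]) simp_all
      then show ?thesis using ys(1) same_type_sym by blast
    qed
    then show "\<exists>T. finite T \<and> T \<subseteq> env ?M \<and> (\<forall>e\<in>env ?M. \<exists>t\<in>T. same_type canonical_lang k ?M e ?M t)"
      using F(1) env by (intro exI[of _ "(!) ` F"]) auto
  qed
qed

subsection \<open>Algebraic closure and weak elimination of imaginaries\<close>

definition acl :: "(nat \<Rightarrow> nat) set \<Rightarrow> nat set \<Rightarrow> nat set" where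
  "acl G A = {a. algebraic_over G a A}"

definition fin_closed :: "(nat \<Rightarrow> nat) set \<Rightarrow> nat set \<Rightarrow> bool" where
  "fin_closed G K \<longleftrightarrow> finite K \<and> acl G K \<subseteq> K"

definition open_subgroup :: "(nat \<Rightarrow> nat) set \<Rightarrow> (nat \<Rightarrow> nat) set \<Rightarrow> bool" where
  "open_subgroup G H \<longleftrightarrow> perm_group H \<and> H \<subseteq> G \<and> (\<exists>A. finite A \<and> pointwise_stabilizer G A \<subseteq> H)"

definition supports :: "(nat \<Rightarrow> nat) set \<Rightarrow> (nat \<Rightarrow> nat) set \<Rightarrow> nat set \<Rightarrow> bool" where
  "supports G H K \<longleftrightarrow>
     fin_closed G K \<and> pointwise_stabilizer G K \<subseteq> H \<and> H \<subseteq> setwise_stabilizer G K"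

definition wei :: "(nat \<Rightarrow> nat) set \<Rightarrow> bool" where
  "wei G \<longleftrightarrow> (\<forall>H. open_subgroup G H \<longrightarrow> (\<exists>K. supports G H K \<and> (\<forall>K'. supports G H K' \<longrightarrow> K \<subseteq> K')))"

lemma weak_elim_imaginaries_iff:
  assumes "univ M = UNIV" "perm_group (Aut L M)"
  shows "weak_elim_imaginaries L M \<longleftrightarrow> wei (Aut L M)"
proof -
  have fac: "fin_alg_closed L M K \<longleftrightarrow> fin_closed (Aut L M) K" for K
    by (auto simp: fin_alg_closed_def fin_closed_def assms(1) acl_def)
  have uniq: "(\<exists>!K. P K \<and> (\<forall>K'. P K' \<longrightarrow> K \<subseteq> K')) \<longleftrightarrow> (\<exists>K. P K \<and> (\<forall>K'. P K' \<longrightarrow> K \<subseteq> K'))"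
    for P :: "nat set \<Rightarrow> bool" by (metis subset_antisym)
  show ?thesis
    unfolding weak_elim_imaginaries_def Let_def uniq assms(1) subgroup_restrict_iff[OF assms(2)] fac
    by (auto simp: wei_def supports_def open_subgroup_def)
qed

text \<open>Languages and structures disappear here: the remaining conditions concern the
  permutation group alone, which is the form in which Borel measurability can be checked. In the
  converse direction the canonical structure is the witness.\<close>

theorem WEI_groups_iff:
  "G \<in> WEI_groups \<longleftrightarrow> G \<in> closed_subgroups \<and> oligomorphic G \<and> wei G"
proof
  assume G: "G \<in> WEI_groups"
  then obtain L M where M: "G \<in> closed_subgroups" "univ M = UNIV" "omega_categorical L M"
    "weak_elim_imaginaries L M" "G = Aut L M" by (auto simp: WEI_groups_def)
  then have "perm_group (Aut L M)" by (simp add: closed_subgroups_iff)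
  then show "G \<in> closed_subgroups \<and> oligomorphic G \<and> wei G"
    using M oligomorphic_Aut[OF M(3,2)] weak_elim_imaginaries_iff[OF M(2)] by simp
next
  assume G: "G \<in> closed_subgroups \<and> oligomorphic G \<and> wei G"
  then interpret perm_group G by (simp add: closed_subgroups_iff)
  have Aut: "Aut canonical_lang (canonical_structure G) = G"
    using G by (intro Aut_canonical) (simp add: closed_subgroups_iff)
  have U: "univ (canonical_structure G) = UNIV" by (simp add: canonical_structure_def)
  have "perm_group G" ..
  then have "weak_elim_imaginaries canonical_lang (canonical_structure G)"
    using weak_elim_imaginaries_iff[OF U, of canonical_lang] G by (simp add: Aut)
  then show "G \<in> WEI_groups"
    using G Aut U canonical_omega_categorical unfolding WEI_groups_def by blast
qed

section \<open>Stabilizers, orbits and algebraic closure in an oligomorphic group\<close>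

locale oligo_group = perm_group +
  assumes closed: "closed_perm G" and oligo: "oligomorphic G"
begin

abbreviation stab :: "nat set \<Rightarrow> (nat \<Rightarrow> nat) set" where
  "stab A \<equiv> pointwise_stabilizer G A"

lemma stab_iff: "g \<in> stab A \<longleftrightarrow> g \<in> G \<and> (\<forall>a\<in>A. g a = a)"
  by (auto simp: pointwise_stabilizer_def)

lemma stab_perm_group: "perm_group (stab A)"
proof
  fix g h assume gh: "g \<in> stab A" "h \<in> stab A"
  then show "g \<circ> h \<in> stab A" using comp_mem by (auto simp: stab_iff)
next
  fix g assume g: "g \<in> stab A"
  then have "pinv g a = a" if "a \<in> A" for a using inv_apply[of g a] that by (auto simp: stab_iff)
  then show "pinv g \<in> stab A" using g inv_mem by (auto simp: stab_iff)
qed (auto simp: stab_iff bij id_mem)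

definition orb :: "nat set \<Rightarrow> nat \<Rightarrow> nat set" where
  "orb A a = (\<lambda>g. g a) ` stab A"

lemma acl_iff: "a \<in> acl G A \<longleftrightarrow> finite (orb A a)"
  by (auto simp: acl_def algebraic_over_def orb_def Setcompr_eq_image)

lemma orbI: "g \<in> stab A \<Longrightarrow> x = g a \<Longrightarrow> x \<in> orb A a"
  by (auto simp: orb_def)

lemma orb_eq: "g \<in> stab A \<Longrightarrow> orb A (g a) = orb A a"
proof -
  assume g: "g \<in> stab A"
  interpret S: perm_group "stab A" by (rule stab_perm_group)
  have "h a \<in> orb A (g a)" if "h \<in> stab A" for h
    unfolding orb_def using S.comp_mem[OF that S.inv_mem[OF g]] S.inv_apply[OF g]
    by (intro image_eqI[of _ _ "h \<circ> pinv g"]) auto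
  moreover have "h (g a) \<in> orb A a" if "h \<in> stab A" for h
    unfolding orb_def using S.comp_mem[OF that g] by (intro image_eqI[of _ _ "h \<circ> g"]) auto
  ultimately show ?thesis by (auto simp: orb_def)
qed

text \<open>One point is appended to a listing of \<open>A\<close>: if two such extended tuples are
  in the same orbit under \<open>G\<close>, the group element between them fixes the listing. So
  orbit representatives of tuples with one more entry suffice.\<close>

lemma finitely_many_orbits:
  assumes "finite A"
  obtains F where "finite F" "\<And>x. \<exists>y\<in>F. \<exists>g\<in>stab A. g y = x"
proof -
  obtain xs where xs: "set xs = A" using assms finite_list by blast
  obtain F where F: "finite F" "\<And>zs. length zs = Suc (length xs) \<Longrightarrow> \<exists>ys\<in>F. \<exists>g\<in>G. map g ys = zs"
    by (rule oligomorphicE[OF oligo, where n = "Suc (length xs)"], rule that)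
  define r where "r ys = (SOME x. \<exists>g\<in>G. map g ys = xs @ [x])" for ys
  have "\<exists>y\<in>r ` F. \<exists>g\<in>stab A. g y = x" for x
  proof -
    obtain ys g where g: "ys \<in> F" "g \<in> G" "map g ys = xs @ [x]" using F(2)[of "xs @ [x]"] by auto
    then have "\<exists>x. \<exists>g\<in>G. map g ys = xs @ [x]" by blast
    from someI_ex[OF this] obtain g' where g': "g' \<in> G" "map g' ys = xs @ [r ys]"
      unfolding r_def by blast
    let ?h = "g \<circ> pinv g'"
    have "map (pinv g') (map g' ys) = ys" using g'(1) by (simp add: inv_comp)
    then have "map ?h (xs @ [r ys]) = xs @ [x]" using g(3) g'(2) by (metis map_map)
    then have h: "map ?h xs = xs" "?h (r ys) = x" by simp_all
    then have "?h \<in> stab A"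
      using comp_mem[OF g(2) inv_mem[OF g'(1)]] xs by (simp add: stab_iff map_idI) (metis map_eq_conv map_ident comp_apply)
    then show ?thesis using h(2) g(1) by blast
  qed
  then show ?thesis using that[of "r ` F"] F(1) by blast
qed

lemma finite_acl:
  assumes "finite A"
  shows "finite (acl G A)"
proof -
  obtain F where F: "finite F" "\<And>x. \<exists>y\<in>F. \<exists>g\<in>stab A. g y = x"
    using finitely_many_orbits[OF assms] by blast
  have "acl G A \<subseteq> (\<Union>y\<in>{y\<in>F. finite (orb A y)}. orb A y)"
  proof
    fix x assume x: "x \<in> acl G A"
    obtain y g where y: "y \<in> F" "g \<in> stab A" "g y = x" using F(2) by blast
    have "orb A y = orb A x" using orb_eq[OF y(2), of y] y(3) by simp
    moreover have "x \<in> orb A y" using y by (auto simp: orb_def)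
    ultimately show "x \<in> (\<Union>y\<in>{y\<in>F. finite (orb A y)}. orb A y)"
      using x y(1) by (auto simp: acl_iff)
  qed
  then show ?thesis using F(1) by (auto elim: finite_subset)
qed

lemma acl_extensive: "A \<subseteq> acl G A"
proof
  fix a assume "a \<in> A"
  then have "orb A a \<subseteq> {a}" by (auto simp: orb_def stab_iff)
  then show "a \<in> acl G A" by (auto simp: acl_iff elim: finite_subset)
qed

lemma stab_antimono: "A \<subseteq> B \<Longrightarrow> stab B \<subseteq> stab A"
  by (meson stab_iff subset_iff)

lemma acl_mono: "A \<subseteq> B \<Longrightarrow> acl G A \<subseteq> acl G B"
  using finite_subset[OF image_mono[OF stab_antimono]] by (auto simp: acl_iff orb_def)

lemma stab_preserves_acl: "g \<in> stab A \<Longrightarrow> a \<in> acl G A \<Longrightarrow> g a \<in> acl G A"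
  by (simp add: acl_iff orb_eq)

text \<open>
  Elements of the stabilizer of \<open>A\<close> that agree on the finite set \<open>C = acl A\<close> differ by an
  element of the stabilizer of \<open>C\<close>, and there are finitely many restrictions to \<open>C\<close>.
\<close>

lemma acl_idem:
  assumes "finite A"
  shows "acl G (acl G A) = acl G A"
proof
  let ?C = "acl G A"
  show "acl G ?C \<subseteq> ?C"
  proof
    fix b assume b: "b \<in> acl G ?C"
    define R where "R = (\<lambda>g. restrict g ?C) ` stab A"
    have "R \<subseteq> ?C \<rightarrow>\<^sub>E ?C" using stab_preserves_acl by (auto simp: R_def)
    then have finR: "finite R" using finite_PiE[OF finite_acl[OF assms]] finite_acl[OF assms]
      by (metis finite_subset)
    define c where "c r = (SOME g. g \<in> stab A \<and> restrict g ?C = r)" for r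
    have c: "c r \<in> stab A" "restrict (c r) ?C = r" if "r \<in> R" for r
    proof -
      have "\<exists>g. g \<in> stab A \<and> restrict g ?C = r" using that by (auto simp: R_def)
      from someI_ex[OF this] show "c r \<in> stab A" "restrict (c r) ?C = r" by (auto simp: c_def)
    qed
    have "orb A b \<subseteq> (\<Union>r\<in>R. c r ` orb ?C b)"
    proof
      fix x assume "x \<in> orb A b"
      then obtain g where g: "g \<in> stab A" "x = g b" by (auto simp: orb_def)
      let ?r = "restrict g ?C"
      have r: "?r \<in> R" using g by (auto simp: R_def)
      have cG: "c ?r \<in> G" "g \<in> G" using c(1)[OF r] g(1) by (auto simp: stab_iff)
      have "pinv (c ?r) (g a) = a" if "a \<in> ?C" for a
        using fun_cong[OF c(2)[OF r], of a] that inv_apply[OF cG(1), of a] by simp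
      then have "pinv (c ?r) \<circ> g \<in> stab ?C"
        using comp_mem[OF inv_mem[OF cG(1)] cG(2)] by (auto simp: stab_iff)
      then have "pinv (c ?r) x \<in> orb ?C b" using g(2) by (auto intro: orbI)
      then have "x \<in> c ?r ` orb ?C b" using apply_inv[OF cG(1), of x] by (metis imageI)
      then show "x \<in> (\<Union>r\<in>R. c r ` orb ?C b)" using r by blast
    qed
    moreover have "finite (orb ?C b)" using b by (simp add: acl_iff)
    ultimately show "b \<in> ?C" using finR by (auto simp: acl_iff elim: finite_subset)
  qed
qed (rule acl_extensive)

lemma fin_closed_acl: "finite A \<Longrightarrow> fin_closed G (acl G A)"
  by (simp add: fin_closed_def finite_acl acl_idem)

lemma fin_closed_finite: "fin_closed G K \<Longrightarrow> finite K"
  by (simp add: fin_closed_def)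

lemma acl_subset: "fin_closed G K \<Longrightarrow> A \<subseteq> K \<Longrightarrow> acl G A \<subseteq> K"
  using acl_mono[of A K] by (auto simp: fin_closed_def)

lemma acl_image:
  assumes g: "g \<in> G"
  shows "acl G (g ` A) = g ` acl G A"
proof -
  have sub: "g a \<in> acl G (g ` A)" if "a \<in> acl G A" "g \<in> G" for a A g
  proof -
    have "orb (g ` A) (g a) \<subseteq> g ` orb A a"
    proof
      fix x assume "x \<in> orb (g ` A) (g a)"
      then obtain h where h: "h \<in> G" "\<And>b. b \<in> A \<Longrightarrow> h (g b) = g b" "x = h (g a)"
        by (auto simp: orb_def stab_iff)
      then have "pinv g \<circ> (h \<circ> g) \<in> stab A"
        using that(2) by (auto simp: stab_iff inv_apply intro!: comp_mem inv_mem)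
      then have "pinv g x \<in> orb A a" using h(3) by (auto intro: orbI)
      then show "x \<in> g ` orb A a" using apply_inv[OF that(2), of x] by (metis imageI)
    qed
    then show ?thesis using that(1) by (auto simp: acl_iff elim: finite_subset)
  qed
  show ?thesis
  proof
    show "g ` acl G A \<subseteq> acl G (g ` A)" using sub[OF _ g] by blast
    show "acl G (g ` A) \<subseteq> g ` acl G A"
    proof
      fix x assume "x \<in> acl G (g ` A)"
      from sub[OF this inv_mem[OF g]] have "pinv g x \<in> acl G A"
        by (simp add: image_image inv_apply[OF g])
      then show "x \<in> g ` acl G A" using apply_inv[OF g, of x] by (metis imageI)
    qed
  qed
qed

lemma fin_closed_image: "g \<in> G \<Longrightarrow> fin_closed G K \<Longrightarrow> fin_closed G (g ` K)"
  by (simp add: fin_closed_def acl_image image_mono)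

text \<open>Moving a tuple by \<open>g\<close> moves its closure by \<open>g\<close>, so the size of
  the closure depends only on the orbit of the tuple.\<close>

lemma acl_bounded: "\<exists>B. \<forall>xs. length xs = n \<longrightarrow> card (acl G (set xs)) \<le> B"
proof -
  obtain F where F: "finite F" "\<And>zs. length zs = n \<Longrightarrow> \<exists>ys\<in>F. \<exists>g\<in>G. map g ys = zs"
    by (rule oligomorphicE[OF oligo, where n = n], rule that)
  have "card (acl G (set xs)) \<le> Max ((\<lambda>ys. card (acl G (set ys))) ` F)" if xs: "length xs = n" for xs
  proof -
    obtain ys g where g: "ys \<in> F" "g \<in> G" "map g ys = xs" using F(2)[OF xs] by blast
    have "acl G (set xs) = g ` acl G (set ys)" using acl_image[OF g(2), of "set ys"] g(3) by auto
    then have "card (acl G (set xs)) \<le> card (acl G (set ys))"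
      using card_image_le[OF finite_acl[of "set ys"], of g] by simp
    also have "\<dots> \<le> Max ((\<lambda>ys. card (acl G (set ys))) ` F)" using F(1) g(1) by (intro Max_ge) auto
    finally show ?thesis .
  qed
  then show ?thesis by blast
qed

section \<open>Bounding a closed set by the number of its closed subsets\<close>

definition closed_subsets :: "nat set \<Rightarrow> nat set set" where
  "closed_subsets K = {K'. K' \<subseteq> K \<and> fin_closed G K'}"

lemma finite_closed_subsets: "finite K \<Longrightarrow> finite (closed_subsets K)"
  by (rule finite_subset[of _ "Pow K"]) (auto simp: closed_subsets_def)

text \<open>Take a maximal proper closed subset \<open>J\<close> and a point \<open>a\<close> of
  \<open>K\<close> outside it. By maximality the generators of \<open>J\<close> together with
  \<open>a\<close> generate \<open>K\<close>, and \<open>J\<close> has fewer closed subsets than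
  \<open>K\<close> because \<open>K\<close> itself is lost.\<close>

lemma few_generators:
  "fin_closed G K \<Longrightarrow> \<exists>xs. length xs \<le> card (closed_subsets K) \<and> acl G (set xs) = K"
proof (induction "card K" arbitrary: K rule: less_induct)
  case less
  note K = fin_closed_finite[OF less.prems]
  show ?case
  proof (cases "closed_subsets K = {K}")
    case True
    have "acl G {} \<in> closed_subsets K"
      using acl_subset[OF less.prems, of "{}"] fin_closed_acl[of "{}"] by (auto simp: closed_subsets_def)
    then show ?thesis using True by (intro exI[of _ "[]"]) auto
  next
    case False
    moreover have "K \<in> closed_subsets K" using less.prems by (auto simp: closed_subsets_def)
    ultimately have ne: "closed_subsets K - {K} \<noteq> {}" by blast
    have "finite (closed_subsets K - {K})" using finite_closed_subsets[OF K] by simp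
    from finite_has_maximal[OF this ne]
    obtain J where J: "J \<in> closed_subsets K - {K}"
      and max: "\<And>J'. J' \<in> closed_subsets K - {K} \<Longrightarrow> J \<subseteq> J' \<Longrightarrow> J = J'" by blast
    then have JK: "J \<subset> K" "fin_closed G J" by (auto simp: closed_subsets_def)
    obtain xs where xs: "length xs \<le> card (closed_subsets J)" "acl G (set xs) = J"
      using less.hyps[OF psubset_card_mono[OF K JK(1)] JK(2)] by blast
    obtain a where a: "a \<in> K" "a \<notin> J" using JK(1) by blast
    let ?J' = "acl G (set (a # xs))"
    have J': "J \<subseteq> ?J'" "a \<in> ?J'"
      using acl_mono[of "set xs" "set (a # xs)"] xs(2) acl_extensive[of "set (a # xs)"] by auto
    have "set (a # xs) \<subseteq> K" using acl_extensive[of "set xs"] xs(2) JK(1) a(1) by auto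
    then have "?J' \<in> closed_subsets K"
      using acl_subset[OF less.prems] fin_closed_acl[of "set (a # xs)"] by (auto simp: closed_subsets_def)
    then have "?J' = K" using max[of ?J'] J' a(2) by blast
    moreover have "closed_subsets J \<subset> closed_subsets K"
      using JK less.prems by (auto simp: closed_subsets_def)
    then have "card (closed_subsets J) < card (closed_subsets K)"
      by (rule psubset_card_mono[OF finite_closed_subsets[OF K]])
    ultimately show ?thesis using xs(1) by (intro exI[of _ "a # xs"]) auto
  qed
qed

lemma closed_sets_bounded: "\<exists>B. \<forall>K. fin_closed G K \<longrightarrow> card (closed_subsets K) \<le> n \<longrightarrow> card K \<le> B"
proof -
  obtain B where B: "\<And>m xs. length xs = m \<Longrightarrow> card (acl G (set xs)) \<le> B m" using acl_bounded by metis
  have "card K \<le> Max (B ` {..n})" if K: "fin_closed G K" "card (closed_subsets K) \<le> n" for K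
  proof -
    obtain xs where xs: "length xs \<le> card (closed_subsets K)" "acl G (set xs) = K"
      using few_generators[OF K(1)] by blast
    have "card K \<le> B (length xs)" using B[of xs] xs(2) by simp
    also have "\<dots> \<le> Max (B ` {..n})" using xs(1) K(2) by (intro Max_ge) auto
    finally show ?thesis .
  qed
  then show ?thesis by blast
qed

end

lemma WEI_groups_oligo: "G \<in> WEI_groups \<Longrightarrow> oligo_group G"
  by (simp add: WEI_groups_iff closed_subgroups_iff oligo_group_def oligo_group_axioms_def)

section \<open>The structure of partial automorphisms\<close>

definition part :: "(nat \<Rightarrow> nat) \<Rightarrow> nat set \<Rightarrow> (nat \<times> nat) set" where
  "part g K = (\<lambda>x. (x, g x)) ` K"

lemma in_part_iff: "(x, y) \<in> part g K \<longleftrightarrow> x \<in> K \<and> y = g x"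
  by (auto simp: part_def)

lemma part_comp: "part g K O part h (g ` K) = part (h \<circ> g) K"
  by (force simp: in_part_iff)

definition partials :: "(nat \<Rightarrow> nat) set \<Rightarrow> (nat \<times> nat) set set" where
  "partials G = {part g K | g K. g \<in> G \<and> fin_closed G K}"

definition below :: "(nat \<Rightarrow> nat) set \<Rightarrow> (nat \<times> nat) set \<Rightarrow> (nat \<times> nat) set set" where
  "below G p = {q \<in> partials G. q \<subseteq> p}"

text \<open>
  The partial maps \<open>g|K\<close>, with \<open>K\<close> finite algebraically closed, under restriction and composition.
  The symbol \<open>r\<close> of arity 1 bounds the number of restrictions; it cuts the structure into
  pieces on which \<open>G\<close> has finitely many orbits by conjugation.
\<close>

definition coarse_lang :: language where
  "coarse_lang = \<lparr>fun_syms = {}, rel_syms = UNIV\<rparr>"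

definition coarse :: "(nat \<Rightarrow> nat) set \<Rightarrow> (nat \<times> nat) set fo_structure" where
  "coarse G = \<lparr>univ = partials G, fun_interp = (\<lambda>_ _. {}),
     rel_interp = (\<lambda>r xs. case xs of
         [p] \<Rightarrow> card (below G p) \<le> r
       | [p, q] \<Rightarrow> p \<subseteq> q
       | [p, q, s] \<Rightarrow> s \<subseteq> q O p
       | _ \<Rightarrow> False)\<rparr>"

lemma univ_coarse: "univ (coarse G) = partials G"
  by (simp add: coarse_def)

lemma rel_coarse_simps:
  "rel_interp (coarse G) r [p] \<longleftrightarrow> card (below G p) \<le> r"
  "rel_interp (coarse G) r [p, q] \<longleftrightarrow> p \<subseteq> q"
  "rel_interp (coarse G) r [p, q, s] \<longleftrightarrow> s \<subseteq> q O p"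
  "rel_interp (coarse G) r [] \<longleftrightarrow> False"
  "rel_interp (coarse G) r (p # q # s # t # xs) \<longleftrightarrow> False"
  by (simp_all add: coarse_def)

text \<open>The unary cardinality predicates follow from inclusion: an order isomorphism maps
  \<open>below G p\<close> bijectively onto \<open>below H (\<theta> p)\<close>.\<close>

lemma coarse_isomorphism_iff:
  "struct_isomorphism coarse_lang (coarse G) (coarse H) \<theta> \<longleftrightarrow>
     bij_betw \<theta> (partials G) (partials H) \<and>
     (\<forall>p\<in>partials G. \<forall>q\<in>partials G. p \<subseteq> q \<longleftrightarrow> \<theta> p \<subseteq> \<theta> q) \<and>
     (\<forall>p\<in>partials G. \<forall>q\<in>partials G. \<forall>s\<in>partials G. s \<subseteq> q O p \<longleftrightarrow> \<theta> s \<subseteq> \<theta> q O \<theta> p)"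
    (is "_ \<longleftrightarrow> ?bij \<and> ?ord \<and> ?comp")
proof
  assume iso: "struct_isomorphism coarse_lang (coarse G) (coarse H) \<theta>"
  note rel = struct_isomorphism_rel[OF iso, unfolded univ_coarse]
  have "?bij" using iso by (simp add: struct_isomorphism_def univ_coarse)
  moreover have "?ord" using rel[of 0 "[p, q]" for p q] by (simp add: rel_coarse_simps coarse_lang_def)
  moreover have "?comp" using rel[of 0 "[p, q, s]" for p q s] by (simp add: rel_coarse_simps coarse_lang_def)
  ultimately show "?bij \<and> ?ord \<and> ?comp" by (intro conjI)
next
  assume asm: "?bij \<and> ?ord \<and> ?comp"
  have bij: "?bij" using asm by (rule conjunct1)
  have ord: "?ord" using asm[THEN conjunct2] by (rule conjunct1)
  have comp: "?comp" using asm[THEN conjunct2] by (rule conjunct2)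
  have card: "card (below G p) = card (below H (\<theta> p))" if p: "p \<in> partials G" for p
  proof (rule bij_betw_same_card)
    show "bij_betw \<theta> (below G p) (below H (\<theta> p))"
      unfolding bij_betw_def
    proof
      show "inj_on \<theta> (below G p)" using bij by (auto simp: bij_betw_def below_def inj_on_def)
      show "\<theta> ` below G p = below H (\<theta> p)"
      proof
        show "\<theta> ` below G p \<subseteq> below H (\<theta> p)" using bij ord p by (auto simp: below_def bij_betw_def)
        show "below H (\<theta> p) \<subseteq> \<theta> ` below G p"
        proof
          fix q assume q: "q \<in> below H (\<theta> p)"
          then obtain q' where "q' \<in> partials G" "q = \<theta> q'"
            using bij unfolding bij_betw_def below_def by blast
          then show "q \<in> \<theta> ` below G p" using ord p q unfolding below_def by blast
        qed
      qed
    qed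
  qed
  have "rel_interp (coarse G) r xs \<longleftrightarrow> rel_interp (coarse H) r (map \<theta> xs)"
    if "set xs \<subseteq> partials G" for r xs
  proof -
    note * = that card ord comp
    show ?thesis
    proof (cases xs)
      case xs: (Cons p ys)
      show ?thesis
      proof (cases ys)
        case ys: (Cons q zs)
        show ?thesis
        proof (cases zs)
          case zs: (Cons s ts)
          show ?thesis using * by (cases ts) (simp_all add: xs ys zs rel_coarse_simps)
        qed (use * in \<open>simp add: xs ys rel_coarse_simps\<close>)
      qed (use * in \<open>simp add: xs rel_coarse_simps\<close>)
    qed (simp add: rel_coarse_simps)
  qed
  then show "struct_isomorphism coarse_lang (coarse G) (coarse H) \<theta>"
    using bij by (auto simp: struct_isomorphism_def univ_coarse coarse_lang_def)
qed

section \<open>Conjugation on the partial maps and atomicity\<close>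

context oligo_group
begin

lemma partialsI: "g \<in> G \<Longrightarrow> fin_closed G K \<Longrightarrow> part g K \<in> partials G"
  by (auto simp: partials_def)

lemma partialsE:
  assumes "p \<in> partials G"
  obtains g K where "g \<in> G" "fin_closed G K" "p = part g K"
  using assms by (auto simp: partials_def)

lemma partials_finite: "p \<in> partials G \<Longrightarrow> finite p"
  by (auto simp: partials_def part_def dest: fin_closed_finite)

lemma countable_partials: "countable (partials G)"
  by (rule countable_subset[OF _ countable_Collect_finite]) (auto dest: partials_finite)

lemma is_structure_coarse: "is_structure coarse_lang (coarse G)"
  using partialsI[OF id_mem fin_closed_acl[of "{}"]]
  by (auto simp: is_structure_def univ_coarse coarse_lang_def)

lemma conj_part:
  assumes "g \<in> G"
  shows "map_prod g g ` part h K = part (g \<circ> h \<circ> pinv g) (g ` K)"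
  by (auto simp: part_def image_iff inv_apply[OF assms])

lemma conj_isomorphism:
  assumes g: "g \<in> G"
  shows "struct_isomorphism coarse_lang (coarse G) (coarse G) ((`) (map_prod g g))"
proof -
  have inj: "inj (map_prod g g)" using bij[OF g] by (simp add: prod.inj_map bij_is_inj)
  have inv: "map_prod h h ` map_prod g g ` p = p" if "h \<circ> g = id" for h g :: "nat \<Rightarrow> nat" and p
    using that by (simp add: image_comp map_prod.comp map_prod.id)
  have mem: "map_prod g g ` p \<in> partials G" if p: "p \<in> partials G" and g: "g \<in> G" for p g
  proof -
    obtain h K where h: "h \<in> G" "fin_closed G K" "p = part h K" using p by (rule partialsE)
    show ?thesis
      unfolding h(3) conj_part[OF g]
      by (intro partialsI comp_mem inv_mem fin_closed_image g h)
  qed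
  have "bij_betw ((`) (map_prod g g)) (partials G) (partials G)"
    by (rule bij_betw_byWitness[where f' = "(`) (map_prod (pinv g) (pinv g))"])
      (use mem g inv_mem[OF g] inv[OF inv_comp[OF g]] inv[OF comp_inv[OF g]] in auto)
  moreover have "p \<subseteq> q \<longleftrightarrow> map_prod g g ` p \<subseteq> map_prod g g ` q" for p q
    using inj by (simp add: inj_image_subset_iff)
  moreover have "(map_prod g g ` q) O (map_prod g g ` p) = map_prod g g ` (q O p)" for p q
    by (force simp: eq_iff[OF g] relcomp_unfold image_iff)
  ultimately show ?thesis unfolding coarse_isomorphism_iff by simp
qed

text \<open>Restrictions of \<open>g\<close> to different closed subsets of \<open>K\<close> differ,
  having different domains. A bound on the number of restrictions therefore bounds the size of the
  domain, by \<open>closed_sets_bounded\<close>.\<close>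

lemma card_below:
  assumes "g \<in> G" "fin_closed G K"
  shows "card (closed_subsets K) \<le> card (below G (part g K))"
proof (rule card_inj_on_le)
  show "part g ` closed_subsets K \<subseteq> below G (part g K)"
    using assms by (auto simp: closed_subsets_def below_def partials_def part_def)
  have "Domain (part g K') = K'" for K' by (auto simp: part_def)
  then show "inj_on (part g) (closed_subsets K)" by (metis inj_onI)
  show "finite (below G (part g K))"
    by (rule finite_subset[of _ "Pow (part g K)"])
      (use fin_closed_finite[OF assms(2)] in \<open>auto simp: below_def part_def\<close>)
qed

text \<open>
  Modulo conjugation, all entries of a tuple whose entries have few restrictions live on one
  fixed finite set.
\<close>

lemma finitely_many_conjugates:
  fixes k n :: nat
  shows "\<exists>Z. finite Z \<and> (\<forall>e. (\<forall>i<k. e i \<in> partials G \<and> card (below G (e i)) \<le> n) \<longrightarrow>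
      (\<exists>g\<in>G. \<forall>i<k. map_prod g g ` e i \<subseteq> Z \<times> Z))"
proof -
  obtain B where B: "\<And>K. fin_closed G K \<Longrightarrow> card (closed_subsets K) \<le> n \<Longrightarrow> card K \<le> B"
    using closed_sets_bounded by blast
  have "\<exists>F. finite F \<and> (\<forall>xs. length xs = m \<longrightarrow> (\<exists>ys\<in>F. \<exists>g\<in>G. map g ys = xs))" for m
    using oligo by (simp add: oligomorphic_def)
  then obtain F where F: "\<And>m. finite (F m)" "\<And>m xs. length xs = m \<Longrightarrow> \<exists>ys\<in>F m. \<exists>g\<in>G. map g ys = xs"
    by metis
  \<comment> \<open>Each of the \<open>k\<close> partial maps has at most \<open>B\<close> points in
    its domain and at most \<open>B\<close> in its range, hence \<open>k * (2 * B)\<close> points in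
    all; \<open>Z\<close> collects the entries of orbit representatives for all tuples up to that
    length.\<close>
  define Z where "Z = (\<Union>m\<le>k * (2 * B). \<Union>ys\<in>F m. set ys)"
  have "finite Z" unfolding Z_def using F(1) by auto
  moreover have "\<exists>g\<in>G. \<forall>i<k. map_prod g g ` e i \<subseteq> Z \<times> Z"
    if e: "\<forall>i<k. e i \<in> partials G \<and> card (below G (e i)) \<le> n" for e
  proof -
    have fld: "finite (Field (e i)) \<and> card (Field (e i)) \<le> 2 * B" if i: "i < k" for i
    proof -
      obtain g K where gK: "g \<in> G" "fin_closed G K" "e i = part g K" using e i partialsE by blast
      have "card K \<le> B"
        by (rule B[OF gK(2)]) (use card_below[OF gK(1,2)] e i gK(3) in auto)
      moreover have "Field (e i) = K \<union> g ` K" by (auto simp: gK(3) part_def Field_def)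
      moreover have "card (K \<union> g ` K) \<le> card K + card K"
        using card_Un_le[of K "g ` K"] card_image_le[OF fin_closed_finite[OF gK(2)], of g] by linarith
      ultimately show ?thesis using fin_closed_finite[OF gK(2)] by auto
    qed
    let ?W = "\<Union>i<k. Field (e i)"
    have finW: "finite ?W" using fld by auto
    have "card ?W \<le> (\<Sum>i<k. card (Field (e i)))" by (rule card_UN_le) simp
    also have "\<dots> \<le> (\<Sum>i<k. 2 * B)" by (rule sum_mono) (use fld in auto)
    finally have card: "card ?W \<le> k * (2 * B)" by simp
    let ?w = "sorted_list_of_set ?W"
    obtain ys g where ys: "ys \<in> F (length ?w)" "g \<in> G" "map g ys = ?w" using F(2) by blast
    have "length ?w \<le> k * (2 * B)" using card by simp
    then have ysZ: "set ys \<subseteq> Z" using ys(1) unfolding Z_def by blast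
    have W: "?W = g ` set ys" using finW ys(3) by (metis list.set_map set_sorted_list_of_set)
    have "pinv g x \<in> Z" if "x \<in> ?W" for x
      using that ysZ unfolding W by (auto simp: inv_apply[OF ys(2)])
    then have "map_prod (pinv g) (pinv g) ` e i \<subseteq> Z \<times> Z" if "i < k" for i
      using that by (fastforce simp: Field_def)
    then show ?thesis using inv_mem[OF ys(2)] by blast
  qed
  ultimately show ?thesis by blast
qed

lemma atomic_coarse: "atomic coarse_lang (coarse G)"
  unfolding atomic_def
proof (intro allI ballI)
  fix k e assume e: "e \<in> env (coarse G)"
  define n where "n = Max ((\<lambda>i. card (below G (e i))) ` {..<k})"
  define \<delta> where "\<delta> = conj_list (map (\<lambda>i. Atom n [Var i]) [0..<k])"
  have ne: "univ (coarse G) \<noteq> {}" using is_structure_coarse by (simp add: is_structure_def)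
  have \<delta>: "\<delta> \<in> fmla coarse_lang k"
    unfolding \<delta>_def by (rule fmla_conj_list) (auto simp: fmla_def coarse_lang_def)
  have sat: "satisfies (coarse G) e' \<delta> \<longleftrightarrow> (\<forall>i<k. card (below G (e' i)) \<le> n)" for e'
    unfolding \<delta>_def satisfies_conj_list[OF ne] by (auto simp: rel_coarse_simps)
  have "card (below G (e i)) \<le> n" if "i < k" for i
    unfolding n_def using that by (intro Max_ge) auto
  then have sat_e: "satisfies (coarse G) e \<delta>" by (simp add: sat)
  obtain Z where Z: "finite Z"
    "\<And>e. \<forall>i<k. e i \<in> partials G \<and> card (below G (e i)) \<le> n \<Longrightarrow>
      \<exists>g\<in>G. \<forall>i<k. map_prod g g ` e i \<subseteq> Z \<times> Z"
    using finitely_many_conjugates[of k n] by blast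
  \<comment> \<open>All \<open>k\<close>-tuples of subsets of \<open>Z \<times> Z\<close>, extended
    by the empty set, whether or not these subsets are partial maps of \<open>G\<close>.\<close>
  let ?T = "{t. \<forall>i. (i \<in> {..<k} \<longrightarrow> t i \<in> Pow (Z \<times> Z)) \<and> (i \<notin> {..<k} \<longrightarrow> t i = {})}"
  show "isolated coarse_lang k (coarse G) e"
  proof (rule isolated_if_finite_types[OF is_structure_coarse \<delta> sat_e e])
    show "finite ?T" by (rule finite_set_of_finite_funs) (use Z(1) in auto)
    fix e' assume e': "e' \<in> env (coarse G)" "satisfies (coarse G) e' \<delta>"
    have "e' i \<in> partials G" for i using env_in[OF e'(1)] by (simp add: univ_coarse)
    then obtain g where g: "g \<in> G" "\<And>i. i < k \<Longrightarrow> map_prod g g ` e' i \<subseteq> Z \<times> Z"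
      using Z(2)[of e'] e'(2) sat by blast
    let ?t = "\<lambda>i. if i < k then map_prod g g ` e' i else {}"
    have "same_type coarse_lang k (coarse G) e' (coarse G) ((`) (map_prod g g) \<circ> e')"
      by (rule isomorphism_same_type[OF conj_isomorphism[OF g(1)] is_structure_coarse e'(1)])
    then have "same_type coarse_lang k (coarse G) e' (coarse G) ?t"
      by (rule same_type_cong) auto
    moreover have "?t \<in> ?T" using g(2) by simp
    ultimately show "\<exists>t\<in>?T. same_type coarse_lang k (coarse G) e' (coarse G) t" by blast
  qed
qed

end

theorem coarse_isomorphic_iff_theory:
  assumes "oligo_group G" "oligo_group H"
  shows "(\<exists>\<theta>. struct_isomorphism coarse_lang (coarse G) (coarse H) \<theta>) \<longleftrightarrow>
    theory_of coarse_lang (coarse G) = theory_of coarse_lang (coarse H)"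
proof -
  interpret G: oligo_group G by fact
  interpret H: oligo_group H by fact
  note S = G.is_structure_coarse H.is_structure_coarse
  have eq_iff: "elem_equiv coarse_lang (coarse G) (coarse H) \<longleftrightarrow>
      theory_of coarse_lang (coarse G) = theory_of coarse_lang (coarse H)"
    by (auto simp: elem_equiv_def theory_of_def)
  show ?thesis
  proof
    assume "\<exists>\<theta>. struct_isomorphism coarse_lang (coarse G) (coarse H) \<theta>"
    then show "theory_of coarse_lang (coarse G) = theory_of coarse_lang (coarse H)"
      using isomorphism_elem_equiv[OF _ S(1)] eq_iff by blast
  next
    assume "theory_of coarse_lang (coarse G) = theory_of coarse_lang (coarse H)"
    then have eq: "elem_equiv coarse_lang (coarse G) (coarse H)" using eq_iff by blast
    have "univ (coarse G) \<noteq> {}" "univ (coarse H) \<noteq> {}" using S by (simp_all add: is_structure_def)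
    from this[THEN env_nonempty] obtain e e' where e: "e \<in> env (coarse G)" "e' \<in> env (coarse H)"
      by blast
    have c: "countable (univ (coarse G))" "countable (univ (coarse H))"
      by (simp_all add: univ_coarse G.countable_partials H.countable_partials)
    show "\<exists>\<theta>. struct_isomorphism coarse_lang (coarse G) (coarse H) \<theta>"
      by (rule atomic_unique[OF eq S G.atomic_coarse H.atomic_coarse c same_type_0[OF eq e] e]) blast
  qed
qed

subsection \<open>From isomorphisms of coarse structures to topological isomorphisms\<close>

text \<open>The inverse \<open>\<eta>\<close> is a parameter in order to make the situation
  symmetric: by \<open>swap\<close>, every result about \<open>\<theta>\<close> is available for
  \<open>\<eta>\<close>.\<close>

locale coarse_iso =
  G: oligo_group G + H: oligo_group H for G H +
  fixes \<theta> \<eta>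
  assumes iso: "struct_isomorphism coarse_lang (coarse G) (coarse H) \<theta>"
    and iso': "struct_isomorphism coarse_lang (coarse H) (coarse G) \<eta>"
    and \<eta>\<theta>: "p \<in> partials G \<Longrightarrow> \<eta> (\<theta> p) = p"
    and \<theta>\<eta>: "q \<in> partials H \<Longrightarrow> \<theta> (\<eta> q) = q"
begin

lemma \<theta>_mem: "p \<in> partials G \<Longrightarrow> \<theta> p \<in> partials H"
  using iso by (auto simp: coarse_isomorphism_iff dest: bij_betwE)

lemma \<theta>_sub: "p \<in> partials G \<Longrightarrow> q \<in> partials G \<Longrightarrow> p \<subseteq> q \<Longrightarrow> \<theta> p \<subseteq> \<theta> q"
  using iso by (simp add: coarse_isomorphism_iff)

lemma \<theta>_comp: "p \<in> partials G \<Longrightarrow> q \<in> partials G \<Longrightarrow> s \<in> partials G \<Longrightarrow> s \<subseteq> q O p \<Longrightarrow> \<theta> s \<subseteq> \<theta> q O \<theta> p"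
  using iso by (simp add: coarse_isomorphism_iff)

lemma swap: "coarse_iso H G \<eta> \<theta>"
  by unfold_locales (fact iso iso' \<eta>\<theta> \<theta>\<eta>)+

text \<open>Identities are the partial maps with \<open>p \<subseteq> p O p\<close>: the inclusion
  gives \<open>h x = h (h x)\<close> on the domain, and \<open>h\<close> is injective.\<close>

lemma \<theta>_identity:
  assumes "fin_closed G K"
  obtains L where "fin_closed H L" "\<theta> (part id K) = part id L"
proof -
  have p: "part id K \<in> partials G" by (rule G.partialsI[OF G.id_mem assms])
  obtain h L where h: "h \<in> H" "fin_closed H L" "\<theta> (part id K) = part h L"
    using \<theta>_mem[OF p] by (rule H.partialsE)
  have "part h L \<subseteq> part h L O part h L"
    using \<theta>_comp[OF p p p] h(3) part_comp[of id K id] by simp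
  have "h x = x" if "x \<in> L" for x
  proof -
    have "(x, h x) \<in> part h L O part h L"
      using \<open>part h L \<subseteq> part h L O part h L\<close> that by (auto simp: in_part_iff)
    then have "h x = h (h x)" by (auto simp: in_part_iff)
    then show ?thesis using H.eq_iff[OF h(1)] by metis
  qed
  then have "part h L = part id L" by (auto simp: part_def)
  then show ?thesis using that h by simp
qed

text \<open>The domain is recognized by composition: precomposing \<open>part g K\<close> with the
  identity of \<open>K\<close> changes nothing, which puts the domain into \<open>L\<close>;
  following it by its inverse gives that identity, which puts \<open>L\<close> into the
  domain.\<close>

lemma domain_\<theta>:
  assumes g: "g \<in> G" and K: "fin_closed G K" and L: "\<theta> (part id K) = part id L"
  shows "Domain (\<theta> (part g K)) = L"
proof -
  have p: "part id K \<in> partials G" "part g K \<in> partials G" "part (pinv g) (g ` K) \<in> partials G"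
    by (intro G.partialsI G.id_mem g K G.inv_mem G.fin_closed_image)+
  have sub: "\<theta> (part g K) \<subseteq> part id L O \<theta> (part g K)"
    using \<theta>_comp[OF p(2,1,2)] L part_comp[of id K g] by simp
  have sup: "part id L \<subseteq> \<theta> (part g K) O \<theta> (part (pinv g) (g ` K))"
    using \<theta>_comp[OF p(3,2,1)] L part_comp[of g K "pinv g"] G.inv_comp[OF g] by simp
  have "x \<in> L" if "(x, y) \<in> \<theta> (part g K)" for x y
    using subsetD[OF sub that] by (auto simp: in_part_iff)
  moreover have "x \<in> Domain (\<theta> (part g K))" if "x \<in> L" for x
    using subsetD[OF sup, of "(x, x)"] that by (auto simp: in_part_iff)
  ultimately show ?thesis by auto
qed

text \<open>The coherent system of images of the restrictions of \<open>g\<close>, glued into one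
  relation; it turns out to be the graph of an element of \<open>H\<close>.\<close>

definition limit_graph :: "(nat \<Rightarrow> nat) \<Rightarrow> (nat \<times> nat) set" where
  "limit_graph g = (\<Union>K\<in>Collect (fin_closed G). \<theta> (part g K))"

lemma \<theta>_form:
  assumes "g \<in> G" "fin_closed G K"
  obtains h L where "h \<in> H" "fin_closed H L" "\<theta> (part g K) = part h L"
  using \<theta>_mem[OF G.partialsI[OF assms]] by (rule H.partialsE)

text \<open>Closed sets are directed: the restrictions of \<open>g\<close> to \<open>K\<close> and
  \<open>K'\<close> extend to the closure of \<open>K \<union> K'\<close>, and the image of that
  restriction is part of a single element of \<open>H\<close>.\<close>

lemma limit_graph_pair:
  assumes g: "g \<in> G" and xy: "z \<in> limit_graph g" "z' \<in> limit_graph g"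
  obtains h L where "h \<in> H" "z \<in> part h L" "z' \<in> part h L"
proof -
  obtain K K' where K: "fin_closed G K" "z \<in> \<theta> (part g K)" "fin_closed G K'" "z' \<in> \<theta> (part g K')"
    using xy by (auto simp: limit_graph_def)
  let ?J = "acl G (K \<union> K')"
  have J: "fin_closed G ?J" using K by (intro G.fin_closed_acl) (auto dest: G.fin_closed_finite)
  have "K \<subseteq> ?J" "K' \<subseteq> ?J" using G.acl_extensive[of "K \<union> K'"] by auto
  then have "\<theta> (part g K) \<subseteq> \<theta> (part g ?J)" "\<theta> (part g K') \<subseteq> \<theta> (part g ?J)"
    by (intro \<theta>_sub G.partialsI g K J; auto simp: part_def)+
  then have z: "z \<in> \<theta> (part g ?J)" "z' \<in> \<theta> (part g ?J)" using K by blast+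
  obtain h L where "h \<in> H" "\<theta> (part g ?J) = part h L" using g J by (rule \<theta>_form)
  then show ?thesis using that[of h L] z by simp
qed

lemma limit_graph_inj:
  assumes "g \<in> G" "(x, y) \<in> limit_graph g" "(x', y') \<in> limit_graph g"
  shows "x = x' \<longleftrightarrow> y = y'"
proof -
  obtain h L where "h \<in> H" "(x, y) \<in> part h L" "(x', y') \<in> part h L"
    using assms by (rule limit_graph_pair)
  then show ?thesis by (auto simp: in_part_iff H.eq_iff)
qed

text \<open>The identity on the closure of \<open>A\<close> in \<open>H\<close> is pulled back by
  \<open>\<eta>\<close>. This is why the domains of the images \<open>\<theta> (part g K)\<close>
  exhaust all points.\<close>

lemma covering:
  assumes A: "finite A"
  obtains K L where "fin_closed G K" "fin_closed H L" "A \<subseteq> L" "\<theta> (part id K) = part id L"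
proof -
  interpret S: coarse_iso H G \<eta> \<theta> by (rule swap)
  have L: "fin_closed H (acl H A)" by (rule H.fin_closed_acl[OF A])
  obtain K where K: "fin_closed G K" "\<eta> (part id (acl H A)) = part id K" by (rule S.\<theta>_identity[OF L])
  have "\<theta> (part id K) = part id (acl H A)"
    using \<theta>\<eta>[OF H.partialsI[OF H.id_mem L]] K(2) by simp
  then show ?thesis using that K(1) L H.acl_extensive by blast
qed

definition limit :: "(nat \<Rightarrow> nat) \<Rightarrow> nat \<Rightarrow> nat" where
  "limit g x = (THE y. (x, y) \<in> limit_graph g)"

lemma limit_graph_total:
  assumes g: "g \<in> G"
  shows "\<exists>y. (x, y) \<in> limit_graph g"
proof -
  obtain K L where KL: "fin_closed G K" "fin_closed H L" "{x} \<subseteq> L" "\<theta> (part id K) = part id L"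
    by (rule covering[of "{x}"]) auto
  have "x \<in> Domain (\<theta> (part g K))" using domain_\<theta>[OF g KL(1,4)] KL(3) by simp
  then show ?thesis using KL(1) by (auto simp: limit_graph_def)
qed

text \<open>A preimage of \<open>y\<close> comes from factoring the identity of \<open>K\<close> as
  the inverse of \<open>g\<close> followed by \<open>g\<close>.\<close>

lemma limit_graph_onto:
  assumes g: "g \<in> G"
  shows "\<exists>x. (x, y) \<in> limit_graph g"
proof -
  obtain K L where KL: "fin_closed G K" "fin_closed H L" "{y} \<subseteq> L" "\<theta> (part id K) = part id L"
    by (rule covering[of "{y}"]) auto
  let ?K' = "pinv g ` K"
  have K': "fin_closed G ?K'" by (rule G.fin_closed_image[OF G.inv_mem[OF g] KL(1)])
  have "part id K \<subseteq> part (pinv g) K O part g ?K'" using part_comp[of "pinv g" K g] G.comp_inv[OF g] by simp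
  then have "\<theta> (part id K) \<subseteq> \<theta> (part (pinv g) K) O \<theta> (part g ?K')"
    by (intro \<theta>_comp G.partialsI g K' KL G.inv_mem G.id_mem)
  moreover have "(y, y) \<in> \<theta> (part id K)" using KL by (simp add: in_part_iff)
  ultimately obtain z where "(z, y) \<in> \<theta> (part g ?K')" by blast
  then show ?thesis using K' by (auto simp: limit_graph_def)
qed

lemma limit_graph_iff:
  assumes g: "g \<in> G"
  shows "(x, y) \<in> limit_graph g \<longleftrightarrow> y = limit g x"
proof -
  obtain z where z: "(x, z) \<in> limit_graph g" using limit_graph_total[OF g] by blast
  then have "limit g x = z"
    unfolding limit_def by (rule the_equality) (use limit_graph_inj[OF g _ z] in auto)
  then show ?thesis using z limit_graph_inj[OF g z, of x y] by auto
qed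

lemma limit_bij: "g \<in> G \<Longrightarrow> bij (limit g)"
proof (rule bijI)
  assume g: "g \<in> G"
  note iff = limit_graph_iff[OF g]
  show "inj (limit g)" using limit_graph_inj[OF g] iff by (metis injI)
  show "surj (limit g)" using limit_graph_onto[OF g] iff by (metis surjI)
qed

lemma \<theta>_part:
  assumes g: "g \<in> G" and K: "fin_closed G K" and L: "\<theta> (part id K) = part id L"
  shows "\<theta> (part g K) = part (limit g) L"
proof -
  have "\<theta> (part g K) \<subseteq> limit_graph g" using K by (auto simp: limit_graph_def)
  then have "y = limit g x" if "(x, y) \<in> \<theta> (part g K)" for x y
    using that limit_graph_iff[OF g] by blast
  then show ?thesis using domain_\<theta>[OF g K L] by (auto simp: in_part_iff)
qed

text \<open>On a finite set the limit is given by one image \<open>\<theta> (part g K)\<close>,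
  which is a restriction of an element of \<open>H\<close>; closedness of \<open>H\<close> does the
  rest.\<close>

lemma limit_mem:
  assumes g: "g \<in> G"
  shows "limit g \<in> H"
proof -
  have "\<exists>h\<in>H. \<forall>a\<in>A. h a = limit g a" if A: "finite A" for A
  proof -
    obtain K L where KL: "fin_closed G K" "fin_closed H L" "A \<subseteq> L" "\<theta> (part id K) = part id L"
      by (rule covering[OF A])
    obtain h L' where h: "h \<in> H" "\<theta> (part g K) = part h L'" using g KL(1) by (rule \<theta>_form)
    then have "part h L' = part (limit g) L" using \<theta>_part[OF g KL(1,4)] by simp
    then have "(a, limit g a) \<in> part h L'" if "a \<in> L" for a using that by (simp add: in_part_iff)
    then have "h a = limit g a" if "a \<in> L" for a using that by (simp add: in_part_iff)
    then show ?thesis using h(1) KL(3) by blast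
  qed
  then show ?thesis using H.closed limit_bij[OF g] by (simp add: closed_perm_def)
qed

lemma limit_unique:
  assumes g: "g \<in> G" and f: "\<And>K. fin_closed G K \<Longrightarrow> \<theta> (part g K) \<subseteq> {(x, y). y = f x}"
  shows "limit g = f"
proof
  fix x
  have "(x, limit g x) \<in> limit_graph g" using limit_graph_iff[OF g] by simp
  then show "limit g x = f x" using f by (auto simp: limit_graph_def)
qed

lemma \<theta>_limit: "g \<in> G \<Longrightarrow> fin_closed G K \<Longrightarrow> (x, y) \<in> \<theta> (part g K) \<Longrightarrow> y = limit g x"
  using limit_graph_iff[of g x y] by (auto simp: limit_graph_def)

lemma limit_comp:
  assumes g: "g \<in> G" "g' \<in> G"
  shows "limit (g \<circ> g') = limit g \<circ> limit g'"
proof (rule limit_unique[OF G.comp_mem[OF g]])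
  fix K assume K: "fin_closed G K"
  have K': "fin_closed G (g' ` K)" by (rule G.fin_closed_image[OF g(2) K])
  have "part (g \<circ> g') K \<subseteq> part g' K O part g (g' ` K)" by (simp add: part_comp)
  then have "\<theta> (part (g \<circ> g') K) \<subseteq> \<theta> (part g' K) O \<theta> (part g (g' ` K))"
    by (intro \<theta>_comp G.partialsI g K K' G.comp_mem)
  then show "\<theta> (part (g \<circ> g') K) \<subseteq> {(x, y). y = (limit g \<circ> limit g') x}"
    using \<theta>_limit[OF g(2) K] \<theta>_limit[OF g(1) K'] by fastforce
qed

text \<open>On \<open>L\<close> the limit of \<open>g\<close> is determined by the single partial
  map \<open>part g K\<close>, so agreement on the finite set \<open>K\<close> suffices.\<close>

lemma limit_continuous:
  assumes "finite B"
  shows "\<exists>A. finite A \<and> (\<forall>g\<in>G. \<forall>h\<in>G. (\<forall>a\<in>A. g a = h a) \<longrightarrow> (\<forall>b\<in>B. limit g b = limit h b))"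
proof -
  obtain K L where KL: "fin_closed G K" "fin_closed H L" "B \<subseteq> L" "\<theta> (part id K) = part id L"
    by (rule covering[OF assms])
  have "\<forall>b\<in>B. limit g b = limit h b" if gh: "g \<in> G" "h \<in> G" "\<forall>a\<in>K. g a = h a" for g h
  proof
    fix b assume b: "b \<in> B"
    have "part g K = part h K" using gh(3) by (auto simp: part_def)
    then have "part (limit g) L = part (limit h) L"
      using \<theta>_part[OF gh(1) KL(1,4)] \<theta>_part[OF gh(2) KL(1,4)] by simp
    moreover have "(b, limit g b) \<in> part (limit g) L" using b KL(3) by (auto simp: in_part_iff)
    ultimately show "limit g b = limit h b" by (auto simp: in_part_iff)
  qed
  then show ?thesis using G.fin_closed_finite[OF KL(1)] by blast
qed

end

lemma (in coarse_iso) limit_inverse: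
  assumes g: "g \<in> G"
  shows "coarse_iso.limit H \<eta> (limit g) = g"
proof -
  interpret S: coarse_iso H G \<eta> \<theta> by (rule swap)
  show ?thesis
  proof (rule S.limit_unique[OF limit_mem[OF g]])
    fix L assume L: "fin_closed H L"
    obtain K where K: "fin_closed G K" "\<eta> (part id L) = part id K" using L by (rule S.\<theta>_identity)
    have "\<theta> (part id K) = part id L" using \<theta>\<eta>[OF H.partialsI[OF H.id_mem L]] K(2) by simp
    then have "\<theta> (part g K) = part (limit g) L" by (rule \<theta>_part[OF g K(1)])
    then have "\<eta> (part (limit g) L) = part g K" using \<eta>\<theta>[OF G.partialsI[OF g K(1)]] by metis
    then show "\<eta> (part (limit g) L) \<subseteq> {(x, y). y = g x}" by (auto simp: part_def)
  qed
qed

subsection \<open>Topological isomorphisms\<close>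

text \<open>Uniform continuity with respect to agreement on finite sets: one \<open>A\<close> serves
  for all pairs \<open>g\<close>, \<open>h\<close>. For homomorphisms of permutation groups it
  amounts to continuity.\<close>

definition fin_continuous :: "(nat \<Rightarrow> nat) set \<Rightarrow> ((nat \<Rightarrow> nat) \<Rightarrow> nat \<Rightarrow> nat) \<Rightarrow> bool" where
  "fin_continuous G \<phi> \<longleftrightarrow> (\<forall>B. finite B \<longrightarrow>
     (\<exists>A. finite A \<and> (\<forall>g\<in>G. \<forall>h\<in>G. (\<forall>a\<in>A. g a = h a) \<longrightarrow> (\<forall>b\<in>B. \<phi> g b = \<phi> h b))))"

lemma continuous_map_fin_continuous:
  assumes "fin_continuous G \<phi>" "\<And>g. g \<in> G \<Longrightarrow> \<phi> g \<in> H"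
  shows "continuous_map (top_of_set G) (top_of_set H) \<phi>"
  unfolding continuous_map_def topspace_euclidean_subtopology
proof (intro conjI allI impI)
  show "\<phi> \<in> G \<rightarrow> H" using assms(2) by blast
  fix U assume U: "openin (top_of_set H) U"
  show "openin (top_of_set G) {g \<in> G. \<phi> g \<in> U}"
    unfolding openin_pointwise_iff
  proof (intro conjI ballI)
    fix g assume g: "g \<in> {g \<in> G. \<phi> g \<in> U}"
    then obtain B where B: "finite B" "{h \<in> H. \<forall>b\<in>B. h b = \<phi> g b} \<subseteq> U"
      using U unfolding openin_pointwise_iff by blast
    obtain A where A: "finite A" "\<forall>g\<in>G. \<forall>h\<in>G. (\<forall>a\<in>A. g a = h a) \<longrightarrow> (\<forall>b\<in>B. \<phi> g b = \<phi> h b)"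
      using assms(1)[unfolded fin_continuous_def, rule_format, OF B(1)] by blast
    have "\<phi> h \<in> U" if h: "h \<in> G" "\<forall>a\<in>A. h a = g a" for h
      using A(2)[rule_format, OF h(1), of g] h(2) g assms(2)[OF h(1)] B(2) by blast
    then show "\<exists>A. finite A \<and> {h \<in> G. \<forall>a\<in>A. h a = g a} \<subseteq> {g \<in> G. \<phi> g \<in> U}"
      using A(1) by blast
  qed auto
qed

text \<open>Continuity at the identity gives a finite \<open>A\<close>; it works everywhere because,
  if \<open>g\<close> and \<open>h\<close> agree on \<open>A\<close>, then
  \<open>pinv h \<circ> g\<close> fixes \<open>A\<close> pointwise.\<close>

lemma fin_continuous_continuous_map:
  assumes "perm_group G" "perm_group H" "continuous_map (top_of_set G) (top_of_set H) \<phi>"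
    and mem: "\<And>g. g \<in> G \<Longrightarrow> \<phi> g \<in> H"
    and hom: "\<And>g h. g \<in> G \<Longrightarrow> h \<in> G \<Longrightarrow> \<phi> (g \<circ> h) = \<phi> g \<circ> \<phi> h"
  shows "fin_continuous G \<phi>"
  unfolding fin_continuous_def
proof (intro allI impI)
  interpret G: perm_group G by fact
  interpret H: perm_group H by fact
  fix B :: "nat set" assume B: "finite B"
  let ?U = "{h \<in> H. \<forall>b\<in>B. h b = b}"
  have "openin (top_of_set H) ?U" unfolding openin_pointwise_iff using B by auto
  then have op: "openin (top_of_set G) {g \<in> G. \<phi> g \<in> ?U}"
    using assms(3) unfolding continuous_map_def topspace_euclidean_subtopology by blast
  have "\<phi> id = id"
    using hom[OF G.id_mem G.id_mem] by (intro H.idempotent_imp_id mem G.id_mem) simp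
  then have "id \<in> {g \<in> G. \<phi> g \<in> ?U}" using G.id_mem H.id_mem by simp
  then obtain A where A: "finite A" "{g \<in> G. \<forall>a\<in>A. g a = id a} \<subseteq> {g \<in> G. \<phi> g \<in> ?U}"
    using op unfolding openin_pointwise_iff by blast
  have "\<forall>b\<in>B. \<phi> g b = \<phi> h b" if gh: "g \<in> G" "h \<in> G" "\<forall>a\<in>A. g a = h a" for g h
  proof
    fix b assume b: "b \<in> B"
    have k: "pinv h \<circ> g \<in> G" by (intro G.comp_mem G.inv_mem gh)
    have "\<forall>a\<in>A. (pinv h \<circ> g) a = id a" using gh G.inv_apply by simp
    then have "\<phi> (pinv h \<circ> g) \<in> ?U" using A(2) k by blast
    then have "\<phi> (pinv h \<circ> g) b = b" using b by blast
    moreover have "h \<circ> (pinv h \<circ> g) = g" using G.comp_inv[OF gh(2)] by (metis comp_assoc id_comp)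
    then have "\<phi> g = \<phi> h \<circ> \<phi> (pinv h \<circ> g)" using hom[OF gh(2) k] by simp
    ultimately show "\<phi> g b = \<phi> h b" by simp
  qed
  then show "\<exists>A. finite A \<and> (\<forall>g\<in>G. \<forall>h\<in>G. (\<forall>a\<in>A. g a = h a) \<longrightarrow> (\<forall>b\<in>B. \<phi> g b = \<phi> h b))"
    using A(1) by blast
qed

locale topo_iso = G: perm_group G + H: perm_group H for G H +
  fixes \<phi> \<psi>
  assumes \<phi>_mem: "g \<in> G \<Longrightarrow> \<phi> g \<in> H" and \<psi>_mem: "h \<in> H \<Longrightarrow> \<psi> h \<in> G"
    and \<psi>\<phi>: "g \<in> G \<Longrightarrow> \<psi> (\<phi> g) = g" and \<phi>\<psi>: "h \<in> H \<Longrightarrow> \<phi> (\<psi> h) = h"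
    and \<phi>_comp: "g \<in> G \<Longrightarrow> g' \<in> G \<Longrightarrow> \<phi> (g \<circ> g') = \<phi> g \<circ> \<phi> g'"
    and \<phi>_cont: "fin_continuous G \<phi>" and \<psi>_cont: "fin_continuous H \<psi>"
begin

lemma \<psi>_comp: "h \<in> H \<Longrightarrow> h' \<in> H \<Longrightarrow> \<psi> (h \<circ> h') = \<psi> h \<circ> \<psi> h'"
  using \<phi>_comp \<phi>\<psi> \<psi>\<phi> \<psi>_mem G.comp_mem by metis

lemma swap: "topo_iso H G \<psi> \<phi>"
  by unfold_locales (simp_all add: \<phi>_mem \<psi>_mem \<psi>\<phi> \<phi>\<psi> \<psi>_comp \<phi>_cont \<psi>_cont)

lemma \<phi>_id: "\<phi> id = id"
  using \<phi>_comp[OF G.id_mem G.id_mem] by (intro H.idempotent_imp_id \<phi>_mem G.id_mem) simp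

lemma \<phi>_inv: "g \<in> G \<Longrightarrow> \<phi> (pinv g) = pinv (\<phi> g)"
proof
  fix x assume g: "g \<in> G"
  have "\<phi> g \<circ> \<phi> (pinv g) = id" using \<phi>_comp[OF g G.inv_mem[OF g]] G.comp_inv[OF g] \<phi>_id by simp
  then have "\<phi> g (\<phi> (pinv g) x) = x" by (metis comp_apply id_apply)
  then show "\<phi> (pinv g) x = pinv (\<phi> g) x" using H.inv_apply[OF \<phi>_mem[OF g]] by metis
qed

end

lemma topologically_isomorphic_iff:
  assumes "perm_group G" "perm_group H"
  shows "topologically_isomorphic G H \<longleftrightarrow> (\<exists>\<phi> \<psi>. topo_iso G H \<phi> \<psi>)"
proof -
  interpret G: perm_group G by fact
  interpret H: perm_group H by fact
  have mult: "g \<otimes>\<^bsub>Sym_omega\<lparr>carrier := K\<rparr>\<^esub> h = g \<circ> h" if "bij g" "bij h" for g h K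
    using BijGroup_UNIV_simps(2)[OF that] by simp
  show ?thesis
  proof
    assume "topologically_isomorphic G H"
    then obtain \<phi> where \<phi>: "\<phi> \<in> iso (Sym_omega\<lparr>carrier := G\<rparr>) (Sym_omega\<lparr>carrier := H\<rparr>)"
      "homeomorphic_map (top_of_set G) (top_of_set H) \<phi>" by (auto simp: topologically_isomorphic_def)
    have mem: "\<phi> g \<in> H" if "g \<in> G" for g using \<phi>(1) that by (auto simp: iso_def hom_def)
    have comp: "\<phi> (g \<circ> h) = \<phi> g \<circ> \<phi> h" if gh: "g \<in> G" "h \<in> G" for g h
    proof -
      have "\<phi> (g \<otimes>\<^bsub>Sym_omega\<lparr>carrier := G\<rparr>\<^esub> h) = \<phi> g \<otimes>\<^bsub>Sym_omega\<lparr>carrier := H\<rparr>\<^esub> \<phi> h"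
        using \<phi>(1) gh by (simp add: iso_def hom_def)
      then show ?thesis using mult G.bij[OF gh(1)] G.bij[OF gh(2)] H.bij[OF mem[OF gh(1)]] H.bij[OF mem[OF gh(2)]]
        by metis
    qed
    obtain \<psi> where "homeomorphic_maps (top_of_set G) (top_of_set H) \<phi> \<psi>"
      using \<phi>(2) homeomorphic_map_maps by blast
    then have c: "continuous_map (top_of_set G) (top_of_set H) \<phi>" "continuous_map (top_of_set H) (top_of_set G) \<psi>"
      and inv: "\<And>g. g \<in> G \<Longrightarrow> \<psi> (\<phi> g) = g" "\<And>h. h \<in> H \<Longrightarrow> \<phi> (\<psi> h) = h"
      by (auto simp: homeomorphic_maps_def)
    have mem': "\<psi> h \<in> G" if "h \<in> H" for h
      using c(2) that unfolding continuous_map_def topspace_euclidean_subtopology by blast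
    have comp': "\<psi> (g \<circ> h) = \<psi> g \<circ> \<psi> h" if "g \<in> H" "h \<in> H" for g h
      using comp inv mem' G.comp_mem that by metis
    have "topo_iso G H \<phi> \<psi>"
      by (intro topo_iso.intro topo_iso_axioms.intro assms mem mem' inv comp
          fin_continuous_continuous_map[OF assms c(1) mem comp]
          fin_continuous_continuous_map[OF assms(2,1) c(2) mem' comp'])
    then show "\<exists>\<phi> \<psi>. topo_iso G H \<phi> \<psi>" by blast
  next
    assume "\<exists>\<phi> \<psi>. topo_iso G H \<phi> \<psi>"
    then obtain \<phi> \<psi> where "topo_iso G H \<phi> \<psi>" by blast
    then interpret topo_iso G H \<phi> \<psi> .
    have "homeomorphic_maps (top_of_set G) (top_of_set H) \<phi> \<psi>"
      unfolding homeomorphic_maps_def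
      using continuous_map_fin_continuous[OF \<phi>_cont \<phi>_mem] continuous_map_fin_continuous[OF \<psi>_cont \<psi>_mem]
      by (simp add: \<psi>\<phi> \<phi>\<psi>)
    then have "homeomorphic_map (top_of_set G) (top_of_set H) \<phi>" using homeomorphic_map_maps by blast
    moreover have "bij_betw \<phi> G H"
      by (rule bij_betw_byWitness[where f' = \<psi>]) (use \<psi>\<phi> \<phi>\<psi> \<phi>_mem \<psi>_mem in auto)
    then have "\<phi> \<in> iso (Sym_omega\<lparr>carrier := G\<rparr>) (Sym_omega\<lparr>carrier := H\<rparr>)"
      unfolding iso_def hom_def using \<phi>_mem \<phi>_comp mult G.bij H.bij by auto
    ultimately show "topologically_isomorphic G H" unfolding topologically_isomorphic_def by blast
  qed
qed

lemma coarse_isomorphic_imp_topologically_isomorphic: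
  assumes "oligo_group G" "oligo_group H"
    and "struct_isomorphism coarse_lang (coarse G) (coarse H) \<theta>"
  shows "topologically_isomorphic G H"
proof -
  interpret G: oligo_group G by fact
  interpret H: oligo_group H by fact
  obtain \<eta> where \<eta>: "struct_isomorphism coarse_lang (coarse H) (coarse G) \<eta>"
    "\<And>p. p \<in> univ (coarse G) \<Longrightarrow> \<eta> (\<theta> p) = p"
    "\<And>q. q \<in> univ (coarse H) \<Longrightarrow> \<eta> q \<in> univ (coarse G) \<and> \<theta> (\<eta> q) = q"
    by (rule isomorphism_sym[OF assms(3) G.is_structure_coarse], rule that)
  interpret C: coarse_iso G H \<theta> \<eta>
    by unfold_locales (use assms(3) \<eta> in \<open>auto simp: univ_coarse\<close>)
  interpret S: coarse_iso H G \<eta> \<theta> by (rule C.swap)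
  have "topo_iso G H C.limit S.limit"
    by (intro topo_iso.intro topo_iso_axioms.intro G.perm_group_axioms H.perm_group_axioms
        C.limit_mem S.limit_mem C.limit_inverse S.limit_inverse C.limit_comp
        fin_continuous_def[THEN iffD2] allI impI C.limit_continuous S.limit_continuous)
  then show ?thesis
    using topologically_isomorphic_iff[OF G.perm_group_axioms H.perm_group_axioms] by blast
qed

subsection \<open>From topological isomorphisms to isomorphisms of coarse structures\<close>

text \<open>For \<open>p = part g K\<close> with \<open>g\<close> in \<open>G\<close> this is the
  left coset by \<open>g\<close> of the stabilizer of \<open>K\<close>. It turns relations between
  partial maps into relations between subsets of the group.\<close>

definition coset :: "(nat \<Rightarrow> nat) set \<Rightarrow> (nat \<times> nat) set \<Rightarrow> (nat \<Rightarrow> nat) set" where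
  "coset G p = {g \<in> G. \<forall>x y. (x, y) \<in> p \<longrightarrow> g x = y}"

text \<open>Finite index is expressed by a finite cover with left translates. Only multiplication
  and open subgroups enter, so the notion is invariant under topological isomorphisms.\<close>

definition rigid_subgroup :: "(nat \<Rightarrow> nat) set \<Rightarrow> (nat \<Rightarrow> nat) set \<Rightarrow> bool" where
  "rigid_subgroup G U \<longleftrightarrow> open_subgroup G U \<and>
     (\<forall>V. open_subgroup G V \<longrightarrow> V \<subseteq> U \<longrightarrow>
        (\<exists>F. finite F \<and> F \<subseteq> U \<and> U \<subseteq> (\<Union>f\<in>F. (\<circ>) f ` V)) \<longrightarrow> V = U)"

section \<open>Partial maps as cosets of stabilizers\<close>

context oligo_group
begin

lemma coset_part_iff: "h \<in> coset G (part g K) \<longleftrightarrow> h \<in> G \<and> (\<forall>x\<in>K. h x = g x)"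
  by (auto simp: coset_def part_def)

lemma coset_part:
  assumes g: "g \<in> G"
  shows "coset G (part g K) = (\<circ>) g ` stab K"
proof
  show "(\<circ>) g ` stab K \<subseteq> coset G (part g K)"
    using comp_mem[OF g] by (auto simp: coset_part_iff stab_iff)
  show "coset G (part g K) \<subseteq> (\<circ>) g ` stab K"
  proof
    fix h assume h: "h \<in> coset G (part g K)"
    then have mem: "pinv g \<circ> h \<in> stab K"
      using comp_mem[OF inv_mem[OF g]] by (auto simp: coset_part_iff stab_iff inv_apply[OF g])
    have "h = g \<circ> (pinv g \<circ> h)" using apply_inv[OF g] by auto
    then show "h \<in> (\<circ>) g ` stab K" by (rule image_eqI[OF _ mem])
  qed
qed

lemma stab_moves:
  assumes "fin_closed G K" "x \<notin> K"
  obtains u where "u \<in> stab K" "u x \<noteq> x"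
proof -
  have "x \<notin> acl G K" using assms by (auto simp: fin_closed_def)
  then have "\<not> orb K x \<subseteq> {x}" by (auto simp: acl_iff dest: finite_subset)
  then show ?thesis using that by (auto simp: orb_def)
qed

text \<open>If a point \<open>x\<close> of the domain of \<open>p\<close> were outside the domain
  \<open>J\<close> of \<open>q = part h J\<close>, an element \<open>u\<close> of the stabilizer of
  \<open>J\<close> with \<open>u x \<noteq> x\<close> would give two extensions \<open>h\<close> and
  \<open>h \<circ> u\<close> of \<open>q\<close> with different values at \<open>x\<close>.\<close>

lemma subset_iff_coset:
  assumes "p \<in> partials G" "q \<in> partials G"
  shows "p \<subseteq> q \<longleftrightarrow> coset G q \<subseteq> coset G p"
proof
  show "p \<subseteq> q \<Longrightarrow> coset G q \<subseteq> coset G p" by (auto simp: coset_def)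
  assume sub: "coset G q \<subseteq> coset G p"
  obtain h J where h: "h \<in> G" "fin_closed G J" "q = part h J" using assms(2) by (rule partialsE)
  have h_mem: "h \<in> coset G q" using h by (simp add: coset_part_iff)
  show "p \<subseteq> q"
  proof (rule subrelI)
    fix x y assume xy: "(x, y) \<in> p"
    have hx: "k x = y" if "k \<in> coset G q" for k using that sub xy by (auto simp: coset_def)
    show "(x, y) \<in> q"
    proof (cases "x \<in> J")
      case True
      then show ?thesis using hx[OF h_mem] h(3) by (simp add: in_part_iff)
    next
      case False
      obtain u where u: "u \<in> stab J" "u x \<noteq> x" using stab_moves[OF h(2) False] .
      have "h \<circ> u \<in> coset G q" using u(1) coset_part[OF h(1)] h(3) by blast
      then have "h (u x) = h x" using hx[OF h_mem] hx[of "h \<circ> u"] by simp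
      then show ?thesis using u(2) eq_iff[OF h(1)] by blast
    qed
  qed
qed

text \<open>The relation \<open>q O p\<close> applies \<open>q\<close> first, so it corresponds to
  products \<open>g \<circ> h\<close> with \<open>g\<close> extending \<open>p\<close> and
  \<open>h\<close> extending \<open>q\<close>. If \<open>x\<close> lies outside the domain of
  \<open>q\<close>, or \<open>h x\<close> outside that of \<open>p\<close>, then a stabilizer
  element moving this point changes the value of the product at \<open>x\<close>.\<close>

lemma relcomp_iff_coset:
  assumes "p \<in> partials G" "q \<in> partials G"
  shows "s \<subseteq> q O p \<longleftrightarrow> (\<forall>g\<in>coset G p. \<forall>h\<in>coset G q. g \<circ> h \<in> coset G s)"
proof
  assume "s \<subseteq> q O p"
  then show "\<forall>g\<in>coset G p. \<forall>h\<in>coset G q. g \<circ> h \<in> coset G s"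
    unfolding coset_def using comp_mem by fastforce
next
  assume *: "\<forall>g\<in>coset G p. \<forall>h\<in>coset G q. g \<circ> h \<in> coset G s"
  obtain h J where h: "h \<in> G" "fin_closed G J" "q = part h J" using assms(2) by (rule partialsE)
  obtain g K where g: "g \<in> G" "fin_closed G K" "p = part g K" using assms(1) by (rule partialsE)
  have hq: "h \<in> coset G q" and gp: "g \<in> coset G p" using g h by (simp_all add: coset_part_iff)
  show "s \<subseteq> q O p"
  proof (rule subrelI)
    fix x z assume xz: "(x, z) \<in> s"
    have eq: "k (l x) = z" if "k \<in> coset G p" "l \<in> coset G q" for k l
    proof -
      have "k \<circ> l \<in> coset G s" using * that by blast
      then show ?thesis using xz by (auto simp: coset_def)
    qed
    have "x \<in> J"
    proof (rule ccontr)
      assume "x \<notin> J"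
      obtain u where u: "u \<in> stab J" "u x \<noteq> x" using stab_moves[OF h(2) \<open>x \<notin> J\<close>] .
      have "h \<circ> u \<in> coset G q" using u(1) coset_part[OF h(1)] h(3) by blast
      from eq[OF gp this] eq[OF gp hq] have "g (h (u x)) = g (h x)" by simp
      then show False using u(2) eq_iff[OF h(1)] eq_iff[OF g(1)] by blast
    qed
    moreover have "h x \<in> K"
    proof (rule ccontr)
      assume "h x \<notin> K"
      obtain u where u: "u \<in> stab K" "u (h x) \<noteq> h x" using stab_moves[OF g(2) \<open>h x \<notin> K\<close>] .
      have "g \<circ> u \<in> coset G p" using u(1) coset_part[OF g(1)] g(3) by blast
      from eq[OF this hq] eq[OF gp hq] have "g (u (h x)) = g (h x)" by simp
      then show False using u(2) eq_iff[OF g(1)] by blast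
    qed
    ultimately show "(x, z) \<in> q O p"
      using eq[OF gp hq] g(3) h(3) by (auto simp: in_part_iff intro!: relcompI)
  qed
qed

lemma coset_inj: "p \<in> partials G \<Longrightarrow> q \<in> partials G \<Longrightarrow> coset G p = coset G q \<Longrightarrow> p = q"
  using subset_iff_coset by blast

lemma open_subgroup_stab: "finite K \<Longrightarrow> open_subgroup G (stab K)"
  unfolding open_subgroup_def using stab_perm_group by (auto simp: stab_iff)

text \<open>Let \<open>V\<close> have finite index in the stabilizer of \<open>K\<close> and let
  \<open>J\<close> support \<open>V\<close>. As \<open>V\<close> permutes \<open>J\<close>, finitely
  many translates of \<open>J\<close> cover the orbit of a point of \<open>J\<close> under the
  stabilizer of \<open>K\<close>, so the point is algebraic over \<open>K\<close>. Thus
  \<open>J \<subseteq> K\<close>, and the stabilizer of \<open>K\<close> is contained in that of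
  \<open>J\<close>, hence in \<open>V\<close>.\<close>

lemma rigid_stab:
  assumes "wei G" and K: "fin_closed G K"
  shows "rigid_subgroup G (stab K)"
  unfolding rigid_subgroup_def
proof (intro conjI allI impI)
  show "open_subgroup G (stab K)" by (rule open_subgroup_stab[OF fin_closed_finite[OF K]])
  fix V assume V: "open_subgroup G V" "V \<subseteq> stab K"
    and "\<exists>F. finite F \<and> F \<subseteq> stab K \<and> stab K \<subseteq> (\<Union>f\<in>F. (\<circ>) f ` V)"
  then obtain F where F: "finite F" "stab K \<subseteq> (\<Union>f\<in>F. (\<circ>) f ` V)" by blast
  obtain J where J: "supports G V J" using assms(1) V(1) unfolding wei_def by blast
  have "a \<in> K" if a: "a \<in> J" for a
  proof -
    have "orb K a \<subseteq> (\<Union>f\<in>F. f ` J)"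
    proof
      fix b assume "b \<in> orb K a"
      then obtain u where u: "u \<in> stab K" "b = u a" by (auto simp: orb_def)
      then obtain f v where fv: "f \<in> F" "v \<in> V" "u = f \<circ> v" using F(2) by blast
      have "v ` J = J" using J fv(2) by (auto simp: supports_def setwise_stabilizer_def)
      then show "b \<in> (\<Union>f\<in>F. f ` J)" using fv u a by auto
    qed
    moreover have "finite (\<Union>f\<in>F. f ` J)" using F(1) J by (auto simp: supports_def fin_closed_def)
    ultimately have "finite (orb K a)" by (rule finite_subset)
    then show ?thesis using K by (auto simp: fin_closed_def acl_iff)
  qed
  then have "stab K \<subseteq> stab J" by (intro stab_antimono) blast
  then show "V = stab K" using J V(2) by (auto simp: supports_def)
qed

text \<open>A subgroup supported by \<open>K\<close> permutes the finite set \<open>K\<close>, so it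
  contains the stabilizer of \<open>K\<close> with finite index: one representative
  \<open>c r\<close> for each restriction \<open>r\<close> to \<open>K\<close> is enough. Rigidity
  then forces equality.\<close>

lemma rigid_imp_stab:
  assumes "wei G" and U: "rigid_subgroup G U"
  obtains K where "fin_closed G K" "U = stab K"
proof -
  have op: "open_subgroup G U" using U by (simp add: rigid_subgroup_def)
  then obtain K where K: "supports G U K" using assms(1) unfolding wei_def by blast
  then have fin: "fin_closed G K" "finite K" and sub: "stab K \<subseteq> U"
    by (auto simp: supports_def fin_closed_def)
  have set: "u ` K = K" if "u \<in> U" for u
    using K that unfolding supports_def setwise_stabilizer_def by blast
  interpret U: perm_group U using op by (simp add: open_subgroup_def)
  have UG: "U \<subseteq> G" using op by (simp add: open_subgroup_def)
  define R where "R = (\<lambda>u. restrict u K) ` U"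
  have "u x \<in> K" if "u \<in> U" "x \<in> K" for u x using set[OF that(1)] that(2) by blast
  then have "R \<subseteq> K \<rightarrow>\<^sub>E K" by (auto simp: R_def)
  then have finR: "finite R" by (rule finite_subset) (intro finite_PiE fin)
  have "\<forall>r\<in>R. \<exists>u. u \<in> U \<and> restrict u K = r" by (auto simp: R_def)
  from bchoice[OF this] obtain c where c: "\<And>r. r \<in> R \<Longrightarrow> c r \<in> U \<and> restrict (c r) K = r" by blast
  have "U \<subseteq> (\<Union>f\<in>c ` R. (\<circ>) f ` stab K)"
  proof
    fix u assume u: "u \<in> U"
    let ?f = "c (restrict u K)"
    have r: "restrict u K \<in> R" using u by (auto simp: R_def)
    have f: "?f \<in> U" "?f a = u a" if "a \<in> K" for a
      using c[OF r] that by (auto dest: fun_cong[of _ _ a])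
    have fU: "?f \<in> U" using c[OF r] by blast
    have "pinv ?f (u a) = a" if "a \<in> K" for a
      using f(2)[OF that] U.inv_apply[OF fU, of a] by simp
    then have "pinv ?f \<circ> u \<in> stab K"
      using U.comp_mem[OF U.inv_mem[OF fU] u] UG by (auto simp: stab_iff)
    moreover have "u = ?f \<circ> (pinv ?f \<circ> u)" using U.apply_inv[OF fU] by auto
    ultimately show "u \<in> (\<Union>f\<in>c ` R. (\<circ>) f ` stab K)" using r by blast
  qed
  moreover have "finite (c ` R)" "c ` R \<subseteq> U" using finR c by auto
  ultimately have "stab K = U"
    using U open_subgroup_stab[OF fin(2)] sub unfolding rigid_subgroup_def by meson
  then show ?thesis using that fin by blast
qed

end

section \<open>Open and rigid subgroups under topological isomorphisms\<close>

context topo_iso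
begin

text \<open>The image contains a stabilizer because \<open>\<psi>\<close> is continuous: elements
  fixing \<open>B\<close> are mapped by \<open>\<psi>\<close> into the stabilizer of
  \<open>A\<close>.\<close>

lemma open_subgroup_image:
  assumes U: "open_subgroup G U"
  shows "open_subgroup H (\<phi> ` U)"
proof -
  interpret S: topo_iso H G \<psi> \<phi> by (rule swap)
  interpret U: perm_group U using U by (simp add: open_subgroup_def)
  have UG: "U \<subseteq> G" using U by (simp add: open_subgroup_def)
  obtain A where A: "finite A" "pointwise_stabilizer G A \<subseteq> U" using U by (auto simp: open_subgroup_def)
  obtain B where B: "finite B" "\<And>g h. g \<in> H \<Longrightarrow> h \<in> H \<Longrightarrow> (\<forall>b\<in>B. g b = h b) \<Longrightarrow> (\<forall>a\<in>A. \<psi> g a = \<psi> h a)"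
    using \<psi>_cont[unfolded fin_continuous_def, rule_format, OF A(1)] by blast
  have "perm_group (\<phi> ` U)"
  proof
    show "bij g" if "g \<in> \<phi> ` U" for g using that UG \<phi>_mem H.bij by blast
    show "id \<in> \<phi> ` U" using U.id_mem \<phi>_id by (metis imageI)
  next
    fix g h assume "g \<in> \<phi> ` U" "h \<in> \<phi> ` U"
    then obtain g' h' where gh: "g' \<in> U" "h' \<in> U" "g = \<phi> g'" "h = \<phi> h'" by blast
    then have "g \<circ> h = \<phi> (g' \<circ> h')" using \<phi>_comp UG by (metis subsetD)
    then show "g \<circ> h \<in> \<phi> ` U" using U.comp_mem[OF gh(1,2)] by blast
  next
    fix g assume "g \<in> \<phi> ` U"
    then obtain g' where g: "g' \<in> U" "g = \<phi> g'" by blast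
    then have "pinv g = \<phi> (pinv g')" using \<phi>_inv UG by (metis subsetD)
    then show "pinv g \<in> \<phi> ` U" using U.inv_mem[OF g(1)] by blast
  qed
  moreover have "\<phi> ` U \<subseteq> H" using UG \<phi>_mem by blast
  moreover have "pointwise_stabilizer H B \<subseteq> \<phi> ` U"
  proof
    fix h assume "h \<in> pointwise_stabilizer H B"
    then have h: "h \<in> H" "\<forall>b\<in>B. h b = id b" by (auto simp: pointwise_stabilizer_def)
    have "\<forall>a\<in>A. \<psi> h a = id a" using B(2)[OF h(1) H.id_mem h(2)] unfolding S.\<phi>_id .
    then have "\<psi> h \<in> pointwise_stabilizer G A"
      using \<psi>_mem[OF h(1)] by (simp add: pointwise_stabilizer_def)
    then show "h \<in> \<phi> ` U" using A(2) \<phi>\<psi>[OF h(1)] by (metis imageI subsetD)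
  qed
  ultimately show ?thesis using B(1) unfolding open_subgroup_def by blast
qed

lemma image_\<psi>\<phi>: "U \<subseteq> G \<Longrightarrow> \<psi> ` \<phi> ` U = U"
  unfolding image_image using \<psi>\<phi> by (metis (no_types, lifting) image_cong image_ident subsetD)

lemma rigid_subgroup_image:
  assumes U: "rigid_subgroup G U"
  shows "rigid_subgroup H (\<phi> ` U)"
  unfolding rigid_subgroup_def
proof (intro conjI allI impI)
  interpret S: topo_iso H G \<psi> \<phi> by (rule swap)
  have op: "open_subgroup G U" using U by (simp add: rigid_subgroup_def)
  then have UG: "U \<subseteq> G" by (simp add: open_subgroup_def)
  show "open_subgroup H (\<phi> ` U)" by (rule open_subgroup_image[OF op])
  fix V assume V: "open_subgroup H V" "V \<subseteq> \<phi> ` U"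
    and "\<exists>F. finite F \<and> F \<subseteq> \<phi> ` U \<and> \<phi> ` U \<subseteq> (\<Union>f\<in>F. (\<circ>) f ` V)"
  then obtain F where F: "finite F" "F \<subseteq> \<phi> ` U" "\<phi> ` U \<subseteq> (\<Union>f\<in>F. (\<circ>) f ` V)" by blast
  have VH: "V \<subseteq> H" using V(1) by (simp add: open_subgroup_def)
  have FH: "F \<subseteq> H" using F(2) UG \<phi>_mem by blast
  have "\<psi> ` V \<subseteq> U" "\<psi> ` F \<subseteq> U" using V(2) F(2) image_\<psi>\<phi>[OF UG] by blast+
  moreover have "open_subgroup G (\<psi> ` V)" by (rule S.open_subgroup_image[OF V(1)])
  moreover have "U \<subseteq> (\<Union>f\<in>\<psi> ` F. (\<circ>) f ` \<psi> ` V)"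
  proof
    fix u assume u: "u \<in> U"
    then obtain f v where fv: "f \<in> F" "v \<in> V" "\<phi> u = f \<circ> v" using F(3) by blast
    have "u = \<psi> (\<phi> u)" using \<psi>\<phi> u UG by auto
    also have "\<dots> = \<psi> f \<circ> \<psi> v" using fv VH FH \<psi>_comp by auto
    finally show "u \<in> (\<Union>f\<in>\<psi> ` F. (\<circ>) f ` \<psi> ` V)" using fv by blast
  qed
  moreover have "finite (\<psi> ` F)" using F(1) by simp
  ultimately have "\<psi> ` V = U" using U unfolding rigid_subgroup_def by meson
  then show "V = \<phi> ` U" using S.image_\<psi>\<phi>[OF VH] by simp
qed

end

locale wei_topo_iso = topo_iso + G: oligo_group G + H: oligo_group H +
  assumes weiG: "wei G" and weiH: "wei H"
begin

lemma swap_wei: "wei_topo_iso H G \<psi> \<phi>"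
  by (intro wei_topo_iso.intro swap H.oligo_group_axioms G.oligo_group_axioms
      wei_topo_iso_axioms.intro weiG weiH)

text \<open>Rigidity carries the stabilizer of \<open>K\<close> to that of some \<open>L\<close>,
  and multiplicativity carries the coset by \<open>g\<close> to the coset by
  \<open>\<phi> g\<close>.\<close>

lemma image_coset:
  assumes "p \<in> partials G"
  shows "\<exists>q. q \<in> partials H \<and> coset H q = \<phi> ` coset G p"
proof -
  obtain g K where g: "g \<in> G" "fin_closed G K" "p = part g K" using assms by (rule G.partialsE)
  obtain L where L: "fin_closed H L" "\<phi> ` G.stab K = H.stab L"
    by (rule H.rigid_imp_stab[OF weiH rigid_subgroup_image[OF G.rigid_stab[OF weiG g(2)]]])
  have "\<phi> ` coset G p = (\<lambda>u. \<phi> (g \<circ> u)) ` G.stab K" using G.coset_part[OF g(1)] g(3) by auto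
  also have "\<dots> = (\<lambda>u. \<phi> g \<circ> \<phi> u) ` G.stab K"
    by (rule image_cong) (use \<phi>_comp[OF g(1)] in \<open>auto simp: G.stab_iff\<close>)
  also have "\<dots> = (\<circ>) (\<phi> g) ` H.stab L" unfolding L(2)[symmetric] by (simp add: image_image)
  also have "\<dots> = coset H (part (\<phi> g) L)" by (rule H.coset_part[OF \<phi>_mem[OF g(1)], symmetric])
  finally show ?thesis using H.partialsI[OF \<phi>_mem[OF g(1)] L(1)] by auto
qed

text \<open>The map \<open>\<theta>\<close> is \<open>\<phi>\<close> acting on cosets. It preserves
  the relations because these are expressed by inclusion and multiplication of cosets.\<close>

lemma coarse_isomorphic: "\<exists>\<theta>. struct_isomorphism coarse_lang (coarse G) (coarse H) \<theta>"
proof -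
  interpret S: wei_topo_iso H G \<psi> \<phi> by (rule swap_wei)
  have "\<forall>p\<in>partials G. \<exists>q. q \<in> partials H \<and> coset H q = \<phi> ` coset G p" using image_coset by blast
  from bchoice[OF this] obtain \<theta> where
    \<theta>: "\<And>p. p \<in> partials G \<Longrightarrow> \<theta> p \<in> partials H" "\<And>p. p \<in> partials G \<Longrightarrow> coset H (\<theta> p) = \<phi> ` coset G p"
    by blast
  have cosG: "coset G p \<subseteq> G" for p by (auto simp: coset_def)
  have cosH: "coset H p \<subseteq> H" for p by (auto simp: coset_def)
  have inj: "\<phi> ` A \<subseteq> \<phi> ` B \<longleftrightarrow> A \<subseteq> B" if "A \<subseteq> G" "B \<subseteq> G" for A B
    using image_\<psi>\<phi>[OF that(1)] image_\<psi>\<phi>[OF that(2)] by (metis image_mono)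
  have mem: "\<phi> g \<in> \<phi> ` A \<longleftrightarrow> g \<in> A" if "g \<in> G" "A \<subseteq> G" for g A
    using inj[of "{g}" A] that by simp
  have "inj_on \<theta> (partials G)"
  proof (rule inj_onI)
    fix p q assume pq: "p \<in> partials G" "q \<in> partials G" "\<theta> p = \<theta> q"
    then have "\<phi> ` coset G p = \<phi> ` coset G q" using \<theta>(2) by metis
    then have "coset G p = coset G q" using image_\<psi>\<phi>[OF cosG] by metis
    then show "p = q" by (rule G.coset_inj[OF pq(1,2)])
  qed
  moreover have "\<theta> ` partials G = partials H"
  proof
    show "\<theta> ` partials G \<subseteq> partials H" using \<theta>(1) by blast
    show "partials H \<subseteq> \<theta> ` partials G"
    proof
      fix q assume q: "q \<in> partials H"
      obtain p where p: "p \<in> partials G" "coset G p = \<psi> ` coset H q" using S.image_coset[OF q] by blast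
      then have "coset H (\<theta> p) = coset H q" using \<theta>(2)[OF p(1)] S.image_\<psi>\<phi>[OF cosH] by simp
      then have "\<theta> p = q" by (rule H.coset_inj[OF \<theta>(1)[OF p(1)] q])
      then show "q \<in> \<theta> ` partials G" using p(1) by blast
    qed
  qed
  moreover have "p \<subseteq> q \<longleftrightarrow> \<theta> p \<subseteq> \<theta> q" if "p \<in> partials G" "q \<in> partials G" for p q
    using that by (simp add: G.subset_iff_coset H.subset_iff_coset \<theta> inj cosG)
  moreover have "s \<subseteq> q O p \<longleftrightarrow> \<theta> s \<subseteq> \<theta> q O \<theta> p"
    if pqs: "p \<in> partials G" "q \<in> partials G" "s \<in> partials G" for p q s
  proof -
    have "\<phi> g \<circ> \<phi> h \<in> \<phi> ` coset G s \<longleftrightarrow> g \<circ> h \<in> coset G s" if "g \<in> coset G p" "h \<in> coset G q" for g h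
    proof -
      have gh: "g \<in> G" "h \<in> G" using that cosG by blast+
      show ?thesis using mem[OF G.comp_mem[OF gh] cosG] \<phi>_comp[OF gh] by simp
    qed
    then show ?thesis
      unfolding G.relcomp_iff_coset[OF pqs(1,2)] H.relcomp_iff_coset[OF \<theta>(1)[OF pqs(1)] \<theta>(1)[OF pqs(2)]]
        \<theta>(2)[OF pqs(1)] \<theta>(2)[OF pqs(2)] \<theta>(2)[OF pqs(3)]
      by blast
  qed
  ultimately have "struct_isomorphism coarse_lang (coarse G) (coarse H) \<theta>"
    unfolding coarse_isomorphism_iff bij_betw_def by (intro conjI ballI)
  then show ?thesis by blast
qed

end

theorem topologically_isomorphic_iff_theory:
  assumes G: "G \<in> WEI_groups" and H: "H \<in> WEI_groups"
  shows "topologically_isomorphic G H \<longleftrightarrow>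
    theory_of coarse_lang (coarse G) = theory_of coarse_lang (coarse H)"
proof -
  interpret G: oligo_group G by (rule WEI_groups_oligo[OF G])
  interpret H: oligo_group H by (rule WEI_groups_oligo[OF H])
  have wei: "wei G" "wei H" using G H by (simp_all add: WEI_groups_iff)
  have "topologically_isomorphic G H \<longleftrightarrow>
      (\<exists>\<theta>. struct_isomorphism coarse_lang (coarse G) (coarse H) \<theta>)"
  proof
    assume "topologically_isomorphic G H"
    then obtain \<phi> \<psi> where "topo_iso G H \<phi> \<psi>"
      using topologically_isomorphic_iff[OF G.perm_group_axioms H.perm_group_axioms] by blast
    then have "wei_topo_iso G H \<phi> \<psi>"
      by (intro wei_topo_iso.intro wei_topo_iso_axioms.intro G.oligo_group_axioms H.oligo_group_axioms wei)
    then show "\<exists>\<theta>. struct_isomorphism coarse_lang (coarse G) (coarse H) \<theta>"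
      by (rule wei_topo_iso.coarse_isomorphic)
  qed (use coarse_isomorphic_imp_topologically_isomorphic[OF G.oligo_group_axioms H.oligo_group_axioms] in blast)
  then show ?thesis
    using coarse_isomorphic_iff_theory[OF G.oligo_group_axioms H.oligo_group_axioms] by simp
qed

section \<open>Measurability\<close>

lemma space_Effros: "space Effros = closed_subgroups"
  unfolding Effros_def by (rule space_measure_of) auto

text \<open>The bijections with property \<open>U\<close> form an open set, as finitely many values
  decide \<open>U\<close>, and the groups meeting an open set form a generator of the Effros
  structure. The other conditions are reduced to such ones.\<close>

lemma pred_Effros_hit:
  assumes "finite A" "\<And>g h. (\<And>a. a \<in> A \<Longrightarrow> g a = h a) \<Longrightarrow> U g \<longleftrightarrow> U h"
  shows "Measurable.pred Effros (\<lambda>G. \<exists>g\<in>G. U g)"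
proof -
  let ?V = "{g. bij g \<and> U g}"
  have "openin (top_of_set (carrier Sym_omega)) ?V"
    unfolding openin_pointwise_iff BijGroup_UNIV_simps
  proof (intro conjI ballI)
    fix g assume g: "g \<in> ?V"
    have "U h" if "\<forall>a\<in>A. h a = g a" for h using assms(2)[of h g] that g by blast
    then show "\<exists>A. finite A \<and> {h \<in> Collect bij. \<forall>a\<in>A. h a = g a} \<subseteq> ?V"
      using assms(1) by (intro exI[of _ A]) auto
  qed auto
  then have "{G \<in> closed_subgroups. G \<inter> ?V \<noteq> {}} \<in> sets Effros"
    unfolding Effros_def by (subst sets_measure_of) (auto intro: sigma_sets.Basic)
  moreover have "bij g" if "G \<in> closed_subgroups" "g \<in> G" for G g
    using that by (auto simp: closed_subgroups_iff perm_group.bij)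
  then have "{G \<in> closed_subgroups. G \<inter> ?V \<noteq> {}} = {G \<in> space Effros. \<exists>g\<in>G. U g}"
    unfolding space_Effros by blast
  ultimately show ?thesis by (simp add: pred_def)
qed

lemma pred_Effros_map: "Measurable.pred Effros (\<lambda>G. \<exists>g\<in>G. map g xs = vs)"
proof (rule pred_Effros_hit[where A = "set xs"])
  fix g h :: "nat \<Rightarrow> nat" assume "\<And>a. a \<in> set xs \<Longrightarrow> g a = h a"
  then have "map g xs = map h xs" by simp
  then show "map g xs = vs \<longleftrightarrow> map h xs = vs" by (simp only:)
qed simp

lemma pred_Effros_cong:
  assumes "Measurable.pred Effros Q" "\<And>G. perm_group G \<Longrightarrow> P G \<longleftrightarrow> Q G"
  shows "Measurable.pred Effros P"
proof -
  have "{G \<in> space Effros. P G} = {G \<in> space Effros. Q G}"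
    using assms(2) by (auto simp: space_Effros closed_subgroups_iff)
  then show ?thesis using assms(1) by (simp add: pred_def)
qed

text \<open>Finite sets are traded for lists, over which quantification is countable.\<close>

lemma ex_finite_iff_list: "(\<exists>F. finite F \<and> P F) \<longleftrightarrow> (\<exists>l. P (set l))"
  using finite_list by (metis List.finite_set)

lemma pred_oligomorphic: "Measurable.pred Effros oligomorphic"
proof (rule pred_Effros_cong)
  show "Measurable.pred Effros (\<lambda>G. \<forall>n. \<exists>F::nat list list. \<forall>xs::nat list.
      length xs = n \<longrightarrow> (\<exists>ys\<in>set F. \<exists>g\<in>G. map g ys = xs))"
    by (intro pred_intros_countable pred_intros_logic pred_intros_countable_bounded
        measurable_const pred_Effros_map) simp
  show "oligomorphic G \<longleftrightarrow> (\<forall>n. \<exists>F::nat list list. \<forall>xs. length xs = n \<longrightarrow> (\<exists>ys\<in>set F. \<exists>g\<in>G. map g ys = xs))" for G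
    unfolding oligomorphic_def ex_finite_iff_list ..
qed

lemma pred_fin_closed: "Measurable.pred Effros (\<lambda>G. fin_closed G K)"
proof (cases "finite K")
  case True
  \<comment> \<open>A set of natural numbers is finite iff it is bounded, which leaves countable
    quantifiers over the bound \<open>m\<close> and the values \<open>b\<close>.\<close>
  have "finite {g a |g. g \<in> pointwise_stabilizer G K} \<longleftrightarrow>
      (\<exists>m. \<forall>b. b \<ge> m \<longrightarrow> \<not> (\<exists>g\<in>G. (\<forall>k\<in>K. g k = k) \<and> g a = b))" for G a
  proof -
    have "(\<forall>n\<in>{g a |g. g \<in> pointwise_stabilizer G K}. n < m) \<longleftrightarrow>
        (\<forall>b. b \<ge> m \<longrightarrow> \<not> (\<exists>g\<in>G. (\<forall>k\<in>K. g k = k) \<and> g a = b))" for m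
      unfolding pointwise_stabilizer_def not_less[symmetric] by blast
    then show ?thesis unfolding finite_nat_set_iff_bounded by simp
  qed
  note orbit = this
  have fc: "fin_closed G K \<longleftrightarrow> (\<forall>a. a \<notin> K \<longrightarrow>
      \<not> (\<exists>m. \<forall>b. b \<ge> m \<longrightarrow> \<not> (\<exists>g\<in>G. (\<forall>k\<in>K. g k = k) \<and> g a = b)))" for G
  proof -
    have "fin_closed G K \<longleftrightarrow> (\<forall>a. a \<notin> K \<longrightarrow> \<not> finite {g a |g. g \<in> pointwise_stabilizer G K})"
      unfolding fin_closed_def acl_def algebraic_over_def using True by blast
    then show ?thesis by (simp only: orbit)
  qed
  have hit: "Measurable.pred Effros (\<lambda>G. \<exists>g\<in>G. (\<forall>k\<in>K. g k = k) \<and> g a = b)" for a b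
    by (rule pred_Effros_hit[where A = "insert a K"]) (use True in auto)
  have "Measurable.pred Effros (\<lambda>G. \<forall>a. a \<notin> K \<longrightarrow>
      \<not> (\<exists>m. \<forall>b. b \<ge> m \<longrightarrow> \<not> (\<exists>g\<in>G. (\<forall>k\<in>K. g k = k) \<and> g a = b)))"
    by (intro pred_intros_countable pred_intros_logic measurable_const hit) simp_all
  then show ?thesis by (simp only: fc)
next
  case False
  then show ?thesis by (simp add: fin_closed_def)
qed

subsection \<open>Coding open subgroups\<close>

text \<open>The equation says that \<open>g\<close> fixes the tuple \<open>xs\<close> and sends
  \<open>ys\<close> to \<open>vs\<close>: the tuple \<open>vs\<close> lies in the orbit of a member
  of \<open>B\<close> under the stabilizer of \<open>xs\<close>.\<close>

definition in_code :: "(nat \<Rightarrow> nat) set \<Rightarrow> nat list \<Rightarrow> nat list list \<Rightarrow> nat list \<Rightarrow> bool" where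
  "in_code G xs B vs \<longleftrightarrow> (\<exists>ys\<in>set B. \<exists>g\<in>G. map g (xs @ ys) = xs @ vs)"

text \<open>
  An open subgroup containing the stabilizer of \<open>xs\<close> is determined by the orbit of \<open>xs\<close>,
  which is a finite union of orbits under that stabilizer, represented by the tuples in \<open>B\<close>.
\<close>

definition code_subgroup :: "(nat \<Rightarrow> nat) set \<Rightarrow> nat list \<Rightarrow> nat list list \<Rightarrow> (nat \<Rightarrow> nat) set" where
  "code_subgroup G xs B = {g \<in> G. in_code G xs B (map g xs)}"

lemma pred_in_code: "Measurable.pred Effros (\<lambda>G. in_code G xs B vs)"
  unfolding in_code_def
  by (intro pred_intros_countable_bounded pred_Effros_map)

text \<open>Codes form a countable type, so quantification over open subgroups becomes countable. A
  finite \<open>B\<close> suffices because tuples of twice the length of \<open>xs\<close> fall into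
  finitely many orbits.\<close>

lemma (in oligo_group) open_subgroup_coded:
  assumes H: "open_subgroup G H"
  shows "\<exists>xs B. H = code_subgroup G xs B"
proof -
  interpret H: perm_group H using H by (simp add: open_subgroup_def)
  have HG: "H \<subseteq> G" using H by (simp add: open_subgroup_def)
  obtain A where A: "finite A" "stab A \<subseteq> H" using H by (auto simp: open_subgroup_def)
  obtain xs where xs: "set xs = A" using A(1) finite_list by blast
  have fix_mem: "g \<in> H" if "g \<in> G" "map g xs = xs" for g
  proof -
    have "map g xs = map id xs" using that(2) by simp
    then have "\<forall>a\<in>set xs. g a = id a" by (simp only: map_eq_conv)
    then show ?thesis using A(2) that(1) xs by (auto simp: stab_iff)
  qed
  define T where "T = (\<lambda>h. map h xs) ` H"
  obtain F where F: "finite F"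
    "\<And>zs. length zs = length xs + length xs \<Longrightarrow> \<exists>ys\<in>F. \<exists>g\<in>G. map g ys = zs"
    by (rule oligomorphicE[OF oligo, where n = "length xs + length xs"], rule that)
  \<comment> \<open>One partner \<open>r zs\<close> is chosen for each representative
    \<open>zs\<close> in use. If \<open>xs @ vs\<close> lies in the same orbit as
    \<open>xs @ r zs\<close>, an element of \<open>G\<close> fixing \<open>xs\<close> takes
    \<open>r zs\<close> to \<open>vs\<close>.\<close>
  define Q where "Q zs vs \<longleftrightarrow> vs \<in> T \<and> (\<exists>g\<in>G. map g zs = xs @ vs)" for zs vs
  define F' where "F' = {zs \<in> F. \<exists>vs. Q zs vs}"
  have "\<forall>zs\<in>F'. \<exists>vs. Q zs vs" by (simp add: F'_def)
  from bchoice[OF this] obtain r where r: "\<And>zs. zs \<in> F' \<Longrightarrow> Q zs (r zs)" by blast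
  obtain B where B: "set B = r ` F'" using F(1) finite_list[of "r ` F'"] by (auto simp: F'_def)
  have "in_code G xs B vs" if "vs \<in> T" for vs
  proof -
    have "length (xs @ vs) = length xs + length xs" using that by (auto simp: T_def)
    then obtain zs g where g: "zs \<in> F" "g \<in> G" "map g zs = xs @ vs" using F(2) by blast
    then have zs: "zs \<in> F'" using that by (auto simp: F'_def Q_def)
    obtain g' where g': "g' \<in> G" "map g' zs = xs @ r zs" using r[OF zs] by (auto simp: Q_def)
    have "map (pinv g') (map g' zs) = zs" using g'(1) by (simp add: inv_comp)
    then have "map (g \<circ> pinv g') (xs @ r zs) = xs @ vs" using g(3) g'(2) by (metis map_map)
    moreover have "g \<circ> pinv g' \<in> G" by (intro comp_mem inv_mem g g')
    ultimately show ?thesis using zs B unfolding in_code_def by blast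
  qed
  moreover have "vs \<in> T" if code: "in_code G xs B vs" for vs
  proof -
    obtain ys g where g: "ys \<in> set B" "g \<in> G" "map g (xs @ ys) = xs @ vs"
      using code by (auto simp: in_code_def)
    then have gx: "map g xs = xs" "map g ys = vs" by simp_all
    have "ys \<in> T" using g(1) B r by (auto simp: Q_def)
    then obtain h where h: "h \<in> H" "ys = map h xs" by (auto simp: T_def)
    have "g \<circ> h \<in> H" by (intro H.comp_mem fix_mem[OF g(2) gx(1)] h)
    moreover have "vs = map (g \<circ> h) xs" using gx(2) h(2) by simp
    ultimately show ?thesis unfolding T_def by blast
  qed
  ultimately have T: "in_code G xs B vs \<longleftrightarrow> vs \<in> T" for vs by blast
  have "g \<in> H" if g: "g \<in> G" "map g xs \<in> T" for g
  proof -
    obtain h where h: "h \<in> H" "map g xs = map h xs" using g(2) by (auto simp: T_def)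
    have "map (pinv h \<circ> g) xs = map (pinv h) (map h xs)" using h(2) by (metis map_map)
    also have "\<dots> = xs" by (simp add: H.inv_comp[OF h(1)])
    finally have "pinv h \<circ> g \<in> H" using fix_mem[of "pinv h \<circ> g"] comp_mem[OF inv_mem g(1)] h(1) HG by blast
    then have "h \<circ> (pinv h \<circ> g) \<in> H" by (rule H.comp_mem[OF h(1)])
    moreover have "h \<circ> (pinv h \<circ> g) = g" using H.apply_inv[OF h(1)] by auto
    ultimately show ?thesis by simp
  qed
  then have "H = code_subgroup G xs B" unfolding code_subgroup_def T using HG by (auto simp: T_def)
  then show ?thesis by blast
qed

lemma (in perm_group) open_subgroup_code_subgroup:
  "open_subgroup G (code_subgroup G xs B) \<longleftrightarrow> perm_group (code_subgroup G xs B)"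
proof
  assume C: "perm_group (code_subgroup G xs B)"
  have "in_code G xs B xs" using perm_group.id_mem[OF C] by (simp add: code_subgroup_def)
  moreover have "map g xs = xs" if "g \<in> pointwise_stabilizer G (set xs)" for g
    using that by (auto simp: pointwise_stabilizer_def intro: map_idI)
  ultimately have "pointwise_stabilizer G (set xs) \<subseteq> code_subgroup G xs B"
    by (auto simp: code_subgroup_def pointwise_stabilizer_def)
  moreover have "code_subgroup G xs B \<subseteq> G" by (auto simp: code_subgroup_def)
  ultimately show "open_subgroup G (code_subgroup G xs B)"
    using C unfolding open_subgroup_def by blast
qed (simp add: open_subgroup_def)

text \<open>The group laws in terms of tuples: in the second clause \<open>us\<close> is the image
  of \<open>xs\<close> under \<open>g \<circ> h\<close>, in the third its image under the inverse of
  \<open>g\<close>. Each quantifier over \<open>G\<close> then concerns finitely many values of one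
  element.\<close>

lemma (in perm_group) perm_group_code_subgroup:
  "perm_group (code_subgroup G xs B) \<longleftrightarrow> in_code G xs B xs \<and>
     (\<forall>vs ws us. in_code G xs B vs \<and> in_code G xs B ws \<and>
        (\<exists>g\<in>G. map g xs = vs \<and> map g ws = us) \<and> (\<exists>h\<in>G. map h xs = ws) \<longrightarrow> in_code G xs B us) \<and>
     (\<forall>vs us. in_code G xs B vs \<and> (\<exists>g\<in>G. map g xs = vs \<and> map g us = xs) \<longrightarrow> in_code G xs B us)"
    (is "?L \<longleftrightarrow> ?id \<and> ?comp \<and> ?inv")
proof
  assume C: ?L
  interpret C: perm_group "code_subgroup G xs B" by (rule C)
  have mem: "g \<in> code_subgroup G xs B \<longleftrightarrow> g \<in> G \<and> in_code G xs B (map g xs)" for g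
    by (simp add: code_subgroup_def)
  have ?id using C.id_mem by (simp add: mem)
  moreover have ?comp
  proof (intro allI impI, elim conjE bexE)
    fix vs ws us g h
    assume a: "in_code G xs B vs" "in_code G xs B ws" "g \<in> G" "map g xs = vs" "map g ws = us"
      "h \<in> G" "map h xs = ws"
    then have "g \<circ> h \<in> code_subgroup G xs B" by (intro C.comp_mem) (simp_all add: mem)
    moreover have "map (g \<circ> h) xs = us" using a(5,7) by (metis map_map)
    ultimately show "in_code G xs B us" unfolding mem by metis
  qed
  moreover have ?inv
  proof (intro allI impI, elim conjE bexE)
    fix vs us g
    assume a: "in_code G xs B vs" "g \<in> G" "map g xs = vs" "map g us = xs"
    then have "pinv g \<in> code_subgroup G xs B" by (intro C.inv_mem) (simp add: mem)
    moreover have "map (pinv g) (map g us) = us" by (simp add: inv_comp[OF a(2)])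
    ultimately show "in_code G xs B us" unfolding mem a(4) by metis
  qed
  ultimately show "?id \<and> ?comp \<and> ?inv" by (intro conjI)
next
  assume a: "?id \<and> ?comp \<and> ?inv"
  have id: ?id using a by (rule conjunct1)
  have comp: ?comp using a[THEN conjunct2] by (rule conjunct1)
  have inv: ?inv using a[THEN conjunct2] by (rule conjunct2)
  show ?L
  proof
    fix g h assume g: "g \<in> code_subgroup G xs B" and h: "h \<in> code_subgroup G xs B"
    have gh: "g \<in> G" "h \<in> G" "in_code G xs B (map g xs)" "in_code G xs B (map h xs)"
      using g h by (simp_all add: code_subgroup_def)
    have "in_code G xs B (map g (map h xs))"
      using comp[rule_format, of "map g xs" "map h xs" "map g (map h xs)"] gh by blast
    then show "g \<circ> h \<in> code_subgroup G xs B"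
      using comp_mem[OF gh(1,2)] by (simp add: code_subgroup_def)
  next
    fix g assume "g \<in> code_subgroup G xs B"
    then have g: "g \<in> G" "in_code G xs B (map g xs)" by (simp_all add: code_subgroup_def)
    have "map g (map (pinv g) xs) = xs" by (simp add: comp_inv[OF g(1)])
    then have "in_code G xs B (map (pinv g) xs)"
      using inv[rule_format, of "map g xs" "map (pinv g) xs"] g by blast
    then show "pinv g \<in> code_subgroup G xs B" using inv_mem[OF g(1)] by (simp add: code_subgroup_def)
  qed (use id in \<open>auto simp: code_subgroup_def bij id_mem\<close>)
qed

lemma supports_code_subgroup:
  "supports G (code_subgroup G xs B) K \<longleftrightarrow> fin_closed G K \<and>
     (\<forall>vs. (\<exists>g\<in>G. (\<forall>k\<in>K. g k = k) \<and> map g xs = vs) \<longrightarrow> in_code G xs B vs) \<and>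
     (\<forall>vs. in_code G xs B vs \<longrightarrow> \<not> (\<exists>g\<in>G. map g xs = vs \<and> g ` K \<noteq> K))"
  unfolding supports_def code_subgroup_def pointwise_stabilizer_def setwise_stabilizer_def by blast

lemma pred_supports:
  assumes "finite K"
  shows "Measurable.pred Effros (\<lambda>G. supports G (code_subgroup G xs B) K)"
proof -
  have 1: "Measurable.pred Effros (\<lambda>G. \<exists>g\<in>G. (\<forall>k\<in>K. g k = k) \<and> map g xs = vs)" for vs
  proof (rule pred_Effros_hit[where A = "K \<union> set xs"])
    fix g h :: "nat \<Rightarrow> nat" assume gh: "\<And>a. a \<in> K \<union> set xs \<Longrightarrow> g a = h a"
    have "map g xs = map h xs" "(\<forall>k\<in>K. g k = k) \<longleftrightarrow> (\<forall>k\<in>K. h k = k)" using gh by auto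
    then show "((\<forall>k\<in>K. g k = k) \<and> map g xs = vs) \<longleftrightarrow> ((\<forall>k\<in>K. h k = k) \<and> map h xs = vs)"
      by (simp only:)
  qed (use assms in simp)
  have 2: "Measurable.pred Effros (\<lambda>G. \<exists>g\<in>G. map g xs = vs \<and> g ` K \<noteq> K)" for vs
  proof (rule pred_Effros_hit[where A = "K \<union> set xs"])
    fix g h :: "nat \<Rightarrow> nat" assume gh: "\<And>a. a \<in> K \<union> set xs \<Longrightarrow> g a = h a"
    have "map g xs = map h xs" "g ` K = h ` K" using gh by (auto intro: image_cong)
    then show "(map g xs = vs \<and> g ` K \<noteq> K) \<longleftrightarrow> (map h xs = vs \<and> h ` K \<noteq> K)" by (simp only:)
  qed (use assms in simp)
  show ?thesis
    unfolding supports_code_subgroup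
    by (intro pred_intros_logic pred_intros_countable pred_fin_closed pred_in_code 1 2)
qed

lemma pred_perm_group_code_subgroup: "Measurable.pred Effros (\<lambda>G. perm_group (code_subgroup G xs B))"
proof (rule pred_Effros_cong[OF _ perm_group.perm_group_code_subgroup])
  have 1: "Measurable.pred Effros (\<lambda>G. \<exists>g\<in>G. map g xs = vs \<and> map g ws = us)" for vs ws us :: "nat list"
  proof (rule pred_Effros_hit[where A = "set xs \<union> set ws"])
    fix g h :: "nat \<Rightarrow> nat" assume gh: "\<And>a. a \<in> set xs \<union> set ws \<Longrightarrow> g a = h a"
    have "map g xs = map h xs" "map g ws = map h ws" using gh by auto
    then show "(map g xs = vs \<and> map g ws = us) \<longleftrightarrow> (map h xs = vs \<and> map h ws = us)" by (simp only:)
  qed simp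
  show "Measurable.pred Effros (\<lambda>G. in_code G xs B xs \<and>
     (\<forall>vs ws us. in_code G xs B vs \<and> in_code G xs B ws \<and>
        (\<exists>g\<in>G. map g xs = vs \<and> map g ws = us) \<and> (\<exists>h\<in>G. map h xs = ws) \<longrightarrow> in_code G xs B us) \<and>
     (\<forall>vs us. in_code G xs B vs \<and> (\<exists>g\<in>G. map g xs = vs \<and> map g us = xs) \<longrightarrow> in_code G xs B us))"
    by (intro pred_intros_logic pred_intros_countable pred_in_code 1 pred_Effros_map)
qed

text \<open>Weak elimination of imaginaries with codes for open subgroups and lists for supports, so
  that all quantifiers outside the atomic conditions are countable.\<close>

definition coded_wei :: "(nat \<Rightarrow> nat) set \<Rightarrow> bool" where
  "coded_wei G \<longleftrightarrow> (\<forall>xs B. perm_group (code_subgroup G xs B) \<longrightarrow>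
     (\<exists>ks. supports G (code_subgroup G xs B) (set ks) \<and>
       (\<forall>ks'. supports G (code_subgroup G xs B) (set ks') \<longrightarrow> set ks \<subseteq> set ks')))"

lemma (in oligo_group) wei_iff_coded: "wei G \<longleftrightarrow> coded_wei G"
proof -
  have fin: "\<exists>ks. K = set ks" if "supports G H K" for H K
  proof -
    have "finite K" using that by (simp add: supports_def fin_closed_def)
    from finite_list[OF this] show ?thesis by metis
  qed
  have code: "(\<exists>K. supports G H K \<and> (\<forall>K'. supports G H K' \<longrightarrow> K \<subseteq> K')) \<longleftrightarrow>
      (\<exists>ks. supports G H (set ks) \<and> (\<forall>ks'. supports G H (set ks') \<longrightarrow> set ks \<subseteq> set ks'))" for H
    using fin by metis
  show ?thesis
  proof
    assume "wei G"
    then show "coded_wei G"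
      unfolding wei_def coded_wei_def code open_subgroup_code_subgroup[symmetric] by blast
  next
    assume c: "coded_wei G"
    show "wei G"
      unfolding wei_def code
    proof (intro allI impI)
      fix H assume H: "open_subgroup G H"
      then obtain xs B where B: "H = code_subgroup G xs B" using open_subgroup_coded by blast
      then have "perm_group (code_subgroup G xs B)" using H by (simp add: open_subgroup_def)
      then show "\<exists>ks. supports G H (set ks) \<and> (\<forall>ks'. supports G H (set ks') \<longrightarrow> set ks \<subseteq> set ks')"
        using c unfolding B coded_wei_def by blast
    qed
  qed
qed

lemma sets_WEI_groups: "WEI_groups \<in> sets Effros"
proof -
  have "Measurable.pred Effros coded_wei"
    unfolding coded_wei_def
    by (intro pred_intros_logic pred_intros_countable pred_supports pred_perm_group_code_subgroup
        measurable_const finite_set) simp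
  then have "Measurable.pred Effros (\<lambda>G. oligomorphic G \<and> coded_wei G)"
    by (intro pred_intros_logic pred_oligomorphic)
  moreover have "WEI_groups = {G \<in> space Effros. oligomorphic G \<and> coded_wei G}"
  proof (rule Set.set_eqI)
    fix G
    have "oligo_group G" if "G \<in> closed_subgroups" "oligomorphic G"
      using that by (simp add: closed_subgroups_iff oligo_group_def oligo_group_axioms_def)
    then show "G \<in> WEI_groups \<longleftrightarrow> G \<in> {G \<in> space Effros. oligomorphic G \<and> coded_wei G}"
      using oligo_group.wei_iff_coded[of G] by (auto simp: WEI_groups_iff space_Effros)
  qed
  ultimately show ?thesis by (simp add: pred_def)
qed

subsection \<open>The invariant\<close>

lemma pred_partials: "Measurable.pred Effros (\<lambda>G. p \<in> partials G)"
proof (cases "finite p")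
  case True
  have "p \<in> partials G \<longleftrightarrow> fin_closed G (Domain p) \<and> (\<exists>g\<in>G. p = part g (Domain p))" for G
  proof -
    have dom: "Domain (part g K) = K" for g K by (auto simp: part_def)
    show ?thesis
    proof
      assume "p \<in> partials G"
      then obtain g K where "g \<in> G" "fin_closed G K" "p = part g K" by (auto simp: partials_def)
      then show "fin_closed G (Domain p) \<and> (\<exists>g\<in>G. p = part g (Domain p))" using dom by auto
    next
      assume *: "fin_closed G (Domain p) \<and> (\<exists>g\<in>G. p = part g (Domain p))"
      then obtain g where "g \<in> G" "p = part g (Domain p)" by blast
      then show "p \<in> partials G"
        unfolding partials_def mem_Collect_eq using * by (intro exI[of _ g] exI[of _ "Domain p"] conjI) auto
    qed
  qed
  moreover have "Measurable.pred Effros (\<lambda>G. \<exists>g\<in>G. p = part g (Domain p))"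
    by (rule pred_Effros_hit[where A = "Domain p"])
      (use True in \<open>auto simp: part_def finite_Domain cong: image_cong\<close>)
  ultimately show ?thesis using pred_fin_closed by simp
next
  case False
  then have "p \<notin> partials G" for G by (auto simp: partials_def part_def fin_closed_def)
  then show ?thesis by simp
qed

text \<open>The bound is rewritten with a finite quantifier: some family \<open>Q\<close> of at most
  \<open>r\<close> subsets of \<open>p\<close> contains all partial maps below \<open>p\<close>.
  This is a finite Boolean combination of conditions \<open>q \<in> partials G\<close>.\<close>

lemma pred_card_below:
  assumes "finite p"
  shows "Measurable.pred Effros (\<lambda>G. card (below G p) \<le> r)"
proof -
  have sub: "below G p \<subseteq> Pow p" for G by (auto simp: below_def)
  have fin: "finite (below G p)" for G by (rule finite_subset[OF sub]) (simp add: assms)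
  have "card (below G p) \<le> r \<longleftrightarrow> (\<exists>Q\<in>Pow (Pow p). card Q \<le> r \<and> (\<forall>q\<in>Pow p. q \<in> partials G \<longrightarrow> q \<in> Q))" for G
  proof
    assume "card (below G p) \<le> r"
    then show "\<exists>Q\<in>Pow (Pow p). card Q \<le> r \<and> (\<forall>q\<in>Pow p. q \<in> partials G \<longrightarrow> q \<in> Q)"
      using sub by (intro bexI[of _ "below G p"]) (auto simp: below_def)
  next
    assume "\<exists>Q\<in>Pow (Pow p). card Q \<le> r \<and> (\<forall>q\<in>Pow p. q \<in> partials G \<longrightarrow> q \<in> Q)"
    then obtain Q where "Q \<in> Pow (Pow p)" and Q: "card Q \<le> r" "\<forall>q\<in>Pow p. q \<in> partials G \<longrightarrow> q \<in> Q"
      by (elim bexE conjE) (rule that)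
    then have QP: "Q \<subseteq> Pow p" by simp
    have sub_Q: "below G p \<subseteq> Q" using Q(2) by (auto simp: below_def)
    have "finite Q" by (rule finite_subset[OF QP]) (simp add: assms)
    then show "card (below G p) \<le> r" using card_mono[OF _ sub_Q] Q(1) by linarith
  qed
  moreover have "Measurable.pred Effros
      (\<lambda>G. \<exists>Q\<in>Pow (Pow p). card Q \<le> r \<and> (\<forall>q\<in>Pow p. q \<in> partials G \<longrightarrow> q \<in> Q))"
    by (intro pred_intros_finite pred_intros_logic pred_partials measurable_const)
      (simp_all add: assms)
  ultimately show ?thesis by simp
qed

lemma eval_coarse: "eval_term (coarse G) e t = (case t of Var x \<Rightarrow> e x | App f ts \<Rightarrow> {})"
  by (cases t) (simp_all add: coarse_def)

text \<open>The universe of \<open>coarse G\<close> varies with \<open>G\<close>, so assignments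
  take values among all finite relations, and a quantifier becomes a countable union over lists
  \<open>a\<close> subject to \<open>set a \<in> partials G\<close>.\<close>

lemma pred_satisfies_coarse:
  "(\<And>i. finite (e i)) \<Longrightarrow> Measurable.pred Effros (\<lambda>G. satisfies (coarse G) e \<phi>)"
proof (induction \<phi> arbitrary: e)
  case (Equal s t)
  then show ?case by (simp add: eval_coarse)
next
  case (Atom r ts)
  define ps where "ps = map (\<lambda>t. case t of Var x \<Rightarrow> e x | App f ts \<Rightarrow> {}) ts"
  have fin: "finite p" if "p \<in> set ps" for p
    using that Atom.prems by (auto simp: ps_def split: fo_term.splits)
  have "satisfies (coarse G) e (Atom r ts) \<longleftrightarrow> rel_interp (coarse G) r ps" for G
  proof -
    have "map (eval_term (coarse G) e) ts = ps" by (simp add: ps_def eval_coarse)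
    then show ?thesis by (simp only: satisfies.simps)
  qed
  moreover have "Measurable.pred Effros (\<lambda>G. rel_interp (coarse G) r ps)"
  proof (cases ps)
    case ps: (Cons p qs)
    show ?thesis
    proof (cases qs)
      case Nil
      then show ?thesis using pred_card_below[of p r] fin by (simp add: ps rel_coarse_simps)
    next
      case qs: (Cons q ss)
      show ?thesis
      proof (cases ss)
        case ss: (Cons s ts)
        show ?thesis by (cases ts) (simp_all add: ps qs ss rel_coarse_simps)
      qed (simp add: ps qs rel_coarse_simps)
    qed
  qed (simp add: rel_coarse_simps)
  ultimately show ?case by simp
next
  case (Neg p)
  then show ?case by (auto intro: pred_intros_logic)
next
  case (Conj p q)
  then show ?case by (auto intro!: pred_intros_logic)
next
  case (Exist x p)
  have "satisfies (coarse G) e (Exist x p) \<longleftrightarrow>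
      (\<exists>a::(nat \<times> nat) list. set a \<in> partials G \<and> satisfies (coarse G) (e(x := set a)) p)" for G
  proof -
    have "\<exists>l. a = set l" if "a \<in> partials G" for a
    proof -
      have "finite a" using that by (auto simp: partials_def part_def fin_closed_def)
      from finite_list[OF this] show ?thesis by metis
    qed
    then show ?thesis unfolding satisfies.simps univ_coarse by metis
  qed
  moreover have "Measurable.pred Effros
      (\<lambda>G. \<exists>a::(nat \<times> nat) list. set a \<in> partials G \<and> satisfies (coarse G) (e(x := set a)) p)"
    by (intro pred_intros_countable pred_intros_logic pred_partials Exist.IH) (simp add: Exist.prems)
  ultimately show ?case by (simp only:)
qed

section \<open>Coding a theory by a real number\<close>

definition ternary :: "nat set \<Rightarrow> real" where
  "ternary A = (\<Sum>n. if n \<in> A then (1 / 3) ^ n else 0)"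

lemma summable_ternary: "summable (\<lambda>n. if n \<in> A then (1 / 3 :: real) ^ n else 0)"
  by (rule summable_comparison_test'[of "\<lambda>n. (1 / 3 :: real) ^ n" 0]) (simp_all add: summable_geometric)

text \<open>At the first difference \<open>k\<close> the term \<open>(1 / 3) ^ k\<close> exceeds the
  sum of all later terms, which is at most half of it. With powers of one half the later terms could
  make up for it exactly, and the coding would not be injective.\<close>

lemma ternary_inj:
  assumes "ternary A = ternary B"
  shows "A = B"
proof (rule ccontr)
  have less: "ternary A < ternary B"
    if k: "k \<in> B" "k \<notin> A" "\<And>n. n < k \<Longrightarrow> n \<in> A \<longleftrightarrow> n \<in> B" for A B k
  proof -
    define t where "t A n = (if n \<in> A then (1 / 3 :: real) ^ n else 0)" for A :: "nat set" and n
    have sm: "summable (t A)" for A unfolding t_def by (rule summable_ternary)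
    have sh: "summable (\<lambda>n. t A (n + Suc k))" for A using sm[of A] by (simp only: summable_iff_shift)
    have split: "ternary A = (\<Sum>n. t A (n + Suc k)) + sum (t A) {..<Suc k}" for A
      unfolding ternary_def t_def[symmetric] by (rule suminf_split_initial_segment[OF sm])
    have geo: "summable (\<lambda>n. (1 / 3 :: real) ^ (n + Suc k))"
      by (subst summable_iff_shift) (simp add: summable_geometric)
    have "(\<Sum>n. t A (n + Suc k)) \<le> (\<Sum>n. (1 / 3 :: real) ^ (n + Suc k))"
      by (rule suminf_le[OF _ sh geo]) (simp add: t_def)
    also have "\<dots> = (\<Sum>n. (1 / 3) ^ Suc k * (1 / 3 :: real) ^ n)"
      by (simp add: power_add mult_ac)
    also have "\<dots> = (1 / 3) ^ Suc k * (\<Sum>n. (1 / 3 :: real) ^ n)"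
      by (rule suminf_mult) (simp add: summable_geometric)
    also have "\<dots> = (1 / 3) ^ k / 2" by (simp add: suminf_geometric)
    finally have A: "(\<Sum>n. t A (n + Suc k)) \<le> (1 / 3) ^ k / 2" .
    have "sum (t A) {..<k} = sum (t B) {..<k}" by (rule sum.cong) (use k(3) in \<open>auto simp: t_def\<close>)
    then have "sum (t B) {..<Suc k} = sum (t A) {..<Suc k} + (1 / 3) ^ k"
      using k(1,2) by (simp add: t_def[of _ k])
    moreover have "0 \<le> (\<Sum>n. t B (n + Suc k))"
      by (rule suminf_nonneg[OF sh]) (simp add: t_def)
    moreover have "(0::real) < (1 / 3) ^ k" by simp
    ultimately show ?thesis unfolding split[of A] split[of B] using A by linarith
  qed
  assume "A \<noteq> B"
  then have ex: "\<exists>n. (n \<in> A) \<noteq> (n \<in> B)" by blast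
  define k where "k = (LEAST n. (n \<in> A) \<noteq> (n \<in> B))"
  have k: "(k \<in> A) \<noteq> (k \<in> B)" unfolding k_def by (rule LeastI_ex[OF ex])
  have "n \<in> A \<longleftrightarrow> n \<in> B" if "n < k" for n using not_less_Least[of n] that unfolding k_def by blast
  then show False using less[of k A B] less[of k B A] k assms by auto
qed

text \<open>The truth of a sentence does not depend on the constant environment used here.\<close>

definition invariant :: "(nat \<Rightarrow> nat) set \<Rightarrow> real" where
  "invariant G = ternary {n. sentence coarse_lang (from_nat n) \<and>
     satisfies (coarse G) (\<lambda>_. {}) (from_nat n)}"

lemma measurable_invariant: "invariant \<in> borel_measurable Effros"
proof -
  have "Measurable.pred Effros (\<lambda>G. n \<in> {n. sentence coarse_lang (from_nat n) \<and>
     satisfies (coarse G) (\<lambda>_. {}) (from_nat n)})" for n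
    unfolding mem_Collect_eq by (intro pred_intros_logic pred_satisfies_coarse measurable_const) simp_all
  then show ?thesis
    unfolding invariant_def ternary_def
    by (intro borel_measurable_suminf measurable_If measurable_const) (simp_all add: pred_def)
qed

lemma invariant_eq_iff:
  assumes "oligo_group G" "oligo_group H"
  shows "invariant G = invariant H \<longleftrightarrow> theory_of coarse_lang (coarse G) = theory_of coarse_lang (coarse H)"
proof -
  have th: "theory_of coarse_lang (coarse G) =
      {p. sentence coarse_lang p \<and> satisfies (coarse G) (\<lambda>_. {}) p}" if "oligo_group G" for G
  proof -
    interpret oligo_group G by (rule that)
    have "univ (coarse G) \<noteq> {}" using is_structure_coarse by (simp add: is_structure_def)
    from env_nonempty[OF this] obtain e where e: "e \<in> env (coarse G)" ..
    have "holds_in (coarse G) p \<longleftrightarrow> satisfies (coarse G) (\<lambda>_. {}) p" if p: "sentence coarse_lang p" for p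
    proof -
      have "satisfies (coarse G) e p \<longleftrightarrow> satisfies (coarse G) (\<lambda>_. {}) p"
        by (rule satisfies_cong) (use p in \<open>simp add: sentence_def\<close>)
      then show ?thesis using holds_in_iff[OF p e] by simp
    qed
    then show ?thesis by (auto simp: theory_of_def)
  qed
  have "{n. (from_nat n :: fo_formula) \<in> S} = {n. from_nat n \<in> T} \<longleftrightarrow> S = T" for S T
    using surj_from_nat by (metis (mono_tags, lifting) Collect_eqI Collect_mem_eq mem_Collect_eq from_nat_to_nat subsetI subset_antisym)
  from this[of "theory_of coarse_lang (coarse G)" "theory_of coarse_lang (coarse H)"]
  show ?thesis
    unfolding invariant_def using ternary_inj by (auto simp: th[OF assms(1)] th[OF assms(2)])
qed

lemma standard_borel_borel: "standard_borel (borel :: real measure)"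
  unfolding standard_borel_def
proof (intro exI conjI)
  show "completely_metrizable_space (euclidean :: real topology)"
    by (rule completely_metrizable_space_euclidean)
  show "second_countable (euclidean :: real topology)"
  proof -
    obtain B :: "real set set" where B: "countable B" "topological_basis B"
      using ex_countable_basis by blast
    have "\<exists>V\<in>B. x \<in> V \<and> V \<subseteq> U" if "open U" "x \<in> U" for U x
      by (rule topological_basisE[OF B(2) that]) blast
    then show ?thesis
      unfolding second_countable_def open_openin[symmetric]
      using B(1) topological_basis_open[OF B(2)] by (intro exI[of _ B] conjI ballI allI impI) simp_all
  qed
  show "sets (borel :: real measure) = sigma_sets (topspace euclidean) {U. openin euclidean U}"
    unfolding borel_def open_openin[symmetric] topspace_euclidean
    by (subst sets_measure_of) simp_all
qed simp

theorem theorem1p1: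
  shows "WEI_groups \<in> sets Effros \<and>
    (\<exists>(Y :: real measure) (f :: (nat \<Rightarrow> nat) set \<Rightarrow> real).
       standard_borel Y \<and>
       f \<in> measurable (restrict_space Effros WEI_groups) Y \<and>
       (\<forall>G\<in>WEI_groups. \<forall>H\<in>WEI_groups. topologically_isomorphic G H \<longleftrightarrow> f G = f H))"
proof (intro conjI exI ballI)
  show "WEI_groups \<in> sets Effros" by (rule sets_WEI_groups)
  show "standard_borel (borel :: real measure)" by (rule standard_borel_borel)
  show "invariant \<in> borel_measurable (restrict_space Effros WEI_groups)"
    by (rule measurable_restrict_space1[OF measurable_invariant])
  fix G H assume G: "G \<in> WEI_groups" and H: "H \<in> WEI_groups"
  show "topologically_isomorphic G H \<longleftrightarrow> invariant G = invariant H"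
    unfolding invariant_eq_iff[OF WEI_groups_oligo[OF G] WEI_groups_oligo[OF H]]
    by (rule topologically_isomorphic_iff_theory[OF G H])
qed

end
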